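(* Let $m\in\mathbb{N}$, let $p\in(1,\infty)$, let $E\subset\mathbb{R}$ be a (nonempty) closed set and let $f:E\to\mathbb{R}$. Then $f\in W^m_p(\mathbb{R})|_E$ if and only if the function $f^{\#}_{k,E}$ belongs to $L_p(\mathbb{R})$ for every $k=0,\dots,m$. Furthermore, $$\|f\|_{W^m_p(\mathbb{R})|_E}\sim\sum_{k=0}^m\|f^{\#}_{k,E}\|_{L_p(\mathbb{R})}$$ with constants in this equivalence depending only on $m$ and $p$ (i.e. each side is at most $C$ times the other, with $C\ge1$ depending only on $m$ and $p$).
   Context: $W^m_p(\mathbb{R})$ is the space of functions $F:\mathbb{R}\to\mathbb{R}$ such that $F^{(m-1)}$ exists and is (locally) absolutely continuous and the derivatives of $F$ of all orders $0,\dots,m$ belong to $L_p(\mathbb{R})$, normed by $\|F\|_{W^m_p(\mathbb{R})}=\sum_{k=0}^m\|F^{(k)}\|_{L_p(\mathbb{R})}$. The trace space is $W^m_p(\mathbb{R})|_E=\{f:E\to\mathbb{R}:\exists F\in W^m_p(\mathbb{R}),\,F|_E=f\}$ with trace norm $\|f\|_{W^m_p(\mathbb{R})|_E}=\inf\{\|F\|_{W^m_p(\mathbb{R})}:F\in W^m_p(\mathbb{R}),\,F|_E=f\}$. For a $(k+1)$-point set $S\subset\mathbb{R}$, the divided difference $\Delta^kf[S]$ is the coefficient of $x^k$ in the Lagrange polynomial of degree at most $k$ which agrees with $f$ on $S$. Also $\operatorname{dist}(x,S)=\inf_{s\in S}|x-s|$ and $\operatorname{diam}$ denotes diameter. For $0\le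 k\le m-1$ and $x\in\mathbb{R}$, $$f^{\#}_{k,E}(x)=\sup_{S\subset E,\ \#S=k+1,\ \operatorname{dist}(x,S)\le1}|\Delta^kf[S]|,$$ and for $k=m$, $$f^{\#}_{m,E}(x)=\sup_{S\subset E,\ \#S=m+1,\ \operatorname{dist}(x,S)\le1}\frac{\operatorname{diam}S}{\operatorname{diam}(S\cup\{x\})}\,|\Delta^mf[S]|.$$ If the family of sets $S$ satisfying these conditions is empty, $f^{\#}_{k,E}(x)=0$. *)

theory Defs
  imports "HOL-Analysis.Analysis" "HOL-Computational_Algebra.Polynomial"
begin

text \<open>The spaces \<open>L\<^sub>p(\<real>)\<close>, for \<open>0 < p < \<infinity>\<close>. Norms are extended nonnegative reals, and the sharp maximal
  functions below may take the value \<open>\<infinity>\<close>, so the norm is defined for functions into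
  \<^typ>\<open>ennreal\<close>; the norm of a real function \<open>F\<close> is that of \<open>\<bar>F\<bar>\<close>.\<close>

definition ennreal_powr :: "ennreal \<Rightarrow> real \<Rightarrow> ennreal" where
  "ennreal_powr t r = (if t = \<infinity> then \<infinity> else ennreal (enn2real t powr r))"

definition Lp_norm :: "real \<Rightarrow> (real \<Rightarrow> ennreal) \<Rightarrow> ennreal" where
  "Lp_norm p g = ennreal_powr (\<integral>\<^sup>+ x. ennreal_powr (g x) p \<partial>lebesgue) (1 / p)"

definition Lp_ennreal :: "real \<Rightarrow> (real \<Rightarrow> ennreal) set" where
  "Lp_ennreal p = {g. g \<in> borel_measurable lebesgue \<and> Lp_norm p g < \<infinity>}"

definition Lp_real :: "real \<Rightarrow> (real \<Rightarrow> real) set" where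
  "Lp_real p = {F. F \<in> borel_measurable lebesgue \<and> Lp_norm p (\<lambda>x. ennreal \<bar>F x\<bar>) < \<infinity>}"

text \<open>Absolute continuity on every compact interval. The finite families of non-overlapping intervals
  are the divisions \<open>D\<close> of subsets of \<open>{a..b}\<close>; a member \<open>K\<close> of such a family is \<open>{Inf K..Sup K}\<close>.\<close>

definition locally_abs_continuous :: "(real \<Rightarrow> real) \<Rightarrow> bool" where
  "locally_abs_continuous F \<longleftrightarrow>
    (\<forall>a b. \<forall>\<epsilon>>0. \<exists>\<delta>>0. \<forall>D T. D division_of T \<and> T \<subseteq> {a..b} \<and> (\<Sum>K\<in>D. measure lborel K) < \<delta> \<longrightarrow>
       (\<Sum>K\<in>D. \<bar>F (Sup K) - F (Inf K)\<bar>) < \<epsilon>)"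

text \<open>The Sobolev space \<open>W\<^sup>m\<^sub>p(\<real>)\<close>, for \<open>m \<ge> 1\<close>. The derivatives of order at most \<open>m - 1\<close> exist everywhere.
  That of order \<open>m\<close> exists almost everywhere, by absolute continuity, and the values of \<^const>\<open>deriv\<close>
  on the exceptional null set are irrelevant.\<close>

definition sobolev :: "nat \<Rightarrow> real \<Rightarrow> (real \<Rightarrow> real) set" where
  "sobolev m p = {F.
     (\<forall>k. Suc k < m \<longrightarrow> (deriv ^^ k) F differentiable_on UNIV) \<and>
     locally_abs_continuous ((deriv ^^ (m - 1)) F) \<and>
     (\<forall>k\<le>m. (deriv ^^ k) F \<in> Lp_real p)}"

definition sobolev_norm :: "nat \<Rightarrow> real \<Rightarrow> (real \<Rightarrow> real) \<Rightarrow> ennreal" where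
  "sobolev_norm m p F = (\<Sum>k\<le>m. Lp_norm p (\<lambda>x. ennreal \<bar>(deriv ^^ k) F x\<bar>))"

text \<open>A function \<open>f : E \<rightarrow> \<real>\<close> is represented by a total function; none of the following depends on its
  values outside \<open>E\<close>.\<close>

definition extensions :: "nat \<Rightarrow> real \<Rightarrow> real set \<Rightarrow> (real \<Rightarrow> real) \<Rightarrow> (real \<Rightarrow> real) set" where
  "extensions m p E f = {F \<in> sobolev m p. \<forall>x\<in>E. F x = f x}"

definition trace_space :: "nat \<Rightarrow> real \<Rightarrow> real set \<Rightarrow> (real \<Rightarrow> real) set" where
  "trace_space m p E = {f. \<exists>F. F \<in> extensions m p E f}"

definition trace_norm :: "nat \<Rightarrow> real \<Rightarrow> real set \<Rightarrow> (real \<Rightarrow> real) \<Rightarrow> ennreal" where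
  "trace_norm m p E f = (INF F \<in> extensions m p E f. sobolev_norm m p F)"

text \<open>The next two definitions are meant for sets \<open>S\<close> of exactly \<open>k + 1\<close> points, for which the interpolating
  polynomial exists and is unique.\<close>

definition lagrange_poly :: "nat \<Rightarrow> (real \<Rightarrow> real) \<Rightarrow> real set \<Rightarrow> real poly" where
  "lagrange_poly k f S = (THE q. degree q \<le> k \<and> (\<forall>x\<in>S. poly q x = f x))"

definition divided_difference :: "nat \<Rightarrow> (real \<Rightarrow> real) \<Rightarrow> real set \<Rightarrow> real" where
  "divided_difference k f S = coeff (lagrange_poly k f S) k"

text \<open>The function \<open>f\<^sup>#\<close> of order \<open>k \<le> m\<close>. The supremum of the empty family is \<open>0\<close> in \<^typ>\<open>ennreal\<close>.\<close>

definition sharp :: "nat \<Rightarrow> nat \<Rightarrow> real set \<Rightarrow> (real \<Rightarrow> real) \<Rightarrow> real \<Rightarrow> ennreal" where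
  "sharp m k E f x =
    (SUP S \<in> {S. S \<subseteq> E \<and> finite S \<and> card S = k + 1 \<and> infdist x S \<le> 1}.
       ennreal (if k = m
         then diameter S / diameter (S \<union> {x}) * \<bar>divided_difference k f S\<bar>
         else \<bar>divided_difference k f S\<bar>))"

end

(*
The sharp functions of the trace of F in W^m_p are dominated pointwise by the maximal function of the sum of |F^(j)|,
j <= m: a divided difference over a short set is a value of a derivative divided by a factorial, the recursion formula
reduces long sets to smaller ones, and the L_p bound is the Hardy-Littlewood theorem.

Conversely, let H be the sum of the sharp functions. For a finite subset of E, first continue f by zero to a grid away
from the subset, so that all gaps between consecutive knots x_0 < x_1 < ... are short. Let P_j interpolate f at
x_j, ..., x_(j+m-1). The extension passes from P_j to P_(j+1) across a widest gap of the window x_j, ..., x_(j+m).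
As P_(j+1) - P_j is the divided difference over the window times its length times the product of t - x_l over the
inner knots, and the chosen gap is comparable to the window, the derivatives of order <= m of this extension are bounded
POINTWISE by C H, with C depending only on m. The bound is uniform over all finite subsets of E and makes the
derivatives of order < m equicontinuous with modulus C times the integral of H, so a subsequence along finite sets
exhausting a dense subset of E converges to an extension of f that inherits the pointwise bound.
*)
theory Submission
  imports Defs "HOL-Complex_Analysis.Great_Picard"
begin

section \<open>Divided differences\<close>

text \<open>The extension half needs no maximal function because the weight
  \<open>diameter S / diameter (S \<union> {x})\<close> is 1 for x in the hull of S: a window of
  knots around t is controlled by the sharp functions at t itself. The grid mesh 1/(3m) serves the
  same end. It makes every gap at most 1/m, hence every window of m gaps at most 1 long, as the
  condition \<open>infdist x S \<le> 1\<close> requires. A divided difference that mixes points of E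
  with grid zeros is reduced by the recursion to differences over points of E, with denominators
  bounded below by the mesh.

  Two obstacles shape the rest. The derivative of order m exists only almost everywhere, so a
  fundamental theorem of calculus for absolutely continuous functions is built from variation,
  Radon-Nikodym and Lebesgue differentiation; in the limit the top derivative comes not from
  convergence but from increments dominated by a primitive of C H. Moreover, a sharp function is a
  supremum over an uncountable family, so its measurability rests on the shape of its superlevel
  sets, which are unions of nondegenerate intervals.\<close>

definition nodal :: "real set \<Rightarrow> real poly" where
  "nodal S = (\<Prod>s\<in>S. [:- s, 1:])"

definition interp :: "(real \<Rightarrow> real) \<Rightarrow> real set \<Rightarrow> real poly" where
  "interp f S = lagrange_poly (card S - 1) f S"

text \<open>The order is read off the number of points, so the recursion formulas carry no side
  condition on it.\<close>

definition dd :: "(real \<Rightarrow> real) \<Rightarrow> real set \<Rightarrow> real" where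
  "dd f S = divided_difference (card S - 1) f S"

lemma nodal_empty [simp]: "nodal {} = 1"
  by (simp add: nodal_def)

lemma nodal_insert: "finite S \<Longrightarrow> x \<notin> S \<Longrightarrow> nodal (insert x S) = [:- x, 1:] * nodal S"
  by (simp add: nodal_def)

lemma poly_nodal: "poly (nodal S) x = (\<Prod>s\<in>S. x - s)"
  by (simp add: nodal_def poly_prod)

lemma nodal_monic:
  assumes "finite S"
  shows "degree (nodal S) = card S \<and> coeff (nodal S) (card S) = 1"
  using assms
proof induction
  case (insert x S)
  then have nz: "nodal S \<noteq> 0" by auto
  have "degree (nodal (insert x S)) = Suc (card S)"
    using insert nz by (simp add: nodal_insert degree_mult_eq del: mult_pCons_left)
  moreover have "lead_coeff (nodal (insert x S)) = 1"
    using insert by (simp add: nodal_insert lead_coeff_mult del: mult_pCons_left)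
  ultimately show ?case
    using insert by simp
qed auto

lemma interpolation_unique:
  fixes p q :: "real poly"
  assumes "finite S" "degree p < card S" "degree q < card S"
    and "\<And>x. x \<in> S \<Longrightarrow> poly p x = poly q x"
  shows "p = q"
  by (rule poly_eqI_degree[of S]) (use assms in auto)

lemma interpolation_exists:
  fixes f :: "real \<Rightarrow> real"
  assumes "finite S" "S \<noteq> {}"
  shows "\<exists>q. degree q < card S \<and> (\<forall>x\<in>S. poly q x = f x)"
  using assms
proof (induction rule: finite_ne_induct)
  case (singleton x)
  show ?case by (rule exI[of _ "[:f x:]"]) simp
next
  case (insert x S)
  then obtain q where q: "degree q < card S" "\<forall>x\<in>S. poly q x = f x" by auto
  have n0: "poly (nodal S) x \<noteq> 0"
    using insert by (auto simp: poly_nodal)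
  have nS: "poly (nodal S) y = 0" if "y \<in> S" for y
    using insert that by (auto simp: poly_nodal)
  define r where "r = q + smult ((f x - poly q x) / poly (nodal S) x) (nodal S)"
  have "degree r < card (insert x S)"
    using q(1) insert nodal_monic[of S] degree_add_le_max[of q "smult ((f x - poly q x) / poly (nodal S) x) (nodal S)"]
      degree_smult_le[of "(f x - poly q x) / poly (nodal S) x" "nodal S"]
    unfolding r_def by simp
  moreover have "\<forall>y\<in>insert x S. poly r y = f y"
    using q n0 nS by (auto simp: r_def)
  ultimately show ?case by blast
qed

lemma
  assumes "finite S" "S \<noteq> {}"
  shows degree_interp: "degree (interp f S) < card S"
    and poly_interp: "x \<in> S \<Longrightarrow> poly (interp f S) x = f x"
proof -
  have c: "card S > 0" using assms by (simp add: card_gt_0_iff)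
  obtain q where q: "degree q < card S" "\<forall>x\<in>S. poly q x = f x"
    using interpolation_exists[OF assms] by blast
  have "\<exists>!q. degree q \<le> card S - 1 \<and> (\<forall>x\<in>S. poly q x = f x)"
  proof (rule ex1I[of _ q])
    show "degree q \<le> card S - 1 \<and> (\<forall>x\<in>S. poly q x = f x)" using q by auto
    show "r = q" if "degree r \<le> card S - 1 \<and> (\<forall>x\<in>S. poly r x = f x)" for r
      by (rule interpolation_unique[of S]) (use that q assms c in auto)
  qed
  from theI'[OF this] have "degree (interp f S) \<le> card S - 1 \<and> (\<forall>x\<in>S. poly (interp f S) x = f x)"
    unfolding interp_def lagrange_poly_def .
  then show "degree (interp f S) < card S" "x \<in> S \<Longrightarrow> poly (interp f S) x = f x"
    using c by auto
qed

lemma interp_eqI: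
  assumes "finite S" "S \<noteq> {}" "degree q < card S" "\<And>x. x \<in> S \<Longrightarrow> poly q x = f x"
  shows "interp f S = q"
  by (rule interpolation_unique[of S]) (use assms degree_interp poly_interp in auto)

lemma interp_cong:
  assumes "finite S" "S \<noteq> {}" "\<And>x. x \<in> S \<Longrightarrow> f x = g x"
  shows "interp f S = interp g S"
  by (rule interp_eqI) (use assms degree_interp poly_interp in auto)

lemma dd_eq_coeff: "dd f S = coeff (interp f S) (card S - 1)"
  by (simp add: dd_def divided_difference_def interp_def)

lemma dd_cong:
  assumes "finite S" "S \<noteq> {}" "\<And>x. x \<in> S \<Longrightarrow> f x = g x"
  shows "dd f S = dd g S"
  using interp_cong[OF assms] by (simp add: dd_eq_coeff)

lemma dd_singleton [simp]: "dd f {x} = f x"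
proof -
  have "interp f {x} = [:f x:]"
    by (rule interp_eqI) auto
  then show ?thesis by (simp add: dd_eq_coeff)
qed

lemma dd_zero:
  assumes "finite S" "S \<noteq> {}" "\<And>x. x \<in> S \<Longrightarrow> f x = 0"
  shows "interp f S = 0" "dd f S = 0"
proof -
  show "interp f S = 0"
    by (rule interp_eqI) (use assms in \<open>auto simp: card_gt_0_iff\<close>)
  then show "dd f S = 0" by (simp add: dd_eq_coeff)
qed

text \<open>Newton's step: subtracting the nodal multiple cancels the coefficient of degree
  \<open>card S\<close> and changes no value on \<open>S\<close>, so what remains is the interpolant
  on \<open>S\<close>.\<close>

lemma interp_insert:
  assumes "finite S" "x \<notin> S" "S \<noteq> {}"
  shows "interp f (insert x S) = interp f S + smult (dd f (insert x S)) (nodal S)"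
proof -
  define r where "r = interp f (insert x S) - smult (dd f (insert x S)) (nodal S)"
  have c: "card S > 0" using assms by (simp add: card_gt_0_iff)
  have "degree r \<le> card S"
    unfolding r_def
    using degree_interp[of "insert x S" f] nodal_monic[OF assms(1)] assms
    by (intro degree_diff_le) auto
  moreover have "coeff r (card S) = 0"
    using nodal_monic[OF assms(1)] assms by (simp add: r_def dd_eq_coeff)
  ultimately have "degree r < card S"
    using c eq_zero_or_degree_less[of r "card S"] by auto
  moreover have "poly r y = f y" if "y \<in> S" for y
    using that assms poly_interp[of "insert x S" y f] by (auto simp: r_def poly_nodal)
  ultimately have "interp f S = r"
    using assms by (intro interp_eqI) auto
  then show ?thesis by (simp add: r_def)
qed

text \<open>The interpolant on both extra nodes is reached by a Newton step from either side with
  the same coefficient, and the two nodal polynomials differ by \<open>b - a\<close> times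
  \<open>nodal T\<close>. The formula gives the jump between neighbouring polynomials of the
  extension; its leading coefficient is the recursion for divided differences.\<close>

lemma interp_exchange:
  assumes "finite T" "a \<notin> T" "b \<notin> T" "a \<noteq> b"
  shows "interp f (insert b T) - interp f (insert a T) =
           smult (dd f (insert a (insert b T)) * (b - a)) (nodal T)"
proof -
  define D where "D = dd f (insert a (insert b T))"
  have "interp f (insert a (insert b T)) = interp f (insert b T) + smult D (nodal (insert b T))"
    unfolding D_def using assms by (intro interp_insert) auto
  moreover have "interp f (insert b (insert a T)) = interp f (insert a T) + smult D (nodal (insert a T))"
    unfolding D_def insert_commute[of a b] using assms by (intro interp_insert) auto
  ultimately have "interp f (insert b T) + smult D (nodal (insert b T)) = interp f (insert a T) + smult D (nodal (insert a T))"
    by (simp only: insert_commute[of b a])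
  then have "interp f (insert b T) - interp f (insert a T)
      = smult D (nodal (insert a T)) - smult D (nodal (insert b T))"
    by (simp only: diff_eq_eq eq_diff_eq diff_add_eq add.commute)
  also have "\<dots> = smult D (([:- a, 1:] - [:- b, 1:]) * nodal T)"
    by (simp only: nodal_insert[OF assms(1,2)] nodal_insert[OF assms(1,3)] smult_diff_right left_diff_distrib)
  also have "[:- a, 1:] - [:- b, 1:] = [:b - a:]"
    by simp
  finally show ?thesis by (simp add: D_def mult.commute)
qed

lemma dd_exchange:
  assumes "finite T" "a \<notin> T" "b \<notin> T" "a \<noteq> b"
  shows "dd f (insert b T) - dd f (insert a T) = dd f (insert a (insert b T)) * (b - a)"
proof -
  have "coeff (interp f (insert b T) - interp f (insert a T)) (card T)
      = dd f (insert a (insert b T)) * (b - a)"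
    using interp_exchange[OF assms, of f] nodal_monic[OF assms(1)] by simp
  then show ?thesis using assms by (simp add: dd_eq_coeff)
qed

lemma dd_recursion:
  assumes "finite S" "a \<in> S" "b \<in> S" "a \<noteq> b"
  shows "dd f S * (b - a) = dd f (S - {a}) - dd f (S - {b})"
proof -
  define T where "T = S - {a, b}"
  have *: "S = insert a (insert b T)" "S - {a} = insert b T" "S - {b} = insert a T"
    using assms by (auto simp: T_def)
  have "finite T" "a \<notin> T" "b \<notin> T" using assms(1) by (auto simp: T_def)
  from dd_exchange[OF this assms(4), of f] show ?thesis by (simp only: *(2,3) *(1)[symmetric])
qed

lemma abs_dd_recursion:
  assumes "finite S" "a \<in> S" "b \<in> S" "\<bar>b - a\<bar> \<ge> d" "d > 0"
  shows "\<bar>dd f S\<bar> \<le> (\<bar>dd f (S - {a})\<bar> + \<bar>dd f (S - {b})\<bar>) / d"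
proof -
  have "\<bar>dd f S\<bar> * d \<le> \<bar>dd f S * (b - a)\<bar>"
    using assms by (simp add: abs_mult mult_left_mono)
  also have "\<dots> \<le> \<bar>dd f (S - {a})\<bar> + \<bar>dd f (S - {b})\<bar>"
    using dd_recursion[of S a b f] assms by auto
  finally show ?thesis using assms by (simp add: field_simps)
qed

text \<open>Each application of Rolle loses one zero, so k + 1 zeros leave one for order k. The
  abstract family \<open>D\<close> lets the lemma be used for a function minus its
  interpolant.\<close>

lemma rolle_iterated:
  fixes D :: "nat \<Rightarrow> real \<Rightarrow> real"
  assumes "\<And>j t. j < k \<Longrightarrow> (D j has_real_derivative D (Suc j) t) (at t)"
    and "finite S" "card S = Suc k" "\<And>x. x \<in> S \<Longrightarrow> D 0 x = 0"
  shows "\<exists>\<xi>. Min S \<le> \<xi> \<and> \<xi> \<le> Max S \<and> D k \<xi> = 0"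
  using assms
proof (induction k arbitrary: D S)
  case 0
  then obtain x where "S = {x}" by (auto simp: card_Suc_eq)
  with 0 show ?case by auto
next
  case (Suc k)
  define xs where "xs = sorted_list_of_set S"
  have len: "length xs = Suc (Suc k)" and ss: "sorted_wrt (<) xs" and set: "set xs = S"
    using Suc by (auto simp: xs_def)
  have mono: "xs ! i < xs ! j" if "i < j" "j < Suc (Suc k)" for i j
    using ss that len by (simp add: sorted_wrt_iff_nth_less)
  \<comment> \<open>The zeros lie strictly between consecutive points, so they are distinct and the
    induction hypothesis applies to them.\<close>
  have "\<exists>z. xs ! i < z \<and> z < xs ! Suc i \<and> D (Suc 0) z = 0" if "i < Suc k" for i
  proof -
    have "D 0 (xs ! i) = D 0 (xs ! Suc i)"
      using Suc.prems(4) set len that nth_mem[of i xs] nth_mem[of "Suc i" xs] by auto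
    moreover have "continuous_on {xs ! i..xs ! Suc i} (D 0)"
      by (intro continuous_at_imp_continuous_on ballI DERIV_isCont[OF Suc.prems(1)]) simp
    moreover have "D 0 differentiable (at t)" for t
      using Suc.prems(1)[of 0 t] by (auto simp: real_differentiable_def)
    moreover have "xs ! i < xs ! Suc i" using mono[of i "Suc i"] that by simp
    ultimately obtain z where z: "xs ! i < z" "z < xs ! Suc i" "DERIV (D 0) z :> 0"
      using Rolle[of "xs ! i" "xs ! Suc i" "D 0"] by blast
    moreover have "D (Suc 0) z = 0"
      by (rule DERIV_unique[OF _ z(3)]) (rule Suc.prems(1), simp)
    ultimately show ?thesis by blast
  qed
  then have "\<forall>i. \<exists>z. i < Suc k \<longrightarrow> xs ! i < z \<and> z < xs ! Suc i \<and> D (Suc 0) z = 0" by blast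
  from choice[OF this] obtain z
    where z: "\<And>i. i < Suc k \<Longrightarrow> xs ! i < z i \<and> z i < xs ! Suc i \<and> D (Suc 0) (z i) = 0" by blast
  have zm: "z i < z j" if "i < j" "j < Suc k" for i j
  proof -
    have "z i < xs ! Suc i" using z that by simp
    also have "\<dots> \<le> xs ! j" using mono[of "Suc i" j] that by (cases "Suc i = j") auto
    also have "\<dots> < z j" using z that by simp
    finally show ?thesis .
  qed
  have inj: "inj_on z {..<Suc k}"
    by (rule inj_onI) (metis zm lessThan_iff less_irrefl linorder_neqE_nat)
  define T where "T = z ` {..<Suc k}"
  have T: "finite T" "card T = Suc k" using inj by (auto simp: T_def card_image)
  have Dz: "D (Suc 0) x = 0" if "x \<in> T" for x
    using z that by (auto simp: T_def)
  obtain \<xi> where "Min T \<le> \<xi>" "\<xi> \<le> Max T" "D (Suc k) \<xi> = 0"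
    using Suc.IH[of "\<lambda>j. D (Suc j)" T, OF Suc.prems(1) _ _ Dz] T by auto
  moreover have "Min S \<le> z i \<and> z i \<le> Max S" if "i < Suc k" for i
  proof -
    have "xs ! i \<in> S" "xs ! Suc i \<in> S"
      using set len that nth_mem[of i xs] nth_mem[of "Suc i" xs] by auto
    then have "Min S \<le> xs ! i" "xs ! Suc i \<le> Max S"
      using Suc.prems(2) by auto
    then show ?thesis using z[OF that] by linarith
  qed
  then have "Min S \<le> Min T" "Max T \<le> Max S"
    unfolding T_def by (auto simp: lessThan_empty_iff)
  ultimately have "Min S \<le> \<xi>" "\<xi> \<le> Max S" "D (Suc k) \<xi> = 0" by linarith+
  then show ?case by blast
qed

lemma has_real_derivative_higher_pderiv:
  "(poly ((pderiv ^^ k) q) has_real_derivative poly ((pderiv ^^ Suc k) q) t) (at t)"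
  using poly_DERIV[of "(pderiv ^^ k) q" t] by simp

lemma higher_pderiv_degree:
  fixes q :: "real poly"
  assumes "degree q \<le> k"
  shows "(pderiv ^^ k) q = [:fact k * coeff q k:]"
  using assms
proof (induction k arbitrary: q)
  case 0
  then obtain c where "q = [:c:]" by (auto elim: degree_eq_zeroE)
  then show ?case by simp
next
  case (Suc k)
  have "degree (pderiv q) \<le> k" using Suc.prems by (simp add: degree_pderiv)
  from Suc.IH[OF this] have "(pderiv ^^ Suc k) q = [:fact k * coeff (pderiv q) k:]"
    by (simp only: funpow_Suc_right o_apply)
  moreover have "fact k * coeff (pderiv q) k = fact (Suc k) * coeff q (Suc k)"
    by (simp add: coeff_pderiv)
  ultimately show ?case by (simp only:)
qed

text \<open>Iterated Rolle for \<open>D 0\<close> minus its interpolant, whose derivative of order k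
  is the constant \<open>fact k * dd (D 0) S\<close>.\<close>

lemma dd_mean_value:
  fixes D :: "nat \<Rightarrow> real \<Rightarrow> real"
  assumes D: "\<And>j t. j < k \<Longrightarrow> (D j has_real_derivative D (Suc j) t) (at t)"
    and S: "finite S" "card S = Suc k"
  shows "\<exists>\<xi>. Min S \<le> \<xi> \<and> \<xi> \<le> Max S \<and> fact k * dd (D 0) S = D k \<xi>"
proof -
  have ne: "S \<noteq> {}" using S by auto
  define q where "q = interp (D 0) S"
  have "\<exists>\<xi>. Min S \<le> \<xi> \<and> \<xi> \<le> Max S \<and> D k \<xi> - poly ((pderiv ^^ k) q) \<xi> = 0"
  proof (rule rolle_iterated[where D = "\<lambda>j t. D j t - poly ((pderiv ^^ j) q) t", OF _ S])
    show "((\<lambda>t. D j t - poly ((pderiv ^^ j) q) t) has_real_derivative D (Suc j) t - poly ((pderiv ^^ Suc j) q) t) (at t)"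
      if "j < k" for j t
      by (rule DERIV_diff[OF D[OF that] has_real_derivative_higher_pderiv])
  qed (use poly_interp[OF S(1) ne] in \<open>simp add: q_def\<close>)
  moreover have "(pderiv ^^ k) q = [:fact k * dd (D 0) S:]"
    using degree_interp[OF S(1) ne, of "D 0"] S by (simp add: higher_pderiv_degree q_def dd_eq_coeff)
  ultimately show ?thesis by auto
qed

section \<open>Variation and absolute continuity\<close>

definition osc :: "(real \<Rightarrow> real) \<Rightarrow> real set \<Rightarrow> real" where
  "osc F K = \<bar>F (Sup K) - F (Inf K)\<bar>"

text \<open>Arbitrary sets and extended values keep finiteness out of the additivity statements;
  finiteness enters only with absolute continuity.\<close>

definition variation :: "(real \<Rightarrow> real) \<Rightarrow> real set \<Rightarrow> ennreal" where
  "variation F U = (SUP D \<in> {D. D division_of \<Union>D \<and> \<Union>D \<subseteq> U}. ennreal (\<Sum>K\<in>D. osc F K))"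

lemma osc_nonneg [simp]: "0 \<le> osc F K"
  by (simp add: osc_def)

lemma osc_Icc: "u \<le> v \<Longrightarrow> osc F {u..v} = \<bar>F v - F u\<bar>"
  by (simp add: osc_def)

text \<open>The innermost clause of \<open>locally_abs_continuous\<close>, with the set
  \<open>T\<close> eliminated as \<open>\<Union>D\<close>.\<close>

definition osc_small :: "(real \<Rightarrow> real) \<Rightarrow> real \<Rightarrow> real \<Rightarrow> real \<Rightarrow> real \<Rightarrow> bool" where
  "osc_small F a b \<delta> \<epsilon> \<longleftrightarrow>
    (\<forall>D. D division_of \<Union>D \<longrightarrow> \<Union>D \<subseteq> {a..b} \<longrightarrow> sum (measure lborel) D < \<delta> \<longrightarrow> sum (osc F) D < \<epsilon>)"

lemma osc_smallI:
  assumes "\<And>D. D division_of \<Union>D \<Longrightarrow> \<Union>D \<subseteq> {a..b} \<Longrightarrow> sum (measure lborel) D < \<delta> \<Longrightarrow> sum (osc F) D < \<epsilon>"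
  shows "osc_small F a b \<delta> \<epsilon>"
  using assms unfolding osc_small_def by simp

lemma osc_smallD:
  assumes "osc_small F a b \<delta> \<epsilon>" "D division_of \<Union>D" "\<Union>D \<subseteq> {a..b}" "sum (measure lborel) D < \<delta>"
  shows "sum (osc F) D < \<epsilon>"
  using assms unfolding osc_small_def by simp

lemma locally_abs_continuous_iff:
  "locally_abs_continuous F \<longleftrightarrow> (\<forall>a b. \<forall>\<epsilon>>0. \<exists>\<delta>>0. osc_small F a b \<delta> \<epsilon>)"
proof -
  have "(\<forall>D T. D division_of T \<and> T \<subseteq> {a..b} \<and> sum (measure lborel) D < \<delta> \<longrightarrow> sum (osc F) D < \<epsilon>) \<longleftrightarrow>
        osc_small F a b \<delta> \<epsilon>" for a b \<delta> \<epsilon>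
    unfolding osc_small_def by (metis division_ofD(6))
  then show ?thesis
    unfolding locally_abs_continuous_def osc_def by simp
qed

lemma locally_abs_continuousE:
  assumes "locally_abs_continuous F" "0 < \<epsilon>"
  obtains \<delta> where "0 < \<delta>" "osc_small F a b \<delta> \<epsilon>"
  using assms unfolding locally_abs_continuous_iff by blast

lemma division_memE:
  fixes D :: "real set set"
  assumes "D division_of T" "K \<in> D"
  obtains u v where "u \<le> v" "K = {u..v}"
proof -
  obtain u v where "K = cbox u v" using division_ofD(4)[OF assms] by blast
  moreover have "K \<noteq> {}" using division_ofD(3)[OF assms] .
  ultimately show ?thesis using that[of u v] by auto
qed

lemma variation_upper:
  "D division_of \<Union>D \<Longrightarrow> \<Union>D \<subseteq> U \<Longrightarrow> ennreal (sum (osc F) D) \<le> variation F U"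
  unfolding variation_def by (intro SUP_upper) auto

lemma variation_least:
  "(\<And>D. D division_of \<Union>D \<Longrightarrow> \<Union>D \<subseteq> U \<Longrightarrow> ennreal (sum (osc F) D) \<le> c) \<Longrightarrow> variation F U \<le> c"
  unfolding variation_def by (intro SUP_least) auto

lemma osc_le_variation: "x \<le> y \<Longrightarrow> ennreal \<bar>F y - F x\<bar> \<le> variation F {x..y}"
  using variation_upper[of "{{x..y}}" "{x..y}" F] division_of_self[of x y]
  by (simp add: osc_Icc)

lemma sum_osc_union:
  assumes D: "D division_of \<Union>D" "\<Union>D \<subseteq> U" and E: "E division_of \<Union>E" "\<Union>E \<subseteq> V"
    and int: "interior U \<inter> interior V = {}"
  shows "sum (osc F) (D \<union> E) = sum (osc F) D + sum (osc F) E"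
proof -
  \<comment> \<open>A common member lies in \<open>U\<close> and in \<open>V\<close>, whose
    interiors are disjoint, so it is a single point.\<close>
  have "osc F K = 0" if "K \<in> D \<inter> E" for K
  proof -
    from that obtain u v where K: "u \<le> v" "K = {u..v}" by (auto elim: division_memE[OF D(1)])
    have "interior K \<subseteq> interior U" "interior K \<subseteq> interior V"
      using that D(2) E(2) by (auto intro!: interior_mono)
    then have "interior K = {}" using int by blast
    then have "u = v" using K by (simp add: interior_atLeastAtMost_real greaterThanLessThan_empty_iff)
    then show ?thesis using K by (simp add: osc_def)
  qed
  then have "sum (osc F) (D \<inter> E) = 0" by (intro sum.neutral) auto
  then show ?thesis
    using sum.union_inter[of D E "osc F"] division_ofD(1)[OF D(1)] division_ofD(1)[OF E(1)] by simp
qed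

lemma variation_superadditive:
  assumes "interior U \<inter> interior V = {}"
  shows "variation F U + variation F V \<le> variation F (U \<union> V)"
proof -
  have ne: "{D. D division_of \<Union>D \<and> \<Union>D \<subseteq> W} \<noteq> {}" for W :: "real set"
    by (auto intro!: exI[of _ "{}"])
  have *: "ennreal (sum (osc F) D) + ennreal (sum (osc F) E) \<le> variation F (U \<union> V)"
    if D: "D division_of \<Union>D" "\<Union>D \<subseteq> U" and E: "E division_of \<Union>E" "\<Union>E \<subseteq> V" for D E
  proof -
    have "interior (\<Union>D) \<inter> interior (\<Union>E) = {}"
      using interior_mono[OF D(2)] interior_mono[OF E(2)] assms by blast
    then have "(D \<union> E) division_of (\<Union>(D \<union> E))"
      using division_disjoint_union[OF D(1) E(1)] by (simp add: Union_Un_distrib)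
    then have "ennreal (sum (osc F) (D \<union> E)) \<le> variation F (U \<union> V)"
      using D E by (intro variation_upper) auto
    then show ?thesis
      using sum_osc_union[OF D E assms, of F] by (simp add: sum_nonneg)
  qed
  have "ennreal (sum (osc F) D) + variation F V \<le> variation F (U \<union> V)"
    if D: "D division_of \<Union>D" "\<Union>D \<subseteq> U" for D
  proof -
    have "ennreal (sum (osc F) D) + variation F V
      = (SUP E \<in> {E. E division_of \<Union>E \<and> \<Union>E \<subseteq> V}. ennreal (sum (osc F) D) + ennreal (sum (osc F) E))"
      unfolding variation_def by (rule ennreal_SUP_add_right[OF ne])
    also have "\<dots> \<le> variation F (U \<union> V)" by (rule SUP_least) (use *[OF D] in blast)
    finally show ?thesis .
  qed
  moreover have "variation F U + variation F V
      = (SUP D \<in> {D. D division_of \<Union>D \<and> \<Union>D \<subseteq> U}. ennreal (sum (osc F) D) + variation F V)"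
    unfolding variation_def[of F U] by (rule ennreal_SUP_add_left[OF ne, symmetric])
  ultimately show ?thesis by (simp add: SUP_le_iff)
qed

lemma variation_sum:
  assumes "D division_of \<Union>D"
  shows "(\<Sum>K\<in>D. variation F K) \<le> variation F (\<Union>D)"
proof -
  have "finite D" using assms by auto
  from this assms show ?thesis
  proof (induction D)
    case (insert K D)
    note d = division_ofD[OF insert.prems]
    have D: "D division_of \<Union>D"
      by (rule division_ofI) (use d insert.hyps in auto)
    have "interior K \<inter> interior (\<Union>D) = {}"
    proof (rule Int_interior_Union_intervals)
      show "interior K \<inter> interior T = {}" if "T \<in> D" for T
        using d(5)[of K T] that insert.hyps by auto
      show "\<exists>a b. T = cbox a b" if "T \<in> D" for T
        using d(4)[of T] that by blast
    qed (use insert.hyps in auto)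
    then have "variation F K + variation F (\<Union>D) \<le> variation F (K \<union> \<Union>D)"
      by (rule variation_superadditive)
    then show ?case
      using insert.IH[OF D] insert.hyps by (simp add: order_trans[OF add_left_mono])
  qed simp
qed

text \<open>Intersecting a division with an interval gives a division again. Different members may
  have the same intersection, but then it has empty interior, is a point and contributes 0, so
  passing to the image loses nothing.\<close>

lemma sum_osc_restrict:
  assumes D: "D division_of \<Union>D" and "a \<le> b"
  shows "(\<Sum>K\<in>D. if K \<inter> {a..b} = {} then 0 else ennreal (osc F (K \<inter> {a..b}))) \<le> variation F {a..b}"
proof -
  let ?J = "{a..b}"
  define P where "P = {K \<in> D. K \<inter> ?J \<noteq> {}}"
  have fin: "finite D" using D by auto
  have "{k1 \<inter> k2 | k1 k2. k1 \<in> D \<and> k2 \<in> {?J} \<and> k1 \<inter> k2 \<noteq> {}} division_of (\<Union>D \<inter> ?J)"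
    by (rule division_inter[OF D]) (use \<open>a \<le> b\<close> division_of_self[of a b] in simp)
  also have "{k1 \<inter> k2 | k1 k2. k1 \<in> D \<and> k2 \<in> {?J} \<and> k1 \<inter> k2 \<noteq> {}} = (\<lambda>K. K \<inter> ?J) ` P"
    by (auto simp: P_def)
  finally have div: "(\<lambda>K. K \<inter> ?J) ` P division_of (\<Union>D \<inter> ?J)" .
  then have U: "\<Union>((\<lambda>K. K \<inter> ?J) ` P) = \<Union>D \<inter> ?J" by auto
  have "(\<Sum>K\<in>D. if K \<inter> ?J = {} then 0 else ennreal (osc F (K \<inter> ?J))) = (\<Sum>K\<in>P. ennreal (osc F (K \<inter> ?J)))"
    by (rule sum.mono_neutral_cong_right) (use fin in \<open>auto simp: P_def\<close>)
  also have "\<dots> = ennreal (\<Sum>K\<in>P. osc F (K \<inter> ?J))" by simp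
  also have "(\<Sum>K\<in>P. osc F (K \<inter> ?J)) = sum (osc F) ((\<lambda>K. K \<inter> ?J) ` P)"
  proof (rule sum.reindex_nontrivial[symmetric, unfolded o_def])
    show "finite P" using fin by (simp add: P_def)
    fix K L assume KL: "K \<in> P" "L \<in> P" "K \<noteq> L" "K \<inter> ?J = L \<inter> ?J"
    then have "interior K \<inter> interior L = {}"
      using division_ofD(5)[OF D] by (auto simp: P_def)
    moreover have "interior (K \<inter> ?J) \<subseteq> interior K" by (intro interior_mono) blast
    moreover have "interior (K \<inter> ?J) \<subseteq> interior L" unfolding KL(4) by (intro interior_mono) blast
    ultimately have int0: "interior (K \<inter> ?J) = {}" by blast
    have "K \<inter> ?J \<in> (\<lambda>K. K \<inter> ?J) ` P" using KL(1) by blast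
    then obtain u v where uv: "u \<le> v" "K \<inter> ?J = {u..v}" by (rule division_memE[OF div])
    then have "u = v"
      using int0 by (simp add: interior_atLeastAtMost_real greaterThanLessThan_empty_iff)
    then show "osc F (K \<inter> ?J) = 0" using uv by (simp add: osc_def)
  qed
  also have "ennreal (sum (osc F) ((\<lambda>K. K \<inter> ?J) ` P)) \<le> variation F ?J"
    by (rule variation_upper) (use div U in auto)
  finally show ?thesis .
qed

text \<open>A member that straddles b is cut there, and the triangle inequality bounds its
  oscillation by those of the two parts.\<close>

lemma variation_subadditive:
  assumes ab: "a \<le> b" "b \<le> c"
  shows "variation F {a..c} \<le> variation F {a..b} + variation F {b..c}"
proof (rule variation_least)
  fix D assume D: "D division_of \<Union>D" "\<Union>D \<subseteq> {a..c}"
  let ?h = "\<lambda>J K. if K \<inter> J = {} then 0 else ennreal (osc F (K \<inter> J))"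
  have "ennreal (osc F K) \<le> ?h {a..b} K + ?h {b..c} K" if "K \<in> D" for K
  proof -
    obtain u v where uv: "u \<le> v" "K = {u..v}" using \<open>K \<in> D\<close> by (rule division_memE[OF D(1)])
    have "K \<subseteq> {a..c}" using that D(2) by blast
    then have ac: "a \<le> u" "v \<le> c" using uv by auto
    consider "v \<le> b" | "b \<le> u" | "u < b" "b < v" by linarith
    then show ?thesis
    proof cases
      case 1
      then have "K \<inter> {a..b} = K" using uv ac by auto
      then show ?thesis using uv by auto
    next
      case 2
      then have "K \<inter> {b..c} = K" using uv ac by auto
      then show ?thesis using uv by auto
    next
      case 3
      then have "K \<inter> {a..b} = {u..b}" "K \<inter> {b..c} = {b..v}" using uv ac by auto
      then show ?thesis using uv 3 by (auto simp: osc_Icc simp flip: ennreal_plus intro!: ennreal_leI)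
    qed
  qed
  then have "(\<Sum>K\<in>D. ennreal (osc F K)) \<le> (\<Sum>K\<in>D. ?h {a..b} K) + (\<Sum>K\<in>D. ?h {b..c} K)"
    unfolding sum.distrib[symmetric] by (rule sum_mono)
  also have "\<dots> \<le> variation F {a..b} + variation F {b..c}"
    by (intro add_mono sum_osc_restrict D ab)
  finally show "ennreal (sum (osc F) D) \<le> variation F {a..b} + variation F {b..c}" by simp
qed

lemma variation_additive:
  assumes ab: "a \<le> b" "b \<le> c"
  shows "variation F {a..c} = variation F {a..b} + variation F {b..c}"
proof (rule antisym)
  have "interior {a..b} \<inter> interior {b..c} = {}" by auto
  from variation_superadditive[OF this, of F]
  show "variation F {a..b} + variation F {b..c} \<le> variation F {a..c}"
    using ab by (simp add: ivl_disj_un)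
qed (rule variation_subadditive[OF ab])

lemma variation_finite:
  assumes "locally_abs_continuous F"
  shows "variation F {a..b} < \<infinity>"
proof (cases "a \<le> b")
  case True
  obtain \<delta> where \<delta>: "\<delta> > 0"
    "osc_small F a b \<delta> 1"
    by (rule locally_abs_continuousE[OF assms zero_less_one]) blast
  \<comment> \<open>Absolute continuity with \<epsilon> = 1 bounds the variation by 1 on pieces
    shorter than \<delta>; N equal pieces suffice, and one more unit pays for the degenerate start
    \<open>{a..a}\<close>.\<close>
  obtain N :: nat where N: "(b - a) / \<delta> < real N" using reals_Archimedean2 by blast
  then have N0: "0 < real N" using True \<delta>(1) by (smt (verit) divide_nonneg_pos)
  define h where "h = (b - a) / real N"
  have h: "0 \<le> h" "h < \<delta>" using True N N0 \<delta>(1) by (auto simp: h_def field_simps)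
  have small: "variation F {u..v} \<le> 1" if uv: "{u..v} \<subseteq> {a..b}" "u \<le> v" "v - u < \<delta>" for u v
  proof (rule variation_least)
    fix D assume D: "D division_of \<Union>D" "\<Union>D \<subseteq> {u..v}"
    have "sum (measure lborel) D \<le> measure lborel (cbox u v)"
      by (rule subadditive_content_division[OF D(1)]) (use D(2) in simp)
    also have "\<dots> < \<delta>" using uv by simp
    finally have "sum (osc F) D < 1" using osc_smallD[OF \<delta>(2) D(1) order_trans[OF D(2) uv(1)]] by blast
    then show "ennreal (sum (osc F) D) \<le> 1" by (simp add: ennreal_le_1)
  qed
  have "variation F {a..a + real n * h} \<le> of_nat n + 1" if "n \<le> N" for n
    using that
  proof (induction n)
    case 0
    show ?case using small[of a a] True \<delta>(1) by simp
  next
    case (Suc n)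
    have Nh: "real N * h = b - a" using N0 by (simp add: h_def)
    have le: "real (Suc n) * h \<le> real N * h" using Suc.prems h by (intro mult_right_mono) auto
    have nn: "0 \<le> real n * h" using h by simp
    have S: "real (Suc n) * h = real n * h + h" by (simp add: algebra_simps)
    have "variation F {a + real n * h..a + real (Suc n) * h} \<le> 1"
      by (rule small) (use le nn h Nh S in auto)
    moreover have "variation F {a..a + real (Suc n) * h} = variation F {a..a + real n * h} + variation F {a + real n * h..a + real (Suc n) * h}"
      by (rule variation_additive) (use nn h S in linarith)+
    moreover have "variation F {a..a + real n * h} \<le> of_nat n + 1" using Suc by simp
    ultimately have "variation F {a..a + real (Suc n) * h} \<le> (of_nat n + 1) + 1" by (metis add_mono)
    then show ?case by (simp add: add_ac)
  qed
  from this[of N] have "variation F {a..b} \<le> of_nat N + 1" using N0 by (simp add: h_def)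
  also have "\<dots> < \<infinity>" by (simp add: of_nat_less_top)
  finally show ?thesis .
next
  case False
  have "variation F {a..b} \<le> 0"
  proof (rule variation_least)
    fix D assume D: "D division_of \<Union>D" "\<Union>D \<subseteq> {a..b}"
    then have "D = {}" using False by (metis atLeastatMost_empty division_of_trivial not_le subset_empty)
    then show "ennreal (sum (osc F) D) \<le> 0" by simp
  qed
  then show ?thesis by simp
qed

text \<open>Measured from 0 and signed to the left of it, so that increments are variations wherever
  the interval lies.\<close>

definition total_var :: "(real \<Rightarrow> real) \<Rightarrow> real \<Rightarrow> real" where
  "total_var F x = (if 0 \<le> x then enn2real (variation F {0..x}) else - enn2real (variation F {x..0}))"

lemma total_var_diff:
  assumes "locally_abs_continuous F" "x \<le> y"
  shows "total_var F y - total_var F x = enn2real (variation F {x..y})"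
proof -
  have add: "enn2real (variation F {a..c}) = enn2real (variation F {a..b}) + enn2real (variation F {b..c})"
    if "a \<le> b" "b \<le> c" for a b c
    using variation_finite[OF assms(1)] by (simp add: variation_additive[OF that] enn2real_plus)
  consider "0 \<le> x" | "x < 0" "0 \<le> y" | "y < 0" by linarith
  then show ?thesis
  proof cases
    case 1 then show ?thesis using add[of 0 x y] assms by (simp add: total_var_def)
  next
    case 2 then show ?thesis using add[of x 0 y] assms by (simp add: total_var_def)
  next
    case 3 then show ?thesis using add[of x y 0] assms by (simp add: total_var_def)
  qed
qed

text \<open>Over a division D the increments of \<open>total_var F\<close> add up to at most the
  variation over \<open>\<Union>D\<close>. A competing division inside \<open>\<Union>D\<close> has
  total length at most that of D, so the smallness condition for F applies to it. The supremum only
  preserves a weak inequality, hence \<epsilon>/2.\<close>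

lemma locally_abs_continuous_total_var:
  assumes F: "locally_abs_continuous F"
  shows "locally_abs_continuous (total_var F)"
  unfolding locally_abs_continuous_iff
proof (intro allI impI)
  fix a b \<epsilon> :: real assume \<epsilon>: "0 < \<epsilon>"
  then have \<epsilon>2: "0 < \<epsilon> / 2" by simp
  obtain \<delta> where \<delta>: "\<delta> > 0"
    "osc_small F a b \<delta> (\<epsilon> / 2)"
    by (rule locally_abs_continuousE[OF F \<epsilon>2]) blast
  have content: "sum (measure lborel) E = measure lebesgue (\<Union>E)" if "E division_of \<Union>E" for E :: "real set set"
  proof -
    have "sum (measure lborel) E = (\<Sum>K\<in>E. measure lebesgue K)"
      by (rule sum.cong) (use that in \<open>auto elim!: division_memE\<close>)
    then show ?thesis using content_division[OF that] by simp
  qed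
  have "osc_small (total_var F) a b \<delta> \<epsilon>"
  proof (rule osc_smallI)
    fix D assume D: "D division_of \<Union>D" "\<Union>D \<subseteq> {a..b}" "sum (measure lborel) D < \<delta>"
    have "osc (total_var F) K = enn2real (variation F K)" if "K \<in> D" for K
      by (rule division_memE[OF D(1) that]) (simp add: osc_Icc total_var_diff[OF F])
    moreover have "variation F K < \<infinity>" if "K \<in> D" for K
      by (rule division_memE[OF D(1) that]) (simp add: variation_finite[OF F, simplified])
    ultimately have "ennreal (sum (osc (total_var F)) D) = (\<Sum>K\<in>D. variation F K)"
      by (subst sum_ennreal[symmetric]) (auto intro!: sum.cong simp: less_top)
    also have "\<dots> \<le> variation F (\<Union>D)" by (rule variation_sum[OF D(1)])
    also have "\<dots> \<le> ennreal (\<epsilon> / 2)"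
    proof (rule variation_least)
      fix E assume E: "E division_of \<Union>E" "\<Union>E \<subseteq> \<Union>D"
      have "sum (measure lborel) E \<le> sum (measure lborel) D"
        unfolding content[OF E(1)] content[OF D(1)]
        by (rule measure_mono_fmeasurable[OF E(2)]) (use lmeasurable_division[OF E(1)] lmeasurable_division[OF D(1)] in auto)
      then have "sum (osc F) E < \<epsilon> / 2" using osc_smallD[OF \<delta>(2) E(1)] E(2) D by auto
      then show "ennreal (sum (osc F) E) \<le> ennreal (\<epsilon> / 2)" by (intro ennreal_leI) simp
    qed
    finally have "sum (osc (total_var F)) D \<le> \<epsilon> / 2" using \<epsilon> by (simp add: ennreal_le_iff)
    then show "sum (osc (total_var F)) D < \<epsilon>" using \<epsilon> by simp
  qed
  then show "\<exists>\<delta>>0. osc_small (total_var F) a b \<delta> \<epsilon>"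
    using \<delta>(1) by blast
qed

text \<open>Two dominating functions cover both uses: a difference such as
  \<open>total_var G - G\<close>, and a limit dominated by one primitive, which is then taken
  twice.\<close>

lemma locally_abs_continuous_dominated:
  assumes F: "locally_abs_continuous F" and G: "locally_abs_continuous G"
    and H: "\<And>u v. u \<le> v \<Longrightarrow> \<bar>H v - H u\<bar> \<le> \<bar>F v - F u\<bar> + \<bar>G v - G u\<bar>"
  shows "locally_abs_continuous H"
  unfolding locally_abs_continuous_iff
proof (intro allI impI)
  fix a b \<epsilon> :: real assume \<epsilon>: "0 < \<epsilon>"
  then have \<epsilon>2: "0 < \<epsilon> / 2" by simp
  obtain \<delta> where \<delta>: "\<delta> > 0" "osc_small F a b \<delta> (\<epsilon> / 2)"
    by (rule locally_abs_continuousE[OF F \<epsilon>2]) blast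
  obtain \<delta>' where \<delta>': "\<delta>' > 0" "osc_small G a b \<delta>' (\<epsilon> / 2)"
    by (rule locally_abs_continuousE[OF G \<epsilon>2]) blast
  have "osc_small H a b (min \<delta> \<delta>') \<epsilon>"
  proof (rule osc_smallI)
    fix D assume D: "D division_of \<Union>D" "\<Union>D \<subseteq> {a..b}" "sum (measure lborel) D < min \<delta> \<delta>'"
    have "sum (osc H) D \<le> sum (\<lambda>K. osc F K + osc G K) D"
    proof (rule sum_mono)
      fix K assume "K \<in> D"
      then obtain u v where "u \<le> v" "K = {u..v}" by (rule division_memE[OF D(1)])
      then show "osc H K \<le> osc F K + osc G K" using H[of u v] by (simp add: osc_Icc)
    qed
    also have "\<dots> < \<epsilon>"
      using osc_smallD[OF \<delta>(2) D(1,2)] osc_smallD[OF \<delta>'(2) D(1,2)] D(3) by (simp add: sum.distrib)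
    finally show "sum (osc H) D < \<epsilon>" .
  qed
  then show "\<exists>\<delta>>0. osc_small H a b \<delta> \<epsilon>"
    using \<delta>(1) \<delta>'(1) by (intro exI[of _ "min \<delta> \<delta>'"]) auto
qed

section \<open>The fundamental theorem of calculus for absolutely continuous functions\<close>

lemma sum_content_eq_measure:
  fixes E :: "real set set"
  assumes "E division_of \<Union>E"
  shows "sum (measure lborel) E = measure lebesgue (\<Union>E)"
proof -
  have "sum (measure lborel) E = (\<Sum>K\<in>E. measure lebesgue K)"
    by (rule sum.cong) (use assms in \<open>auto elim!: division_memE\<close>)
  then show ?thesis using content_division[OF assms] by simp
qed

lemma locally_abs_continuous_imp_continuous:
  assumes "locally_abs_continuous F"
  shows "continuous_on UNIV F"
  unfolding continuous_on_iff
proof (intro ballI allI impI)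
  fix x e :: real assume "0 < e"
  obtain \<delta> where \<delta>: "0 < \<delta>"
    "osc_small F (x - 1) (x + 1) \<delta> e"
    by (rule locally_abs_continuousE[OF assms \<open>0 < e\<close>]) blast
  have "dist (F y) (F x) < e" if "dist y x < min \<delta> 1" for y
  proof -
    have d: "\<bar>y - x\<bar> < \<delta>" "\<bar>y - x\<bar> < 1" using that by (auto simp: dist_real_def)
    have "sum (osc F) {{min x y..max x y}} < e"
    proof (rule osc_smallD[OF \<delta>(2)])
      show "{{min x y..max x y}} division_of \<Union>{{min x y..max x y}}"
        using division_of_self[of "min x y" "max x y"] by auto
      show "\<Union>{{min x y..max x y}} \<subseteq> {x - 1..x + 1}" using d by (auto simp: abs_less_iff)
      show "sum (measure lborel) {{min x y..max x y}} < \<delta>" using d by (auto simp: min_def max_def)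
    qed
    then show ?thesis by (auto simp: osc_def dist_real_def min_def max_def split: if_splits)
  qed
  then show "\<exists>d>0. \<forall>x'\<in>UNIV. dist x' x < d \<longrightarrow> dist (F x') (F x) < e"
    using \<delta>(1) by (intro exI[of _ "min \<delta> 1"]) auto
qed

text \<open>A null set sits in an open set of small Lebesgue measure, which decomposes into
  countably many nonoverlapping closed intervals. Finite subfamilies are divisions of small total
  length, so their mass under the interval measure is small, and monotone limits carry this to the
  open set.\<close>

lemma mono_locally_abs_continuous_null_sets:
  assumes mono: "\<And>x y. x \<le> y \<Longrightarrow> F x \<le> F y" and ac: "locally_abs_continuous F"
  shows "absolutely_continuous lborel (interval_measure F)"
  unfolding absolutely_continuous_def
proof
  define M where "M = interval_measure F"
  have cont: "continuous_on UNIV F" by (rule locally_abs_continuous_imp_continuous[OF ac])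
  have M_Icc: "emeasure M {u..v} = ennreal (osc F {u..v})" if "u \<le> v" for u v
    using emeasure_interval_measure_Icc[OF that mono cont] mono[OF that] that by (simp add: M_def osc_Icc)
  have sets_M: "sets M = sets borel" by (simp add: M_def)
  fix N :: "real set" assume N: "N \<in> null_sets lborel"
  then have Nb: "N \<in> sets borel" by auto
  \<comment> \<open>The \<delta> of absolute continuity is available on bounded intervals only, so
    the null set is treated piece by piece.\<close>
  have "emeasure M (N \<inter> {-b<..<b}) \<le> ennreal \<epsilon>" if \<epsilon>: "0 < \<epsilon>" and b: "0 < b" for \<epsilon> b :: real
  proof -
    obtain \<delta> where \<delta>: "0 < \<delta>"
      "osc_small F (-b) b \<delta> \<epsilon>"
      by (rule locally_abs_continuousE[OF ac \<epsilon>]) blast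
    obtain V where V: "open V" "N \<subseteq> V" "emeasure lborel (V - N) < \<delta>"
      by (rule outer_regular_lborel[OF Nb \<delta>(1)])
    define U where "U = V \<inter> {-b<..<b}"
    have U: "open U" "U \<subseteq> cbox (-b) b" using V(1) by (auto simp: U_def)
    have Um: "U \<in> lmeasurable" by (rule lmeasurable_open[OF bounded_subset[OF bounded_cbox U(2)] U(1)])
    have "emeasure lebesgue U \<le> emeasure lborel V"
      using U(1) V(1) by (auto simp: U_def intro!: emeasure_mono)
    also have "\<dots> = emeasure lborel (V - N)"
      using emeasure_Diff_null_set[OF N, of V] V(1) by simp
    finally have "emeasure lebesgue U < ennreal \<delta>" using V(3) by simp
    then have mU: "measure lebesgue U < \<delta>"
      using Um by (simp add: emeasure_eq_measure2 ennreal_less_iff fmeasurableD2)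
    \<comment> \<open>Each interval of the covering is contained in \<open>g x\<close> for one of
      its points x in \<open>U\<close>; this gauge therefore keeps all intervals inside
      \<open>U\<close>.\<close>
    define g where "g x = (if x \<in> U then U else UNIV)" for x
    obtain \<D> where \<D>: "countable \<D>"
      "\<And>K. K \<in> \<D> \<Longrightarrow> interior K \<noteq> {} \<and> (\<exists>c d. K = cbox c d)"
      "pairwise (\<lambda>A B. interior A \<inter> interior B = {}) \<D>"
      "\<And>K. K \<in> \<D> \<Longrightarrow> \<exists>x \<in> U \<inter> K. K \<subseteq> g x" "U \<subseteq> \<Union>\<D>"
    proof (rule covering_lemma[OF U(2), of g])
      show "box (- b) b \<noteq> {}" using b by simp
      show "gauge g" unfolding gauge_def using U(1) by (auto simp: g_def)
    qed blast
    have sub: "K \<subseteq> U" if "K \<in> \<D>" for K using \<D>(4)[OF that] by (auto simp: g_def)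
    have fin: "emeasure M (\<Union>E) \<le> ennreal \<epsilon>" if E: "finite E" "E \<subseteq> \<D>" for E
    proof -
      have div: "E division_of \<Union>E"
      proof (rule division_ofI)
        show "K \<noteq> {}" "\<exists>a b. K = cbox a b" if "K \<in> E" for K
          using \<D>(2)[of K] that E by auto
        show "interior K1 \<inter> interior K2 = {}" if "K1 \<in> E" "K2 \<in> E" "K1 \<noteq> K2" for K1 K2
          using \<D>(3) that E unfolding pairwise_def by blast
      qed (use E in auto)
      have EU: "\<Union>E \<subseteq> U" using E sub by blast
      have "sum (measure lborel) E \<le> measure lebesgue U"
        unfolding sum_content_eq_measure[OF div]
        by (rule measure_mono_fmeasurable[OF EU _ Um]) (use lmeasurable_division[OF div] in auto)
      then have "sum (osc F) E < \<epsilon>" using osc_smallD[OF \<delta>(2) div] EU U(2) mU by auto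
      have Kc: "\<exists>u v. u \<le> v \<and> K = {u..v}" if "K \<in> E" for K
        by (rule division_memE[OF div that]) blast
      have "emeasure M (\<Union>K\<in>E. K) \<le> (\<Sum>K\<in>E. emeasure M K)"
        by (rule emeasure_subadditive_finite) (use E Kc sets_M in fastforce)+
      also have "\<dots> = (\<Sum>K\<in>E. ennreal (osc F K))"
        by (rule sum.cong) (use Kc M_Icc in fastforce)+
      also have "\<dots> = ennreal (sum (osc F) E)" by simp
      also have "\<dots> \<le> ennreal \<epsilon>" using \<open>sum (osc F) E < \<epsilon>\<close> by (intro ennreal_leI) simp
      finally show ?thesis by simp
    qed
    have "emeasure M U \<le> ennreal \<epsilon>"
    proof (cases "\<D> = {}")
      case False
      define A where "A k = \<Union>(from_nat_into \<D> ` {..<k})" for k :: nat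
      have inc: "incseq A"
        unfolding A_def incseq_def by (intro allI impI Union_mono image_mono) auto
      have "from_nat_into \<D> n \<in> sets M" for n
        using \<D>(2)[OF from_nat_into[OF False, of n]] by (auto simp: sets_M)
      then have Am: "range A \<subseteq> sets M" by (auto simp: A_def)
      have "U \<subseteq> (\<Union>k. A k)"
      proof
        fix x assume "x \<in> U"
        then obtain K where "K \<in> \<D>" "x \<in> K" using \<D>(5) by blast
        then obtain n where "K = from_nat_into \<D> n" using from_nat_into_surj[OF \<D>(1)] by metis
        then have "x \<in> A (Suc n)" using \<open>x \<in> K\<close> by (auto simp: A_def)
        then show "x \<in> (\<Union>k. A k)" by blast
      qed
      then have "emeasure M U \<le> emeasure M (\<Union>k. A k)"
        by (rule emeasure_mono) (use Am in blast)
      also have "\<dots> = (SUP k. emeasure M (A k))" by (rule SUP_emeasure_incseq[OF Am inc, symmetric])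
      also have "\<dots> \<le> ennreal \<epsilon>"
        unfolding A_def by (intro SUP_least fin) (auto intro: from_nat_into[OF False])
      finally show ?thesis .
    next
      case True
      then show ?thesis using \<D>(5) by simp
    qed
    moreover have "emeasure M (N \<inter> {-b<..<b}) \<le> emeasure M U"
      by (rule emeasure_mono) (use V(2) U(1) in \<open>auto simp: U_def sets_M\<close>)
    ultimately show ?thesis by simp
  qed
  then have zero: "emeasure M (N \<inter> {-b<..<b}) = 0" if "0 < b" for b
    using that by (metis ennreal_le_epsilon add_0 le_zero_eq)
  have "N = (\<Union>n. N \<inter> {-real (Suc n)<..<real (Suc n)})"
  proof -
    have "\<exists>n. - real (Suc n) < x \<and> x < real (Suc n)" for x :: real
    proof -
      obtain n where "\<bar>x\<bar> < real n" using reals_Archimedean2 by blast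
      then show ?thesis by (intro exI[of _ n]) (auto simp: abs_less_iff)
    qed
    then show ?thesis by auto
  qed
  moreover have "(\<Union>n. N \<inter> {-real (Suc n)<..<real (Suc n)}) \<in> null_sets M"
    by (intro null_sets_UN null_setsI zero) (use Nb sets_M in auto)
  ultimately show "N \<in> null_sets (interval_measure F)" by (simp add: M_def)
qed

text \<open>The density is the Radon-Nikodym derivative of the interval measure; sigma-finiteness
  makes it finite almost everywhere, so it may be taken real.\<close>

lemma mono_locally_abs_continuous_density:
  assumes mono: "\<And>x y. x \<le> y \<Longrightarrow> F x \<le> F y" and ac: "locally_abs_continuous F"
  obtains h where "h \<in> borel_measurable borel" "\<And>x. 0 \<le> h x"
    "\<And>a b. a \<le> b \<Longrightarrow> (h has_integral F b - F a) {a..b}"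
proof -
  define M where "M = interval_measure F"
  define h where "h = RN_deriv lborel M"
  have cont: "continuous_on UNIV F" by (rule locally_abs_continuous_imp_continuous[OF ac])
  then have rc: "continuous (at_right a) F" for a
    by (auto simp: continuous_on_eq_continuous_within intro: continuous_within_subset)
  have abs: "absolutely_continuous lborel M" "sets M = sets lborel"
    using mono_locally_abs_continuous_null_sets[OF assms] by (auto simp: M_def)
  have dens: "density lborel h = M"
    unfolding h_def by (rule sigma_finite_measure.density_RN_deriv[OF sigma_finite_lborel abs])
  have hm[measurable]: "h \<in> borel_measurable borel"
    using borel_measurable_RN_deriv[of lborel M] by (simp add: h_def)
  have fin: "AE x in lborel. h x \<noteq> \<infinity>"
    unfolding h_def M_def
    by (rule sigma_finite_measure.RN_deriv_finite[OF sigma_finite_lborel]) (use abs sigma_finite_interval_measure[OF mono rc] in \<open>auto simp: M_def\<close>)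
  show thesis
  proof (rule that[of "\<lambda>x. enn2real (h x)"])
    fix a b :: real assume "a \<le> b"
    have "(\<integral>\<^sup>+ x. ennreal (enn2real (h x) * indicator {a..b} x) \<partial>lborel) = (\<integral>\<^sup>+ x. h x * indicator {a..b} x \<partial>lborel)"
      using fin by (intro nn_integral_cong_AE, eventually_elim) (auto simp: indicator_def less_top)
    also have "\<dots> = emeasure (density lborel h) {a..b}" by (simp add: emeasure_density)
    also have "\<dots> = ennreal (F b - F a)"
      unfolding dens M_def by (rule emeasure_interval_measure_Icc[OF \<open>a \<le> b\<close> mono cont])
    finally have "((\<lambda>x. enn2real (h x) * indicator {a..b} x) has_integral (F b - F a)) UNIV"
      using mono[OF \<open>a \<le> b\<close>] by (intro nn_integral_has_integral) auto
    also have "(\<lambda>x. enn2real (h x) * indicator {a..b} x) = (\<lambda>x. if x \<in> {a..b} then enn2real (h x) else 0)"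
      by (auto simp: indicator_def)
    finally show "((\<lambda>x. enn2real (h x)) has_integral F b - F a) {a..b}"
      by (simp only: has_integral_restrict_UNIV)
  qed auto
qed

text \<open>\<open>integrable_ccontinuous_explicit\<close> speaks of averages to the right of a
  point. The averages to the left are those of the reflected function h(-x), and the two exceptional
  sets are united.\<close>

lemma lebesgue_differentiation:
  fixes h G :: "real \<Rightarrow> real"
  assumes h: "\<And>a b. a \<le> b \<Longrightarrow> (h has_integral G b - G a) {a..b}"
  shows "AE x in lebesgue. (G has_real_derivative h x) (at x)"
proof -
  have int: "h integrable_on cbox a b" for a b
    using h[of a b] by (cases "a \<le> b") auto
  obtain N where N: "negligible N"
    "\<And>x e. x \<notin> N \<Longrightarrow> 0 < e \<Longrightarrow> \<exists>d>0. \<forall>t. 0 < t \<and> t < d \<longrightarrow>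
       norm (integral (cbox x (x + t *\<^sub>R One)) h /\<^sub>R t ^ DIM(real) - h x) < e"
    using integrable_ccontinuous_explicit[OF int] by blast
  have h': "((\<lambda>x. h (- x)) has_integral G (-a) - G (-b)) {a..b}" if "a \<le> b" for a b
    using h[of "-b" "-a"] that has_integral_reflect_real[of h "G (-a) - G (-b)" "-a" "-b"] by simp
  have int': "(\<lambda>x. h (- x)) integrable_on cbox a b" for a b
    using h'[of a b] by (cases "a \<le> b") auto
  obtain N' where N': "negligible N'"
    "\<And>x e. x \<notin> N' \<Longrightarrow> 0 < e \<Longrightarrow> \<exists>d>0. \<forall>t. 0 < t \<and> t < d \<longrightarrow>
       norm (integral (cbox x (x + t *\<^sub>R One)) (\<lambda>x. h (- x)) /\<^sub>R t ^ DIM(real) - h (- x)) < e"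
    using integrable_ccontinuous_explicit[OF int'] by blast
  have neg: "negligible (N \<union> uminus ` N')"
  proof (rule negligible_Un[OF N(1)])
    show "negligible (uminus ` N')"
      by (rule negligible_differentiable_image_negligible[OF _ N'(1)]) (auto intro!: derivative_intros)
  qed
  have "(G has_real_derivative h x) (at x)" if x: "x \<notin> N \<union> uminus ` N'" for x
    unfolding has_field_derivative_def has_derivative_at_alt
  proof (intro conjI allI impI)
    show "bounded_linear ((*) (h x))" by (rule bounded_linear_mult_right)
    fix e :: real assume "0 < e"
    have "- x \<notin> N'" using x by (metis UnCI image_eqI minus_minus)
    obtain d where d: "d > 0" "\<And>t. 0 < t \<Longrightarrow> t < d \<Longrightarrow> norm (integral (cbox x (x + t *\<^sub>R One)) h /\<^sub>R t ^ DIM(real) - h x) < e"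
      using N(2)[OF _ \<open>0 < e\<close>, of x] x by blast
    obtain d' where d': "d' > 0" "\<And>t. 0 < t \<Longrightarrow> t < d' \<Longrightarrow> norm (integral (cbox (-x) (-x + t *\<^sub>R One)) (\<lambda>x. h (- x)) /\<^sub>R t ^ DIM(real) - h x) < e"
      using N'(2)[OF \<open>- x \<notin> N'\<close> \<open>0 < e\<close>] by auto
    have "norm (G y - G x - h x * (y - x)) \<le> e * norm (y - x)" if y: "norm (y - x) < min d d'" for y
    proof (cases x y rule: linorder_cases)
      case less
      have "norm ((G y - G x) / (y - x) - h x) < e"
        using d(2)[of "y - x"] y less integral_unique[OF h[of x y]] by (simp add: divide_inverse mult.commute)
      then have "norm ((G y - G x) / (y - x) - h x) * (y - x) \<le> e * (y - x)"
        using less by (intro mult_right_mono) auto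
      also have "norm ((G y - G x) / (y - x) - h x) * (y - x) = norm (((G y - G x) / (y - x) - h x) * (y - x))"
        using less by (simp add: abs_mult)
      also have "((G y - G x) / (y - x) - h x) * (y - x) = G y - G x - h x * (y - x)"
        using less by (simp add: field_simps)
      finally show ?thesis using less by simp
    next
      case greater
      have "norm ((G x - G y) / (x - y) - h x) < e"
        using d'(2)[of "x - y"] y greater integral_unique[OF h'[of "-x" "-y"]] by (simp add: divide_inverse mult.commute)
      then have "norm ((G x - G y) / (x - y) - h x) * (x - y) \<le> e * (x - y)"
        using greater by (intro mult_right_mono) auto
      also have "norm ((G x - G y) / (x - y) - h x) * (x - y) = norm (((G x - G y) / (x - y) - h x) * (x - y))"
        using greater by (simp add: abs_mult)
      also have "((G x - G y) / (x - y) - h x) * (x - y) = - (G y - G x - h x * (y - x))"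
        using greater by (simp add: field_simps)
      finally show ?thesis using greater by simp
    qed simp
    then show "\<exists>d>0. \<forall>y. norm (y - x) < d \<longrightarrow> norm (G y - G x - h x * (y - x)) \<le> e * norm (y - x)"
      using d(1) d'(1) by (intro exI[of _ "min d d'"]) auto
  qed
  moreover have "N \<union> uminus ` N' \<in> null_sets lebesgue"
    using neg by (simp add: negligible_iff_null_sets)
  ultimately show ?thesis
    by (intro AE_I'[of "N \<union> uminus ` N'"]) auto
qed

text \<open>G is the difference of \<open>total_var G\<close> and \<open>total_var G - G\<close>,
  both monotone and absolutely continuous. Their densities are nonnegative, so the difference of the
  densities is absolutely integrable.\<close>

theorem locally_abs_continuous_ftc:
  assumes G: "locally_abs_continuous G"
  obtains h where "h \<in> borel_measurable borel"
    "\<And>a b. a \<le> b \<Longrightarrow> (h has_integral G b - G a) {a..b}"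
    "\<And>a b. h absolutely_integrable_on {a..b}"
    "AE x in lebesgue. (G has_real_derivative h x) (at x)"
proof -
  let ?V = "total_var G"
  have V: "locally_abs_continuous ?V" by (rule locally_abs_continuous_total_var[OF G])
  have diff: "\<bar>G y - G x\<bar> \<le> ?V y - ?V x" if "x \<le> y" for x y
  proof -
    have "enn2real (ennreal \<bar>G y - G x\<bar>) \<le> enn2real (variation G {x..y})"
      by (rule enn2real_mono[OF osc_le_variation[OF that]]) (use variation_finite[OF G] in auto)
    then show ?thesis using total_var_diff[OF G that] by simp
  qed
  obtain h1 where h1: "h1 \<in> borel_measurable borel" "\<And>x. 0 \<le> h1 x"
    "\<And>a b. a \<le> b \<Longrightarrow> (h1 has_integral ?V b - ?V a) {a..b}"
  proof (rule mono_locally_abs_continuous_density[OF _ V])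
    show "?V x \<le> ?V y" if "x \<le> y" for x y using diff[OF that] by linarith
  qed blast
  obtain h2 where h2: "h2 \<in> borel_measurable borel" "\<And>x. 0 \<le> h2 x"
    "\<And>a b. a \<le> b \<Longrightarrow> (h2 has_integral (?V b - G b) - (?V a - G a)) {a..b}"
  proof (rule mono_locally_abs_continuous_density)
    show "locally_abs_continuous (\<lambda>x. ?V x - G x)"
      by (rule locally_abs_continuous_dominated[OF V G]) linarith
    show "?V x - G x \<le> ?V y - G y" if "x \<le> y" for x y using diff[OF that] by linarith
  qed blast
  have ai: "h1 absolutely_integrable_on {a..b}" "h2 absolutely_integrable_on {a..b}" for a b
    using h1(2,3) h2(2,3) by (cases "a \<le> b"; force intro!: nonnegative_absolutely_integrable_1)+
  have hi: "((\<lambda>x. h1 x - h2 x) has_integral G b - G a) {a..b}" if "a \<le> b" for a b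
    using has_integral_diff[OF h1(3)[OF that] h2(3)[OF that]] by (simp add: algebra_simps)
  show thesis
  proof (rule that[of "\<lambda>x. h1 x - h2 x"])
    show "AE x in lebesgue. (G has_real_derivative h1 x - h2 x) (at x)"
      by (rule lebesgue_differentiation[OF hi])
  qed (use h1(1) h2(1) hi set_integral_diff(1)[OF ai] in auto)
qed

section \<open>The Hardy--Littlewood maximal function\<close>

text \<open>The uncentred Hardy-Littlewood maximal function. With rational end points the superlevel
  sets are countable unions of open intervals, hence Borel whatever \<open>g\<close> is; the price
  is a factor 2 in \<open>integral_le_maximal\<close>.\<close>

definition maximal :: "(real \<Rightarrow> ennreal) \<Rightarrow> real \<Rightarrow> ennreal" where
  "maximal g x = (SUP (a, b) \<in> {(a, b). real_of_rat a < x \<and> x < real_of_rat b}.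
     (\<integral>\<^sup>+ y. g y * indicator {of_rat a..of_rat b} y \<partial>lborel) / ennreal (of_rat b - of_rat a))"

lemma maximal_greater_iff:
  "c < maximal g x \<longleftrightarrow> (\<exists>a b. real_of_rat a < x \<and> x < real_of_rat b \<and>
     c < (\<integral>\<^sup>+ y. g y * indicator {of_rat a..of_rat b} y \<partial>lborel) / ennreal (of_rat b - of_rat a))"
  by (auto simp: maximal_def less_SUP_iff)

lemma borel_measurable_maximal [measurable]: "maximal g \<in> borel_measurable borel"
proof (rule borel_measurableI_greater)
  fix c
  define I where "I = (\<lambda>(a, b). (\<integral>\<^sup>+ y. g y * indicator {of_rat a..of_rat b} y \<partial>lborel) / ennreal (real_of_rat b - of_rat a))"
  have "{x \<in> space borel. c < maximal g x} = (\<Union>(a, b)\<in>{ab. c < I ab}. {real_of_rat a<..<real_of_rat b})"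
    by (auto simp: maximal_greater_iff I_def) metis
  also have "\<dots> \<in> sets borel"
    by (intro sets.countable_UN') (auto intro: countable_subset[OF subset_UNIV])
  finally show "{x \<in> space borel. c < maximal g x} \<in> sets borel" .
qed

text \<open>An interval around \<open>x\<close> is contained in one with rational end points and twice its length.\<close>

lemma integral_le_maximal:
  assumes "a < b" "a \<le> x" "x \<le> b"
  shows "(\<integral>\<^sup>+ y. g y * indicator {a..b} y \<partial>lborel) \<le> ennreal (2 * (b - a)) * maximal g x"
proof -
  obtain q where q: "a - (b - a) / 2 < real_of_rat q" "real_of_rat q < a"
    using of_rat_dense[of "a - (b - a) / 2" a] assms by auto
  obtain r where r: "b < real_of_rat r" "real_of_rat r < b + (b - a) / 2"
    using of_rat_dense[of b "b + (b - a) / 2"] assms by auto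
  define I where "I = (\<integral>\<^sup>+ y. g y * indicator {of_rat q..of_rat r} y \<partial>lborel)"
  define l where "l = real_of_rat r - real_of_rat q"
  have l: "0 < l" "l \<le> 2 * (b - a)" using q r assms by (auto simp: l_def field_simps)
  have "(\<integral>\<^sup>+ y. g y * indicator {a..b} y \<partial>lborel) \<le> I"
    unfolding I_def using q r by (intro nn_integral_mono) (auto simp: indicator_def)
  also have "I = ennreal l * (I / ennreal l)"
    using l by (simp add: ennreal_times_divide ennreal_mult_divide_eq mult.commute[of "ennreal l"])
  also have "I / ennreal l \<le> maximal g x"
    unfolding maximal_def I_def l_def using q r assms
    by (intro SUP_upper2[of "(q, r)"]) auto
  also have "ennreal l * maximal g x \<le> ennreal (2 * (b - a)) * maximal g x"
    using l by (intro mult_right_mono ennreal_leI) auto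
  finally show ?thesis by (simp add: mult_left_mono)
qed

text \<open>Every point of the superlevel set lies in an interval on which the average exceeds
  \<tau>. Vitali selects disjoint ones whose fivefold enlargements still cover; disjointness sums
  their integrals to at most the total.\<close>

lemma maximal_weak_type:
  assumes g[measurable]: "g \<in> borel_measurable borel"
    and fin: "(\<integral>\<^sup>+ y. g y \<partial>lborel) < \<infinity>" and "0 < \<tau>"
  shows "ennreal \<tau> * emeasure lborel {x. ennreal \<tau> < maximal g x} \<le> 5 * (\<integral>\<^sup>+ y. g y \<partial>lborel)"
proof -
  define G where "G = (\<integral>\<^sup>+ y. g y \<partial>lborel)"
  define J where "J = (\<lambda>(a, b). {real_of_rat a..real_of_rat b})"
  define K where "K = {(a, b). a < b \<and> ennreal \<tau> < (\<integral>\<^sup>+ y. g y * indicator (J (a, b)) y \<partial>lborel) / ennreal (of_rat b - of_rat a)}"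
  define c where "c = (\<lambda>(a, b). (real_of_rat a + real_of_rat b) / 2)"
  define r where "r = (\<lambda>(a, b). (real_of_rat b - real_of_rat a) / 2)"
  have cball: "cball (c i) (r i) = J i" for i
    by (cases i) (auto simp: c_def r_def J_def cball_def dist_real_def abs_le_iff field_simps)
  define \<nu> where "\<nu> = density lborel g"
  have sets\<nu>[simp]: "sets \<nu> = sets borel" by (simp add: \<nu>_def)
  have \<nu>J: "\<nu> A = (\<integral>\<^sup>+ y. g y * indicator A y \<partial>lborel)" if "A \<in> sets borel" for A
    using that by (simp add: \<nu>_def emeasure_density)
  have Jb[measurable]: "J i \<in> sets borel" for i by (cases i) (simp add: J_def)
  have K: "0 < r i" "ennreal \<tau> * ennreal (2 * r i) \<le> \<nu> (J i)" if "i \<in> K" for i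
  proof -
    obtain a b where i: "i = (a, b)" by (cases i)
    have ab: "a < b" "ennreal \<tau> \<le> \<nu> (J i) / ennreal (of_rat b - of_rat a)"
      using that \<nu>J[of "J i"] by (auto simp: K_def i)
    then show "0 < r i" by (simp add: r_def i of_rat_less)
    have "ennreal \<tau> * ennreal (of_rat b - of_rat a) \<le> \<nu> (J i) / ennreal (of_rat b - of_rat a) * ennreal (of_rat b - of_rat a)"
      using ab by (intro mult_right_mono) auto
    also have "\<dots> = \<nu> (J i)"
      using ab by (simp add: ennreal_divide_times ennreal_divide_self of_rat_less of_rat_less_eq)
    finally have "ennreal \<tau> * ennreal (of_rat b - of_rat a) \<le> \<nu> (J i)" .
    moreover have "2 * r i = of_rat b - of_rat a" by (simp add: r_def i)
    ultimately show "ennreal \<tau> * ennreal (2 * r i) \<le> \<nu> (J i)" by (simp only:)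
  qed
  have \<nu>G: "\<nu> A \<le> G" for A
  proof -
    have "\<nu> A \<le> \<nu> UNIV" by (metis emeasure_space sets\<nu> sets_eq_imp_space_eq space_borel)
    also have "\<dots> = G" using \<nu>J[of UNIV] by (simp add: G_def)
    finally show ?thesis .
  qed
  obtain B where B: "G = ennreal B" "0 \<le> B" using fin by (cases G) (auto simp: G_def)
  \<comment> \<open>The covering lemma needs bounded radii. The integral over an interval of
    \<open>K\<close> is at least \<tau> times its length, so the finite total integral bounds the
    length.\<close>
  have rB: "r i \<le> B / (2 * \<tau>)" if "i \<in> K" for i
  proof -
    have "ennreal (\<tau> * (2 * r i)) \<le> ennreal B"
      using K[OF that] \<nu>G[of "J i"] \<open>0 < \<tau>\<close> B by (simp add: ennreal_mult' order_trans)
    then show ?thesis using B \<open>0 < \<tau>\<close> by (simp add: field_simps)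
  qed
  have cov: "{x. ennreal \<tau> < maximal g x} \<subseteq> (\<Union>i\<in>K. cball (c i) (r i))"
  proof
    fix x assume "x \<in> {x. ennreal \<tau> < maximal g x}"
    then obtain a b where ab: "real_of_rat a < x" "x < real_of_rat b"
      "ennreal \<tau> < (\<integral>\<^sup>+ y. g y * indicator {of_rat a..of_rat b} y \<partial>lborel) / ennreal (of_rat b - of_rat a)"
      by (auto simp: maximal_greater_iff)
    then have "a < b" by (metis less_trans of_rat_less)
    with ab have "(a, b) \<in> K" by (simp add: K_def J_def)
    moreover have "x \<in> J (a, b)" using ab by (simp add: J_def)
    ultimately show "x \<in> (\<Union>i\<in>K. cball (c i) (r i))" unfolding cball by blast
  qed
  obtain C where C: "countable C" "C \<subseteq> K"
    "pairwise (\<lambda>i j. disjnt (cball (c i) (r i)) (cball (c j) (r j))) C"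
    "{x. ennreal \<tau> < maximal g x} \<subseteq> (\<Union>i\<in>C. cball (c i) (5 * r i))"
    by (rule Vitali_covering_lemma_cballs[OF cov conjI[OF K(1) rB]]) (assumption | rule that)+
  \<comment> \<open>The countable family is indexed by all naturals, with empty sets at numbers that
    encode no member, so that series can be used.\<close>
  define A where "A n = (if n \<in> to_nat ` C then cball (c (from_nat n)) (5 * r (from_nat n)) else {})" for n
  define D where "D n = (if n \<in> to_nat ` C then J (from_nat n) else {})" for n
  have "{x. ennreal \<tau> < maximal g x} \<subseteq> (\<Union>n. A n)"
  proof
    fix x assume "x \<in> {x. ennreal \<tau> < maximal g x}"
    then obtain i where "i \<in> C" "x \<in> cball (c i) (5 * r i)" using C(4) by blast
    then have "x \<in> A (to_nat i)" unfolding A_def by (simp only: imageI if_True from_nat_to_nat)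
    then show "x \<in> (\<Union>n. A n)" by blast
  qed
  then have "emeasure lborel {x. ennreal \<tau> < maximal g x} \<le> emeasure lborel (\<Union>n. A n)"
    by (intro emeasure_mono) (auto simp: A_def)
  also have "\<dots> \<le> (\<Sum>n. emeasure lborel (A n))"
    by (intro emeasure_subadditive_countably) (auto simp: A_def)
  finally have "ennreal \<tau> * emeasure lborel {x. ennreal \<tau> < maximal g x} \<le> ennreal \<tau> * (\<Sum>n. emeasure lborel (A n))"
    by (intro mult_left_mono) auto
  also have "\<dots> = (\<Sum>n. ennreal \<tau> * emeasure lborel (A n))"
    by (simp add: ennreal_suminf_cmult)
  also have "\<dots> \<le> (\<Sum>n. 5 * \<nu> (D n))"
  proof (intro suminf_le)
    fix n
    show "ennreal \<tau> * emeasure lborel (A n) \<le> 5 * \<nu> (D n)"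
    proof (cases "n \<in> to_nat ` C")
      case True
      then obtain i where i: "i \<in> C" "n = to_nat i" by blast
      have "0 < r i" using i K(1) C(2) by blast
      then have "emeasure lborel (A n) = ennreal (10 * r i)"
        using i by (simp add: A_def cball_eq_atLeastAtMost)
      also have "\<dots> = 5 * ennreal (2 * r i)"
        using \<open>0 < r i\<close> by (simp flip: ennreal_numeral ennreal_mult)
      finally have "ennreal \<tau> * emeasure lborel (A n) = 5 * (ennreal \<tau> * ennreal (2 * r i))"
        by (simp add: mult_ac)
      also have "\<dots> \<le> 5 * \<nu> (D n)"
        using K(2)[of i] i C(2) by (intro mult_left_mono) (auto simp: D_def)
      finally show ?thesis .
    qed (simp add: A_def)
  qed auto
  also have "\<dots> = 5 * (\<Sum>n. \<nu> (D n))" by (simp add: ennreal_suminf_cmult)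
  also have "(\<Sum>n. \<nu> (D n)) = \<nu> (\<Union>n. D n)"
  proof (rule suminf_emeasure)
    have "J i \<inter> J j = {}" if "i \<in> C" "j \<in> C" "i \<noteq> j" for i j
      using C(3) that unfolding cball pairwise_def disjnt_def by blast
    moreover have "from_nat m \<noteq> (from_nat n :: rat \<times> rat)" if "m \<noteq> n" "m \<in> to_nat ` C" "n \<in> to_nat ` C" for m n
      using that by force
    moreover have "from_nat n \<in> C" if "n \<in> to_nat ` C" for n
      using that by auto
    ultimately show "disjoint_family D"
      unfolding disjoint_family_on_def D_def by (simp del: split_paired_All)
  qed (auto simp: D_def)
  also have "5 * \<nu> (\<Union>n. D n) \<le> 5 * G" by (intro mult_left_mono \<nu>G) auto
  finally show ?thesis by (simp add: G_def)
qed

lemma ennreal_powr_ennreal: "0 \<le> t \<Longrightarrow> ennreal_powr (ennreal t) q = ennreal (t powr q)"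
  by (simp add: ennreal_powr_def)

lemma ennreal_powr_mono:
  assumes "s \<le> t" "0 \<le> q"
  shows "ennreal_powr s q \<le> ennreal_powr t q"
  using assms
  by (cases s; cases t) (auto simp: ennreal_powr_def top_unique intro!: ennreal_leI powr_mono2)

lemma borel_measurable_ennreal_powr [measurable]:
  assumes [measurable]: "f \<in> borel_measurable M"
  shows "(\<lambda>x. ennreal_powr (f x) q) \<in> borel_measurable M"
  unfolding ennreal_powr_def by measurable

text \<open>Integrand of the layer-cake formula: t^q is the integral of q s^(q-1) over 0 < s < t.
  The strict inequality matches the superlevel sets of the weak-type bound.\<close>

definition layer :: "real \<Rightarrow> ennreal \<Rightarrow> real \<Rightarrow> ennreal" where
  "layer q t s = ennreal (q * s powr (q - 1)) * indicator {s. 0 \<le> s \<and> ennreal s < t} s"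

lemma nn_integral_layer:
  fixes t :: ennreal
  assumes q: "0 < q"
  shows "(\<integral>\<^sup>+ s. layer q t s \<partial>lborel) = ennreal_powr t q"
    (is "?I t = _")
proof -
  have fin: "?I (ennreal a) = ennreal (a powr q)" if a: "0 \<le> a" for a
  proof -
    have "((\<lambda>s. q * s powr (q - 1)) has_integral q * (a powr (q - 1 + 1) / (q - 1 + 1))) {0..a}"
      using q a by (intro has_integral_mult_right has_integral_powr_from_0) auto
    then have "((\<lambda>s. q * s powr (q - 1)) has_integral (a powr q)) {0..a}" using q by simp
    then have "(\<integral>\<^sup>+ s. ennreal (q * s powr (q - 1)) * indicator {0..a} s \<partial>lborel) = ennreal (a powr q)"
      using q by (intro nn_integral_has_integral_lebesgue') auto
    moreover have "?I (ennreal a) = (\<integral>\<^sup>+ s. ennreal (q * s powr (q - 1)) * indicator {0..a} s \<partial>lborel)"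
    proof (rule nn_integral_cong_AE)
      have "AE s in lborel. s \<noteq> a" by (rule AE_lborel_singleton)
      then show "AE s in lborel. layer q (ennreal a) s =
          ennreal (q * s powr (q - 1)) * indicator {0..a} s"
        by eventually_elim (use a in \<open>auto simp: layer_def indicator_def ennreal_less_iff\<close>)
    qed
    ultimately show ?thesis by simp
  qed
  show ?thesis
  proof (cases t)
    case (real a)
    then show ?thesis using fin[of a] by (simp add: ennreal_powr_ennreal)
  next
    case top
    \<comment> \<open>For infinite t the integral exceeds every B, since it dominates the one that
      stops at B^(1/q).\<close>
    have large: "ennreal B \<le> ?I top" if "0 < B" for B
    proof -
      have "ennreal B = ?I (ennreal (B powr (1 / q)))"
        using fin[of "B powr (1/q)"] q that by (simp add: powr_powr)
      also have "\<dots> \<le> ?I top"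
        unfolding layer_def by (intro nn_integral_mono mult_left_mono) (auto simp: indicator_def)
      finally show ?thesis .
    qed
    have "?I top = top"
    proof (cases "?I top")
      case (real r)
      with large[of "r + 1"] show ?thesis by (simp add: ennreal_le_iff2)
    qed
    then show ?thesis using top by (simp add: ennreal_powr_def)
  qed
qed

text \<open>Where \<open>2 * g y \<le> s\<close>, the function adds at most s/2 to any average.
  Hence \<open>maximal g x > s\<close> forces the truncated part to have maximal function above
  s/2.\<close>

lemma maximal_le_truncate:
  assumes g[measurable]: "g \<in> borel_measurable borel" and s: "0 \<le> s"
  shows "maximal g x \<le> maximal (\<lambda>y. g y * indicator {y. ennreal s < 2 * g y} y) x + ennreal (s / 2)"
  unfolding maximal_def[of g]
proof (rule SUP_least, clarify)
  fix a b assume ab: "real_of_rat a < x" "x < real_of_rat b"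
  define g' where "g' = (\<lambda>y. g y * indicator {y. ennreal s < 2 * g y} y)"
  define l where "l = real_of_rat b - real_of_rat a"
  have [measurable]: "g' \<in> borel_measurable borel" unfolding g'_def by measurable
  have l: "0 < l" using ab by (simp add: l_def)
  have le: "g y \<le> g' y + ennreal (s / 2)" for y
  proof (cases "ennreal s < 2 * g y")
    case False
    then have "2 * g y \<le> ennreal s" by simp
    then have "g y \<le> ennreal (s / 2)"
      using s by (cases "g y") (auto simp: ennreal_mult_top ennreal_le_iff top_unique simp flip: ennreal_numeral ennreal_mult)
    then show ?thesis by (simp add: add_increasing)
  qed (simp add: g'_def)
  let ?J = "{real_of_rat a..real_of_rat b}"
  have "(\<integral>\<^sup>+ y. g y * indicator ?J y \<partial>lborel) \<le> (\<integral>\<^sup>+ y. g' y * indicator ?J y + ennreal (s / 2) * indicator ?J y \<partial>lborel)"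
    using le by (intro nn_integral_mono) (auto simp: indicator_def)
  also have "\<dots> = (\<integral>\<^sup>+ y. g' y * indicator ?J y \<partial>lborel) + ennreal (s / 2) * ennreal l"
    using ab by (subst nn_integral_add) (auto simp: nn_integral_cmult l_def)
  finally have "(\<integral>\<^sup>+ y. g y * indicator ?J y \<partial>lborel) / ennreal l \<le>
      (\<integral>\<^sup>+ y. g' y * indicator ?J y \<partial>lborel) / ennreal l + ennreal (s / 2) * ennreal l / ennreal l"
    by (metis divide_right_mono_ennreal add_divide_distrib_ennreal)
  also have "ennreal (s / 2) * ennreal l / ennreal l = ennreal (s / 2)"
    using l by (intro ennreal_mult_divide_eq) auto
  also have "(\<integral>\<^sup>+ y. g' y * indicator ?J y \<partial>lborel) / ennreal l \<le> maximal g' x"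
    unfolding maximal_def l_def using ab by (intro SUP_upper2[of "(a, b)"]) auto
  finally show "(\<integral>\<^sup>+ y. g y * indicator ?J y \<partial>lborel) / ennreal (real_of_rat b - real_of_rat a)
      \<le> maximal g' x + ennreal (s / 2)"
    by (simp add: l_def add_right_mono)
qed

text \<open>Marcinkiewicz interpolation: layer cake, the weak-type bound for the truncation at
  height s, and Fubini. In the constant, 10 is 2 times 5 (weak type at level s/2), p/(p - 1) passes
  from \<open>layer p\<close> to \<open>layer q\<close> with q = p - 1, and 2^(p-1) stems from
  \<open>layer q (2 * g x)\<close>.\<close>

lemma maximal_strong_type:
  assumes g[measurable]: "g \<in> borel_measurable borel" and p: "1 < p"
  shows "(\<integral>\<^sup>+ x. ennreal_powr (maximal g x) p \<partial>lborel)
    \<le> ennreal (10 * p / (p - 1) * 2 powr (p - 1)) * (\<integral>\<^sup>+ x. ennreal_powr (g x) p \<partial>lborel)"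
proof -
  define q where "q = p - 1"
  have q: "0 < q" using p by (simp add: q_def)
  have weak: "ennreal s * emeasure lborel {x. ennreal s < maximal g x}
      \<le> 10 * (\<integral>\<^sup>+ x. g x * indicator {y. ennreal s < 2 * g y} x \<partial>lborel)" if s: "0 < s" for s
  proof -
    define g' where "g' = (\<lambda>y. g y * indicator {y. ennreal s < 2 * g y} y)"
    have [measurable]: "g' \<in> borel_measurable borel" unfolding g'_def by measurable
    have "ennreal (s / 2) * emeasure lborel {x. ennreal (s / 2) < maximal g' x} \<le> 5 * (\<integral>\<^sup>+ x. g' x \<partial>lborel)"
    \<comment> \<open>The weak-type bound presupposes a finite integral; when it is infinite the
      right-hand side is infinite.\<close>
    proof (cases "(\<integral>\<^sup>+ x. g' x \<partial>lborel) < \<infinity>")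
      case True
      then show ?thesis by (intro maximal_weak_type) (use s in auto)
    next
      case False
      then have "(\<integral>\<^sup>+ x. g' x \<partial>lborel) = top" by (metis infinity_ennreal_def top.not_eq_extremum)
      then show ?thesis by (simp add: ennreal_mult_top)
    qed
    moreover have "{x. ennreal s < maximal g x} \<subseteq> {x. ennreal (s / 2) < maximal g' x}"
    proof
      fix x assume "x \<in> {x. ennreal s < maximal g x}"
      then have "ennreal (s / 2) + ennreal (s / 2) < maximal g' x + ennreal (s / 2)"
        using maximal_le_truncate[OF g, of s x] s by (simp add: g'_def flip: ennreal_plus)
      then show "x \<in> {x. ennreal (s / 2) < maximal g' x}"
        by (metis add_right_mono leD leI mem_Collect_eq)
    qed
    then have "emeasure lborel {x. ennreal s < maximal g x} \<le> emeasure lborel {x. ennreal (s / 2) < maximal g' x}"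
      by (intro emeasure_mono) auto
    ultimately have "ennreal (s / 2) * emeasure lborel {x. ennreal s < maximal g x} \<le> 5 * (\<integral>\<^sup>+ x. g' x \<partial>lborel)"
      by (meson mult_left_mono order_trans zero_le)
    then have "2 * (ennreal (s / 2) * emeasure lborel {x. ennreal s < maximal g x}) \<le> 2 * (5 * (\<integral>\<^sup>+ x. g' x \<partial>lborel))"
      by (intro mult_left_mono) auto
    moreover have "2 * ennreal (s / 2) = ennreal s"
      using s by (simp flip: ennreal_numeral ennreal_mult)
    ultimately show ?thesis by (simp add: g'_def mult.assoc[symmetric])
  qed
  have "(\<integral>\<^sup>+ x. ennreal_powr (maximal g x) p \<partial>lborel)
      = (\<integral>\<^sup>+ x. \<integral>\<^sup>+ s. layer p (maximal g x) s \<partial>lborel \<partial>lborel)"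
    using p by (simp add: nn_integral_layer)
  also have "\<dots> = (\<integral>\<^sup>+ s. \<integral>\<^sup>+ x. layer p (maximal g x) s \<partial>lborel \<partial>lborel)"
    by (rule lborel_pair.Fubini') (simp add: layer_def split_beta' indicator_def, measurable)
  \<comment> \<open>By the weak-type bound the factor p s^(p-1) loses one power of s, which leaves a
    multiple of q s^(q-1), the integrand of \<open>layer q\<close>.\<close>
  also have "\<dots> \<le> (\<integral>\<^sup>+ s. \<integral>\<^sup>+ x. ennreal (10 * p / q) * (g x * layer q (2 * g x) s) \<partial>lborel \<partial>lborel)"
  proof (rule nn_integral_mono)
    fix s :: real
    show "(\<integral>\<^sup>+ x. layer p (maximal g x) s \<partial>lborel)
      \<le> (\<integral>\<^sup>+ x. ennreal (10 * p / q) * (g x * layer q (2 * g x) s) \<partial>lborel)"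
    proof (cases "0 < s")
      case True
      have "(\<integral>\<^sup>+ x. layer p (maximal g x) s \<partial>lborel)
        = (\<integral>\<^sup>+ x. ennreal (p * s powr (p - 1)) * indicator {x. ennreal s < maximal g x} x \<partial>lborel)"
        using True by (intro nn_integral_cong) (auto simp: layer_def indicator_def)
      also have "\<dots> = ennreal (p * s powr (p - 1)) * emeasure lborel {x. ennreal s < maximal g x}"
        by (subst nn_integral_cmult) auto
      also have "\<dots> = ennreal (p * s powr (q - 1)) * (ennreal s * emeasure lborel {x. ennreal s < maximal g x})"
      proof -
        have "p * s powr (p - 1) = p * s powr (q - 1) * s"
          using True powr_add[of s "q - 1" 1] by (simp add: q_def)
        then show ?thesis using True p by (simp add: ennreal_mult mult_ac)
      qed
      also have "\<dots> \<le> ennreal (p * s powr (q - 1)) * (10 * (\<integral>\<^sup>+ x. g x * indicator {y. ennreal s < 2 * g y} x \<partial>lborel))"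
        by (intro mult_left_mono weak True) auto
      also have "\<dots> = ennreal (10 * p / q) * ennreal (q * s powr (q - 1)) * (\<integral>\<^sup>+ x. g x * indicator {y. ennreal s < 2 * g y} x \<partial>lborel)"
      proof -
        have "ennreal (10 * p / q) * ennreal (q * s powr (q - 1)) = ennreal (10 * (p * s powr (q - 1)))"
          using q p by (simp flip: ennreal_mult')
        also have "\<dots> = 10 * ennreal (p * s powr (q - 1))"
          using p by (simp add: ennreal_mult')
        finally show ?thesis by (simp add: mult_ac)
      qed
      also have "\<dots> = (\<integral>\<^sup>+ x. ennreal (10 * p / q) * ennreal (q * s powr (q - 1)) * (g x * indicator {y. ennreal s < 2 * g y} x) \<partial>lborel)"
        by (subst nn_integral_cmult) auto
      also have "\<dots> = (\<integral>\<^sup>+ x. ennreal (10 * p / q) * (g x * layer q (2 * g x) s) \<partial>lborel)"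
        using True by (intro nn_integral_cong) (auto simp: layer_def indicator_def mult_ac)
      finally show ?thesis .
    next
      case False
      then have "(\<integral>\<^sup>+ x. layer p (maximal g x) s \<partial>lborel) = (\<integral>\<^sup>+ (x::real). 0 \<partial>lborel)"
        by (intro nn_integral_cong) (auto simp: layer_def indicator_def)
      then show ?thesis by simp
    qed
  qed
  also have "\<dots> = (\<integral>\<^sup>+ x. \<integral>\<^sup>+ s. ennreal (10 * p / q) * (g x * layer q (2 * g x) s) \<partial>lborel \<partial>lborel)"
    by (rule lborel_pair.Fubini'[symmetric]) (simp add: layer_def split_beta' indicator_def, measurable)
  also have "\<dots> = (\<integral>\<^sup>+ x. ennreal (10 * p / q) * (g x * ennreal_powr (2 * g x) q) \<partial>lborel)"
  proof -
    have [measurable]: "layer q (2 * g x) \<in> borel_measurable borel" for x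
      unfolding layer_def by measurable
    show ?thesis using q by (simp add: nn_integral_cmult nn_integral_layer)
  qed
  also have "\<dots> = ennreal (10 * p / q) * (\<integral>\<^sup>+ x. ennreal (2 powr q) * ennreal_powr (g x) p \<partial>lborel)"
  proof -
    have "g x * ennreal_powr (2 * g x) q = ennreal (2 powr q) * ennreal_powr (g x) p" for x
    proof (cases "g x")
      case (real r)
      have "2 * ennreal r = ennreal (2 * r)" using real by (simp add: ennreal_mult)
      moreover have "r * (2 * r) powr q = 2 powr q * r powr p"
        using real powr_add[of r 1 q] by (cases "r = 0") (auto simp: powr_mult q_def)
      ultimately show ?thesis using real by (simp add: ennreal_powr_ennreal flip: ennreal_mult)
    next
      case top
      then show ?thesis by (simp add: ennreal_mult_top ennreal_powr_def)
    qed
    then show ?thesis by (simp add: nn_integral_cmult)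
  qed
  also have "\<dots> = ennreal (10 * p / q) * (ennreal (2 powr q) * (\<integral>\<^sup>+ x. ennreal_powr (g x) p \<partial>lborel))"
    by (subst nn_integral_cmult) auto
  also have "\<dots> = ennreal (10 * p / q * 2 powr q) * (\<integral>\<^sup>+ x. ennreal_powr (g x) p \<partial>lborel)"
  proof -
    have "ennreal (10 * p / q * 2 powr q) = ennreal (10 * p / q) * ennreal (2 powr q)"
      using p q by (intro ennreal_mult) auto
    then show ?thesis by (simp only: mult.assoc)
  qed
  finally show ?thesis by (simp add: q_def)
qed

section \<open>Norms of extended nonnegative functions\<close>

lemma ennreal_powr_mult:
  assumes "0 < q"
  shows "ennreal_powr (s * t) q = ennreal_powr s q * ennreal_powr t q"
proof (cases "s = 0 \<or> t = 0")
  case True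
  then show ?thesis by (auto simp: ennreal_powr_def)
next
  case False
  then show ?thesis
    using assms
    by (cases s; cases t) (auto simp: ennreal_powr_def ennreal_mult_eq_top_iff ennreal_top_mult ennreal_mult_top
        enn2real_mult powr_mult simp flip: ennreal_mult)
qed

lemma ennreal_powr_powr:
  assumes "0 < a" "0 < b"
  shows "ennreal_powr (ennreal_powr t a) b = ennreal_powr t (a * b)"
  using assms by (cases t) (auto simp: ennreal_powr_def powr_powr)

lemma ennreal_powr_one [simp]: "ennreal_powr t 1 = t"
  by (cases t) (auto simp: ennreal_powr_def)

lemma ennreal_powr_less_top_iff [simp]: "ennreal_powr t q < top \<longleftrightarrow> t < top"
  by (cases t) (auto simp: ennreal_powr_def)

lemma Lp_norm_powr:
  assumes "0 < p"
  shows "ennreal_powr (Lp_norm p g) p = (\<integral>\<^sup>+ x. ennreal_powr (g x) p \<partial>lebesgue)"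
  using assms by (simp add: Lp_norm_def ennreal_powr_powr)

lemma Lp_norm_finite_iff: "Lp_norm p g < \<infinity> \<longleftrightarrow> (\<integral>\<^sup>+ x. ennreal_powr (g x) p \<partial>lebesgue) < \<infinity>"
  by (simp add: Lp_norm_def)

lemma Lp_norm_le_powr:
  assumes "0 < p" "(\<integral>\<^sup>+ x. ennreal_powr (g x) p \<partial>lebesgue) \<le> ennreal_powr c p"
  shows "Lp_norm p g \<le> c"
proof -
  have "Lp_norm p g \<le> ennreal_powr (ennreal_powr c p) (1 / p)"
    unfolding Lp_norm_def using assms by (intro ennreal_powr_mono) auto
  then show ?thesis using assms(1) by (simp add: ennreal_powr_powr)
qed

lemma Lp_norm_mono_AE:
  assumes "0 < p" "AE x in lebesgue. g x \<le> h x"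
  shows "Lp_norm p g \<le> Lp_norm p h"
  unfolding Lp_norm_def using assms
  by (intro ennreal_powr_mono nn_integral_mono_AE) (auto intro: ennreal_powr_mono elim!: eventually_mono)

lemma Lp_norm_mono:
  assumes "0 < p" "\<And>x. g x \<le> h x"
  shows "Lp_norm p g \<le> Lp_norm p h"
  by (rule Lp_norm_mono_AE) (use assms in auto)

lemma Lp_norm_cmult:
  assumes [measurable]: "g \<in> borel_measurable lebesgue" and p: "0 < p"
  shows "Lp_norm p (\<lambda>x. c * g x) = c * Lp_norm p g"
  using p unfolding Lp_norm_def
  by (simp add: ennreal_powr_mult nn_integral_cmult ennreal_powr_powr)

text \<open>A sum of n terms is at most n times the largest, whose power is at most the sum of all
  powers. This gives n^(1+1/p), cruder than Minkowski but dependent on n and p only.\<close>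

lemma Lp_norm_sum_le:
  assumes [measurable]: "\<And>j. j \<in> A \<Longrightarrow> g j \<in> borel_measurable lebesgue" and A: "finite A" and p: "0 < p"
  shows "Lp_norm p (\<lambda>x. \<Sum>j\<in>A. g j x) \<le> of_nat (card A) * ennreal_powr (of_nat (card A)) (1 / p) * (\<Sum>j\<in>A. Lp_norm p (g j))"
proof (cases "A = {}")
  case True
  then show ?thesis by (simp add: Lp_norm_def ennreal_powr_def)
next
  case False
  define n where "n = card A"
  define N where "N = (\<Sum>j\<in>A. Lp_norm p (g j))"
  have bound: "ennreal_powr (\<Sum>j\<in>A. g j x) p \<le> ennreal_powr (of_nat n) p * (\<Sum>j\<in>A. ennreal_powr (g j x) p)" for x
  proof -
    define M where "M = Max ((\<lambda>j. g j x) ` A)"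
    have "M \<in> (\<lambda>j. g j x) ` A" unfolding M_def using A False by (intro Max_in) auto
    then obtain i where i: "i \<in> A" "M = g i x" by blast
    have "(\<Sum>j\<in>A. g j x) \<le> (\<Sum>j\<in>A. M)"
      unfolding M_def using A by (intro sum_mono Max_ge) auto
    then have "ennreal_powr (\<Sum>j\<in>A. g j x) p \<le> ennreal_powr (of_nat n * g i x) p"
      using p i by (intro ennreal_powr_mono) (auto simp: n_def)
    also have "\<dots> = ennreal_powr (of_nat n) p * ennreal_powr (g i x) p"
      using p by (rule ennreal_powr_mult)
    also have "ennreal_powr (g i x) p \<le> (\<Sum>j\<in>A. ennreal_powr (g j x) p)"
      using i A by (intro member_le_sum) auto
    finally show ?thesis by (simp add: mult_left_mono)
  qed
  have "(\<integral>\<^sup>+ x. ennreal_powr (\<Sum>j\<in>A. g j x) p \<partial>lebesgue)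
     \<le> (\<integral>\<^sup>+ x. ennreal_powr (of_nat n) p * (\<Sum>j\<in>A. ennreal_powr (g j x) p) \<partial>lebesgue)"
    by (intro nn_integral_mono bound)
  also have "\<dots> = ennreal_powr (of_nat n) p * (\<Sum>j\<in>A. ennreal_powr (Lp_norm p (g j)) p)"
    using p by (simp add: nn_integral_cmult nn_integral_sum Lp_norm_powr)
  also have "(\<Sum>j\<in>A. ennreal_powr (Lp_norm p (g j)) p) \<le> (\<Sum>j\<in>A. ennreal_powr N p)"
    unfolding N_def using A p by (intro sum_mono ennreal_powr_mono member_le_sum) auto
  also have "\<dots> = ennreal_powr (ennreal_powr (of_nat n) (1 / p) * N) p"
    using p by (simp add: n_def ennreal_powr_mult ennreal_powr_powr)
  also have "ennreal_powr (of_nat n) p * \<dots> = ennreal_powr (of_nat n * ennreal_powr (of_nat n) (1 / p) * N) p"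
    using p by (simp add: ennreal_powr_mult mult_ac)
  finally have "(\<integral>\<^sup>+ x. ennreal_powr (\<Sum>j\<in>A. g j x) p \<partial>lebesgue)
     \<le> ennreal_powr (of_nat n * ennreal_powr (of_nat n) (1 / p) * N) p"
    by (simp add: mult_left_mono)
  then show ?thesis unfolding n_def N_def using p by (intro Lp_norm_le_powr)
qed

text \<open>Averages do not see null sets, so a Lebesgue measurable \<open>g\<close> may be replaced
  by a Borel function equal to it almost everywhere.\<close>

lemma Lp_norm_maximal:
  assumes g: "g \<in> borel_measurable lebesgue" and p: "1 < p"
  shows "Lp_norm p (maximal g) \<le> ennreal ((10 * p / (p - 1) * 2 powr (p - 1)) powr (1 / p)) * Lp_norm p g"
proof -
  define A where "A = 10 * p / (p - 1) * 2 powr (p - 1)"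
  have A: "0 < A" using p by (simp add: A_def)
  obtain g' where g': "g' \<in> borel_measurable borel" "AE x in lborel. g x = g' x"
    using completion_ex_borel_measurable[OF g] by auto
  have "maximal g = maximal g'"
    unfolding maximal_def fun_eq_iff
    by (intro allI SUP_cong refl, clarify, intro arg_cong2[where f = "(/)"] refl nn_integral_cong_AE)
      (use g'(2) in \<open>auto elim!: eventually_mono\<close>)
  then have "(\<integral>\<^sup>+ x. ennreal_powr (maximal g x) p \<partial>lebesgue) \<le> ennreal A * (\<integral>\<^sup>+ x. ennreal_powr (g' x) p \<partial>lborel)"
    using maximal_strong_type[OF g'(1) p] by (simp add: nn_integral_completion A_def)
  also have "(\<integral>\<^sup>+ x. ennreal_powr (g' x) p \<partial>lborel) = (\<integral>\<^sup>+ x. ennreal_powr (g x) p \<partial>lebesgue)"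
    unfolding nn_integral_completion by (rule nn_integral_cong_AE) (use g'(2) in \<open>auto elim!: eventually_mono\<close>)
  also have "\<dots> = ennreal_powr (Lp_norm p g) p" using p by (simp add: Lp_norm_powr)
  also have "ennreal A * \<dots> = ennreal_powr (ennreal (A powr (1 / p)) * Lp_norm p g) p"
    using p A by (simp add: ennreal_powr_mult ennreal_powr_ennreal powr_powr)
  finally show ?thesis unfolding A_def using p by (intro Lp_norm_le_powr) auto
qed

section \<open>Divided differences of Sobolev functions\<close>

lemma sobolev_DERIV:
  assumes "F \<in> sobolev m p" "Suc k < m"
  shows "((deriv ^^ k) F has_real_derivative (deriv ^^ Suc k) F t) (at t)"
proof -
  have "(deriv ^^ k) F differentiable (at t)"
    using assms by (auto simp: sobolev_def differentiable_on_def)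
  then show ?thesis by (simp add: DERIV_deriv_iff_real_differentiable)
qed

lemma sobolev_borel_measurable:
  assumes "F \<in> sobolev m p" "k \<le> m"
  shows "(deriv ^^ k) F \<in> borel_measurable lebesgue"
  using assms by (auto simp: sobolev_def Lp_real_def)

lemma abs_integral_le_nn_integral:
  fixes h :: "real \<Rightarrow> real"
  assumes h: "(h has_integral I) S" "h absolutely_integrable_on S"
  shows "ennreal \<bar>I\<bar> \<le> (\<integral>\<^sup>+ t. ennreal \<bar>h t\<bar> * indicator S t \<partial>lborel)"
proof -
  have int: "(\<lambda>t. \<bar>h t\<bar>) integrable_on S"
    using h(2) unfolding absolutely_integrable_on_def by simp
  have "norm (integral S h) \<le> integral S (\<lambda>t. \<bar>h t\<bar>)"
    by (rule Henstock_Kurzweil_Integration.integral_norm_bound_integral) (use h int in auto)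
  then have "ennreal \<bar>I\<bar> \<le> ennreal (integral S (\<lambda>t. \<bar>h t\<bar>))"
    using integral_unique[OF h(1)] by (intro ennreal_leI) simp
  also have "\<dots> = (\<integral>\<^sup>+ t. ennreal \<bar>h t\<bar> * indicator S t \<partial>lborel)"
    by (rule nn_integral_has_integral_lebesgue'[symmetric]) (use int in auto)
  finally show ?thesis .
qed

text \<open>Below the top order the derivative is continuous and the classical fundamental theorem
  applies. At the top order the density of the absolutely continuous derivative of order m - 1
  agrees with \<open>deriv\<close> almost everywhere.\<close>

lemma sobolev_increment_le:
  assumes F: "F \<in> sobolev m p" and k: "k < m" and xy: "x \<le> y"
  shows "ennreal \<bar>(deriv ^^ k) F y - (deriv ^^ k) F x\<bar>
    \<le> (\<integral>\<^sup>+ t. ennreal \<bar>(deriv ^^ Suc k) F t\<bar> * indicator {x..y} t \<partial>lborel)"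
proof -
  let ?D = "\<lambda>k. (deriv ^^ k) F"
  have ac: "locally_abs_continuous (?D (m - 1))" using F by (simp add: sobolev_def)
  have "\<exists>h. (h has_integral ?D k y - ?D k x) {x..y} \<and> h absolutely_integrable_on {x..y} \<and>
      (AE t in lborel. h t = ?D (Suc k) t)"
  proof (cases "Suc k = m")
    case True
    obtain h where h: "\<And>a b. a \<le> b \<Longrightarrow> (h has_integral ?D (m - 1) b - ?D (m - 1) a) {a..b}"
      "\<And>a b. h absolutely_integrable_on {a..b}"
      "AE x in lebesgue. (?D (m - 1) has_real_derivative h x) (at x)"
      by (rule locally_abs_continuous_ftc[OF ac]) blast
    have "AE x in lborel. (?D (m - 1) has_real_derivative h x) (at x)"
      using h(3) by (simp add: AE_completion_iff)
    then have "AE x in lborel. h x = ?D (Suc k) x"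
    proof eventually_elim
      case (elim x)
      then show ?case using True by (auto dest: DERIV_imp_deriv)
    qed
    then show ?thesis using h(1)[OF xy] h(2) True by auto
  next
    case False
    then have k': "Suc k < m" using k by simp
    have cont: "continuous_on {x..y} (?D (Suc k))"
    proof (cases "Suc (Suc k) < m")
      case True
      then show ?thesis
        by (intro continuous_at_imp_continuous_on ballI DERIV_isCont[OF sobolev_DERIV[OF F]])
    next
      case False
      then have "Suc k = m - 1" using k' by simp
      then show ?thesis using locally_abs_continuous_imp_continuous[OF ac] continuous_on_subset by fastforce
    qed
    have "(?D (Suc k) has_integral ?D k y - ?D k x) {x..y}"
      by (rule fundamental_theorem_of_calculus[OF xy])
        (use sobolev_DERIV[OF F k'] in \<open>auto simp: has_real_derivative_iff_has_vector_derivative[symmetric]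
          intro: has_field_derivative_at_within\<close>)
    moreover have "?D (Suc k) absolutely_integrable_on {x..y}"
      using absolutely_integrable_continuous_real[OF cont] .
    ultimately show ?thesis by auto
  qed
  then obtain h where h: "(h has_integral ?D k y - ?D k x) {x..y}" "h absolutely_integrable_on {x..y}"
    "AE t in lborel. h t = ?D (Suc k) t" by blast
  have "ennreal \<bar>?D k y - ?D k x\<bar> \<le> (\<integral>\<^sup>+ t. ennreal \<bar>h t\<bar> * indicator {x..y} t \<partial>lborel)"
    by (rule abs_integral_le_nn_integral[OF h(1,2)])
  also have "\<dots> = (\<integral>\<^sup>+ t. ennreal \<bar>?D (Suc k) t\<bar> * indicator {x..y} t \<partial>lborel)"
    by (rule nn_integral_cong_AE) (use h(3) in \<open>auto elim!: eventually_mono\<close>)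
  finally show ?thesis .
qed

definition jet_sum :: "nat \<Rightarrow> (real \<Rightarrow> real) \<Rightarrow> real \<Rightarrow> ennreal" where
  "jet_sum m F t = (\<Sum>j\<le>m. ennreal \<bar>(deriv ^^ j) F t\<bar>)"

text \<open>The value at \<xi> differs from the value at t by at most the integral of the next
  derivative; averaging over t in an interval of length 1 gives the bound.\<close>

lemma sobolev_pointwise_le:
  assumes F: "F \<in> sobolev m p" and k: "k < m" and ab: "b = a + 1" "a \<le> \<xi>" "\<xi> \<le> b"
  shows "ennreal \<bar>(deriv ^^ k) F \<xi>\<bar>
    \<le> (\<integral>\<^sup>+ t. jet_sum m F t * indicator {a..b} t \<partial>lborel)"
proof -
  let ?D = "\<lambda>k t. ennreal \<bar>(deriv ^^ k) F t\<bar>"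
  let ?I = "\<lambda>k. \<integral>\<^sup>+ t. ?D k t * indicator {a..b} t \<partial>lebesgue"
  have [measurable]: "(deriv ^^ k) F \<in> borel_measurable lebesgue" "(deriv ^^ Suc k) F \<in> borel_measurable lebesgue"
    using F k by (auto intro!: sobolev_borel_measurable simp del: funpow.simps)
  have le: "?D k \<xi> \<le> ?D k t + ?I (Suc k)" if "t \<in> {a..b}" for t
  proof -
    have "ennreal \<bar>(deriv ^^ k) F (max t \<xi>) - (deriv ^^ k) F (min t \<xi>)\<bar>
      \<le> (\<integral>\<^sup>+ s. ?D (Suc k) s * indicator {min t \<xi>..max t \<xi>} s \<partial>lebesgue)"
      unfolding nn_integral_completion by (rule sobolev_increment_le[OF F k]) simp
    also have "\<dots> \<le> ?I (Suc k)"
      using that ab by (intro nn_integral_mono) (auto simp: indicator_def)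
    finally have "ennreal \<bar>(deriv ^^ k) F \<xi> - (deriv ^^ k) F t\<bar> \<le> ?I (Suc k)"
      by (simp add: max_def min_def abs_minus_commute split: if_splits)
    moreover have "?D k \<xi> \<le> ?D k t + ennreal \<bar>(deriv ^^ k) F \<xi> - (deriv ^^ k) F t\<bar>"
      by (simp flip: ennreal_plus add: ennreal_leI)
    ultimately show ?thesis by (meson add_left_mono order_trans)
  qed
  define A where "A = {a..b}"
  have A[measurable]: "A \<in> sets lebesgue" and A1: "emeasure lebesgue A = 1"
    using ab by (auto simp: A_def)
  have "?D k \<xi> = (\<integral>\<^sup>+ t. ?D k \<xi> * indicator A t \<partial>lebesgue)"
    using A by (simp add: nn_integral_cmult_indicator A1)
  also have "\<dots> \<le> (\<integral>\<^sup>+ t. ?D k t * indicator A t + ?I (Suc k) * indicator A t \<partial>lebesgue)"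
    using le by (intro nn_integral_mono) (auto simp: indicator_def A_def)
  also have "\<dots> = (\<integral>\<^sup>+ t. ?D k t * indicator A t \<partial>lebesgue) + (\<integral>\<^sup>+ t. ?I (Suc k) * indicator A t \<partial>lebesgue)"
    by (rule nn_integral_add) measurable
  also have "(\<integral>\<^sup>+ t. ?I (Suc k) * indicator A t \<partial>lebesgue) = ?I (Suc k)"
    using A by (simp add: nn_integral_cmult_indicator A1)
  also have "(\<integral>\<^sup>+ t. ?D k t * indicator A t \<partial>lebesgue) + ?I (Suc k)
      = (\<integral>\<^sup>+ t. ?D k t * indicator A t + ?D (Suc k) t * indicator A t \<partial>lebesgue)"
    unfolding A_def[symmetric] by (rule nn_integral_add[symmetric]) measurable
  also have "\<dots> \<le> (\<integral>\<^sup>+ t. jet_sum m F t * indicator {a..b} t \<partial>lebesgue)"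
  proof (intro nn_integral_mono)
    fix t
    have "?D k t + ?D (Suc k) t = (\<Sum>j\<in>{k, Suc k}. ?D j t)" by simp
    also have "\<dots> \<le> (\<Sum>j\<le>m. ?D j t)" using k by (intro sum_mono2) auto
    finally show "?D k t * indicator A t + ?D (Suc k) t * indicator A t \<le> jet_sum m F t * indicator {a..b} t"
      by (simp add: indicator_def A_def jet_sum_def)
  qed
  finally show ?thesis by (simp add: nn_integral_completion)
qed

text \<open>The margin of length 1 makes room for the unit interval that starts at the mean-value
  point.\<close>

lemma sobolev_dd_le:
  assumes F: "F \<in> sobolev m p" and S: "finite S" "card S = Suc k" "k < m"
    and J: "\<And>s. s \<in> S \<Longrightarrow> a + 1 \<le> s \<and> s \<le> b - 1"
  shows "ennreal \<bar>dd F S\<bar> \<le> (\<integral>\<^sup>+ t. jet_sum m F t * indicator {a..b} t \<partial>lborel)"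
proof -
  have ne: "S \<noteq> {}" using S by auto
  obtain \<xi> where \<xi>: "Min S \<le> \<xi>" "\<xi> \<le> Max S" "fact k * dd F S = (deriv ^^ k) F \<xi>"
    using dd_mean_value[of k "\<lambda>k. (deriv ^^ k) F" S] sobolev_DERIV[OF F] S by auto
  have ab: "a + 1 \<le> \<xi>" "\<xi> \<le> b - 1"
    using \<xi> J[OF Min_in[OF S(1) ne]] J[OF Max_in[OF S(1) ne]] by linarith+
  have "\<bar>dd F S\<bar> \<le> fact k * \<bar>dd F S\<bar>"
    by (simp add: mult_le_cancel_right1)
  also have "\<dots> = \<bar>(deriv ^^ k) F \<xi>\<bar>" using \<xi>(3) by (metis abs_mult abs_of_nonneg fact_ge_zero)
  finally have "ennreal \<bar>dd F S\<bar> \<le> ennreal \<bar>(deriv ^^ k) F \<xi>\<bar>" by (rule ennreal_leI)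
  also have "\<dots> \<le> (\<integral>\<^sup>+ t. jet_sum m F t * indicator {\<xi>..\<xi> + 1} t \<partial>lborel)"
    by (rule sobolev_pointwise_le[OF F S(3)]) auto
  also have "\<dots> \<le> (\<integral>\<^sup>+ t. jet_sum m F t * indicator {a..b} t \<partial>lborel)"
    using ab by (intro nn_integral_mono) (auto simp: indicator_def)
  finally show ?thesis .
qed

lemma diameter_real:
  fixes S :: "real set"
  assumes "finite S" "S \<noteq> {}"
  shows "diameter S = Max S - Min S"
proof (rule antisym)
  show "diameter S \<le> Max S - Min S"
  proof (rule diameter_le)
    show "norm (x - y) \<le> Max S - Min S" if "x \<in> S" "y \<in> S" for x y
      using that assms Max_ge[of S x] Min_le[of S x] Max_ge[of S y] Min_le[of S y] unfolding real_norm_def by linarith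
  qed (use assms in auto)
  have "dist (Max S) (Min S) \<le> diameter S"
    by (rule diameter_bounded_bound) (use assms in \<open>auto intro: finite_imp_bounded\<close>)
  then show "Max S - Min S \<le> diameter S" by (simp add: dist_real_def)
qed

lemma infdist_finite_le:
  fixes S :: "real set"
  assumes "finite S" "S \<noteq> {}" "infdist x S \<le> r"
  obtains s where "s \<in> S" "\<bar>x - s\<bar> \<le> r"
proof -
  have "closed S" using assms(1) by (rule finite_imp_closed)
  then obtain s where "s \<in> S" "infdist x S = dist x s"
    using infdist_attains_inf[of S x] assms by auto
  then show ?thesis using that assms(3) by (auto simp: dist_real_def)
qed

text \<open>Let d be the length of the hull of S. The interval of integration has length d + 2, so
  \<open>integral_le_maximal\<close> costs 2(d + 2), at most 6 for a short set. For d > 1 one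
  recursion step divides the sum of two such bounds by d, and 4(d + 2)/d is at most 12.\<close>

lemma sobolev_dd_le_maximal:
  assumes F: "F \<in> sobolev m p" and S: "finite S" "card S = Suc k" "k < m" and x: "infdist x S \<le> 1"
  shows "ennreal \<bar>dd F S\<bar> \<le> 12 * maximal (jet_sum m F) x"
proof -
  have ne: "S \<noteq> {}" using S by auto
  define u where "u = Min S"
  define v where "v = Max S"
  have uv: "u \<in> S" "v \<in> S" "\<And>s. s \<in> S \<Longrightarrow> u \<le> s \<and> s \<le> v"
    using S ne by (auto simp: u_def v_def)
  define I where "I = (\<integral>\<^sup>+ t. jet_sum m F t * indicator {u - 1..v + 1} t \<partial>lborel)"
  obtain s where s: "s \<in> S" "\<bar>x - s\<bar> \<le> 1" by (rule infdist_finite_le[OF S(1) ne x])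
  have I: "I \<le> ennreal (2 * (v - u + 2)) * maximal (jet_sum m F) x"
    unfolding I_def using integral_le_maximal[of "u - 1" "v + 1" x "jet_sum m F"] uv(3)[OF s(1)] s(2)
    by (simp add: algebra_simps abs_le_iff)
  show ?thesis
  proof (cases "v - u \<le> 1")
    case True
    have "ennreal \<bar>dd F S\<bar> \<le> I"
      unfolding I_def by (rule sobolev_dd_le[OF F S]) (use uv(3) in auto)
    also have "\<dots> \<le> ennreal 12 * maximal (jet_sum m F) x"
    proof -
      have "ennreal (2 * (v - u + 2)) \<le> ennreal 12" using True by (intro ennreal_leI) simp
      from order_trans[OF I mult_right_mono[OF this]] show ?thesis by simp
    qed
    finally show ?thesis by simp
  next
    case False
    define d where "d = v - u"
    have d: "1 < d" using False by (simp add: d_def)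
    have "u \<noteq> v" using False by auto
    then have "S - {u} \<noteq> {}" using uv(2) by auto
    then obtain k' where k': "k = Suc k'"
      using S uv(1) by (metis card_0_eq card_Diff_singleton diff_Suc_1 finite_Diff not0_implies_Suc)
    have "ennreal \<bar>dd F (S - {y})\<bar> \<le> I" if "y \<in> S" for y
      unfolding I_def
      by (rule sobolev_dd_le[OF F, where k = k']) (use S that k' uv(3) in auto)
    from add_mono[OF this[OF uv(1)] this[OF uv(2)]]
    have "ennreal (\<bar>dd F (S - {u})\<bar> + \<bar>dd F (S - {v})\<bar>) \<le> 2 * I" by (simp add: mult_2)
    also have "\<dots> \<le> 2 * (ennreal (2 * (d + 2)) * maximal (jet_sum m F) x)"
      using I by (intro mult_left_mono) (auto simp: d_def)
    finally have *: "ennreal (\<bar>dd F (S - {u})\<bar> + \<bar>dd F (S - {v})\<bar>) \<le> 2 * (ennreal (2 * (d + 2)) * maximal (jet_sum m F) x)" .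
    have "ennreal \<bar>dd F S\<bar> \<le> ennreal ((\<bar>dd F (S - {u})\<bar> + \<bar>dd F (S - {v})\<bar>) * (1 / d))"
      using abs_dd_recursion[OF S(1) uv(1,2), of d F] d by (intro ennreal_leI) (auto simp: d_def)
    also have "\<dots> = ennreal (\<bar>dd F (S - {u})\<bar> + \<bar>dd F (S - {v})\<bar>) * ennreal (1 / d)"
      using d by (intro ennreal_mult) auto
    also have "\<dots> \<le> 2 * (ennreal (2 * (d + 2)) * maximal (jet_sum m F) x) * ennreal (1 / d)"
      by (intro mult_right_mono *) auto
    also have "\<dots> = ennreal (2 * (2 * (d + 2)) * (1 / d)) * maximal (jet_sum m F) x"
    proof -
      have "2 * ennreal (2 * (d + 2)) * ennreal (1 / d) = ennreal (2 * (2 * (d + 2)) * (1 / d))"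
      proof -
        have "ennreal (2 * (2 * (d + 2)) * (1 / d)) = ennreal (2 * (2 * (d + 2))) * ennreal (1 / d)"
          by (rule ennreal_mult) (use d in auto)
        also have "ennreal (2 * (2 * (d + 2))) = ennreal 2 * ennreal (2 * (d + 2))"
          by (rule ennreal_mult) (use d in auto)
        finally show ?thesis by (simp only: ennreal_numeral)
      qed
      from arg_cong[OF this, of "\<lambda>z. z * maximal (jet_sum m F) x"] show ?thesis by (simp only: mult_ac)
    qed
    also have "\<dots> \<le> ennreal 12 * maximal (jet_sum m F) x"
      using d by (intro mult_right_mono ennreal_leI) (auto simp: field_simps)
    finally show ?thesis by simp
  qed
qed

text \<open>The recursion over the two extreme points turns \<open>diameter S\<close> times the
  divided difference into an increment of the derivative of order m - 1, hence into an integral of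
  the derivative of order m. Averaging this over the hull of \<open>S\<close> and x produces exactly
  the weight in the definition of \<open>sharp\<close>.\<close>

lemma sobolev_top_dd_le_maximal:
  assumes F: "F \<in> sobolev m p" and m: "1 \<le> m" and S: "finite S" "card S = Suc m"
  shows "ennreal (diameter S / diameter (S \<union> {x}) * \<bar>dd F S\<bar>)
    \<le> 2 * maximal (jet_sum m F) x"
proof -
  have ne: "S \<noteq> {}" using S by auto
  define u where "u = Min S"
  define v where "v = Max S"
  have uv: "u \<in> S" "v \<in> S" "\<And>s. s \<in> S \<Longrightarrow> u \<le> s \<and> s \<le> v"
    using S ne by (auto simp: u_def v_def)
  have "u \<noteq> v"
  proof
    assume "u = v"
    then have "S = {u}" using uv by force
    then show False using S m by simp
  qed
  then have "u < v" using uv(3)[OF uv(1)] by simp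
  define a where "a = min u x"
  define b where "b = max v x"
  have ab: "a < b" "a \<le> x" "x \<le> b" "a \<le> u" "v \<le> b" using \<open>u < v\<close> by (auto simp: a_def b_def)
  have diam: "diameter S = v - u" "diameter (S \<union> {x}) = b - a"
    using diameter_real[of S] diameter_real[of "insert x S"] S(1) ne by (auto simp: u_def v_def a_def b_def min.commute max.commute)
  \<comment> \<open>Without one point, m points remain, and the mean value formula of order m - 1
    only involves derivatives that exist everywhere.\<close>
  have point: "\<exists>\<xi>. u \<le> \<xi> \<and> \<xi> \<le> v \<and> fact (m - 1) * dd F (S - {y}) = (deriv ^^ (m - 1)) F \<xi>" if "y \<in> S" for y
  proof -
    let ?T = "S - {y}"
    have T: "finite ?T" "card ?T = Suc (m - 1)" using S that m by auto
    then have Tne: "?T \<noteq> {}" by (metis card.empty nat.distinct(1))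
    have "\<exists>\<xi>. Min ?T \<le> \<xi> \<and> \<xi> \<le> Max ?T \<and> fact (m - 1) * dd F ?T = (deriv ^^ (m - 1)) F \<xi>"
      using dd_mean_value[of "m - 1" "\<lambda>k. (deriv ^^ k) F" ?T] sobolev_DERIV[OF F] T by auto
    moreover have "u \<le> Min ?T" "Max ?T \<le> v"
      using uv(3) Min_in[OF T(1) Tne] Max_in[OF T(1) Tne] by auto
    ultimately show ?thesis by (meson order_trans)
  qed
  obtain \<xi> where \<xi>: "u \<le> \<xi>" "\<xi> \<le> v" "fact (m - 1) * dd F (S - {u}) = (deriv ^^ (m - 1)) F \<xi>"
    using point[OF uv(1)] by blast
  obtain \<eta> where \<eta>: "u \<le> \<eta>" "\<eta> \<le> v" "fact (m - 1) * dd F (S - {v}) = (deriv ^^ (m - 1)) F \<eta>"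
    using point[OF uv(2)] by blast
  have "(v - u) * \<bar>dd F S\<bar> = \<bar>dd F (S - {u}) - dd F (S - {v})\<bar>"
    using dd_recursion[OF S(1) uv(1,2) \<open>u \<noteq> v\<close>, of F] \<open>u < v\<close> by (metis abs_mult abs_of_pos diff_gt_0_iff_gt mult.commute)
  also have "\<dots> \<le> fact (m - 1) * \<bar>dd F (S - {u}) - dd F (S - {v})\<bar>"
    by (simp add: mult_le_cancel_right1)
  also have "\<dots> = \<bar>fact (m - 1) * dd F (S - {u}) - fact (m - 1) * dd F (S - {v})\<bar>"
    by (simp add: abs_mult flip: right_diff_distrib)
  also have "\<dots> = \<bar>(deriv ^^ (m - 1)) F (max \<xi> \<eta>) - (deriv ^^ (m - 1)) F (min \<xi> \<eta>)\<bar>"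
    unfolding \<xi>(3) \<eta>(3) by (simp add: max_def min_def abs_minus_commute)
  finally have "ennreal ((v - u) * \<bar>dd F S\<bar>) \<le> ennreal \<bar>(deriv ^^ (m - 1)) F (max \<xi> \<eta>) - (deriv ^^ (m - 1)) F (min \<xi> \<eta>)\<bar>"
    by (rule ennreal_leI)
  also have "\<dots> \<le> (\<integral>\<^sup>+ t. ennreal \<bar>(deriv ^^ Suc (m - 1)) F t\<bar> * indicator {min \<xi> \<eta>..max \<xi> \<eta>} t \<partial>lborel)"
    by (rule sobolev_increment_le[OF F]) (use m in auto)
  also have "\<dots> \<le> (\<integral>\<^sup>+ t. jet_sum m F t * indicator {a..b} t \<partial>lborel)"
  proof (rule nn_integral_mono)
    fix t
    have "ennreal \<bar>(deriv ^^ Suc (m - 1)) F t\<bar> \<le> jet_sum m F t"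
      using m member_le_sum[of m "{..m}" "\<lambda>j. ennreal \<bar>(deriv ^^ j) F t\<bar>"] by (simp add: jet_sum_def)
    then show "ennreal \<bar>(deriv ^^ Suc (m - 1)) F t\<bar> * indicator {min \<xi> \<eta>..max \<xi> \<eta>} t \<le> jet_sum m F t * indicator {a..b} t"
      using \<xi> \<eta> ab by (auto simp: indicator_def)
  qed
  also have "\<dots> \<le> ennreal (2 * (b - a)) * maximal (jet_sum m F) x"
    by (rule integral_le_maximal[OF ab(1-3)])
  finally have *: "ennreal ((v - u) * \<bar>dd F S\<bar>) \<le> ennreal (2 * (b - a)) * maximal (jet_sum m F) x" .
  have "ennreal (diameter S / diameter (S \<union> {x}) * \<bar>dd F S\<bar>) = ennreal ((v - u) * \<bar>dd F S\<bar>) * ennreal (1 / (b - a))"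
    unfolding diam using ab \<open>u < v\<close> by (simp flip: ennreal_mult)
  also have "\<dots> \<le> ennreal (2 * (b - a)) * maximal (jet_sum m F) x * ennreal (1 / (b - a))"
    by (intro mult_right_mono *) auto
  also have "\<dots> = ennreal (2 * (b - a) * (1 / (b - a))) * maximal (jet_sum m F) x"
    using ab by (subst ennreal_mult) (auto simp: mult_ac)
  also have "2 * (b - a) * (1 / (b - a)) = 2" using ab(1) by (simp add: field_simps)
  finally show ?thesis by simp
qed

lemma sharp_le_maximal:
  assumes F: "F \<in> sobolev m p" and m: "1 \<le> m" and f: "\<And>x. x \<in> E \<Longrightarrow> F x = f x" and k: "k \<le> m"
  shows "sharp m k E f x \<le> 12 * maximal (jet_sum m F) x"
  unfolding sharp_def
proof (rule SUP_least)
  fix S assume "S \<in> {S. S \<subseteq> E \<and> finite S \<and> card S = k + 1 \<and> infdist x S \<le> 1}"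
  then have S: "S \<subseteq> E" "finite S" "card S = Suc k" "infdist x S \<le> 1" by auto
  have "S \<noteq> {}" using S by auto
  then have dd: "divided_difference k f S = dd F S"
    using dd_cong[OF S(2), of F f] f S by (fastforce simp: dd_def)
  let ?M = "maximal (jet_sum m F) x"
  show "ennreal (if k = m then diameter S / diameter (S \<union> {x}) * \<bar>divided_difference k f S\<bar> else \<bar>divided_difference k f S\<bar>) \<le> 12 * ?M"
  proof (cases "k = m")
    case True
    have "ennreal (diameter S / diameter (S \<union> {x}) * \<bar>dd F S\<bar>) \<le> 2 * ?M"
      by (rule sobolev_top_dd_le_maximal[OF F m S(2)]) (use S True in auto)
    also have "\<dots> \<le> 12 * ?M" by (rule mult_right_mono) auto
    finally show ?thesis using dd True by simp
  next
    case False
    then show ?thesis using sobolev_dd_le_maximal[OF F S(2,3) _ S(4)] k by (simp add: dd)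
  qed
qed

section \<open>Measurability and norms of the sharp functions\<close>

text \<open>Each such x picks a rational number in the interval of \<open>U\<close> to its left. If
  x < x' picked the same one, x would lie between it and x', hence in \<open>U\<close>.\<close>

lemma countable_right_end_points:
  fixes U :: "real set"
  shows "countable {x. x \<notin> U \<and> (\<exists>y<x. {y<..<x} \<subseteq> U)}" (is "countable ?R")
proof -
  have "\<exists>q. \<exists>y<x. {y<..<x} \<subseteq> U \<and> y < real_of_rat q \<and> real_of_rat q < x" if "x \<in> ?R" for x
  proof -
    obtain y where y: "y < x" "{y<..<x} \<subseteq> U" using \<open>x \<in> ?R\<close> by blast
    then show ?thesis using of_rat_dense[OF y(1)] by blast
  qed
  then have "\<forall>x. \<exists>q. x \<in> ?R \<longrightarrow> (\<exists>y<x. {y<..<x} \<subseteq> U \<and> y < real_of_rat q \<and> real_of_rat q < x)" by blast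
  from choice[OF this] obtain q
    where "\<forall>x. x \<in> ?R \<longrightarrow> (\<exists>y<x. {y<..<x} \<subseteq> U \<and> y < real_of_rat (q x) \<and> real_of_rat (q x) < x)"
    by (rule exE)
  then have q: "\<exists>y<x. {y<..<x} \<subseteq> U \<and> y < real_of_rat (q x) \<and> real_of_rat (q x) < x" if "x \<in> ?R" for x
    using that by blast
  have *: "q x \<noteq> q x'" if x: "x \<in> ?R" and x': "x' \<in> ?R" and "x < x'" for x x'
  proof
    assume eq: "q x = q x'"
    obtain y' where "y' < x'" "{y'<..<x'} \<subseteq> U" "y' < real_of_rat (q x')" using q[OF x'] by blast
    moreover have "real_of_rat (q x) < x" using q[OF x] by blast
    ultimately have "x \<in> U" using eq \<open>x < x'\<close> by auto
    then show False using x by simp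
  qed
  have "inj_on q ?R"
  proof (rule inj_onI)
    fix x x' assume "x \<in> ?R" "x' \<in> ?R" "q x = q x'"
    then show "x = x'" using *[of x x'] *[of x' x] by (cases x x' rule: linorder_cases) auto
  qed
  then show ?thesis by (rule countable_image_inj_on[rotated]) auto
qed

lemma countable_left_end_points:
  fixes U :: "real set"
  shows "countable {x. x \<notin> U \<and> (\<exists>y>x. {x<..<y} \<subseteq> U)}" (is "countable ?L")
proof -
  let ?R = "{x. x \<notin> uminus ` U \<and> (\<exists>y<x. {y<..<x} \<subseteq> uminus ` U)}"
  have "?L \<subseteq> uminus ` ?R"
  proof
    fix x assume "x \<in> ?L"
    then obtain y where y: "x \<notin> U" "x < y" "{x<..<y} \<subseteq> U" by auto
    have "z \<in> uminus ` U" if "z \<in> {- y<..<- x}" for z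
      using y(3) that by (intro image_eqI[of _ _ "- z"]) auto
    then have "{- y<..<- x} \<subseteq> uminus ` U" by blast
    moreover have "- x \<notin> uminus ` U" using y(1) by auto
    ultimately have "- x \<in> ?R" using y(2) by (auto intro!: exI[of _ "- y"])
    then show "x \<in> uminus ` ?R" by (intro image_eqI[of _ _ "- x"]) auto
  qed
  then show ?thesis
    using countable_right_end_points[of "uminus ` U"] by (meson countable_image countable_subset)
qed

text \<open>Such a union differs from the union of the interiors by a countable set.\<close>

lemma Union_intervals_borel:
  fixes \<I> :: "real set set"
  assumes int: "\<And>I. I \<in> \<I> \<Longrightarrow> is_interval I"
    and nd: "\<And>I x. I \<in> \<I> \<Longrightarrow> x \<in> I \<Longrightarrow> \<exists>y\<in>I. y \<noteq> x"
  shows "\<Union>\<I> \<in> sets borel"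
proof -
  define U where "U = (\<Union>I\<in>\<I>. interior I)"
  have sub: "{y<..<x} \<subseteq> U" if "I \<in> \<I>" "x \<in> I" "y \<in> I" for I x y
  proof -
    have "z \<in> I" if "z \<in> {y<..<x}" for z
      by (rule mem_is_interval_1_I[OF int[OF \<open>I \<in> \<I>\<close>] \<open>y \<in> I\<close> \<open>x \<in> I\<close>]) (use that in auto)
    then have "{y<..<x} \<subseteq> interior I" by (intro interior_maximal) auto
    then show ?thesis using that(1) by (auto simp: U_def)
  qed
  have "\<Union>\<I> - U \<subseteq> {x. x \<notin> U \<and> (\<exists>y<x. {y<..<x} \<subseteq> U)} \<union> {x. x \<notin> U \<and> (\<exists>y>x. {x<..<y} \<subseteq> U)}"
  proof
    fix x assume "x \<in> \<Union>\<I> - U"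
    then obtain I where I: "I \<in> \<I>" "x \<in> I" "x \<notin> U" by blast
    then obtain y where y: "y \<in> I" "y \<noteq> x" using nd by blast
    show "x \<in> {x. x \<notin> U \<and> (\<exists>y<x. {y<..<x} \<subseteq> U)} \<union> {x. x \<notin> U \<and> (\<exists>y>x. {x<..<y} \<subseteq> U)}"
    proof (cases "y < x")
      case True
      with sub[OF I(1,2) y(1)] I(3) show ?thesis by blast
    next
      case False
      with y(2) have "x < y" by simp
      with sub[OF I(1) y(1) I(2)] I(3) show ?thesis by blast
    qed
  qed
  then have cnt: "countable (\<Union>\<I> - U)"
    by (rule countable_subset) (intro countable_Un countable_right_end_points countable_left_end_points)
  have "\<Union>\<I> - U \<in> sets borel" by (rule sets.countable[OF _ cnt]) simp
  moreover have "U \<in> sets borel" by (intro borel_open) (simp add: U_def open_UN)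
  moreover have "U \<subseteq> \<Union>\<I>"
  proof
    fix x assume "x \<in> U"
    then obtain I where "I \<in> \<I>" "x \<in> interior I" by (auto simp: U_def)
    then show "x \<in> \<Union>\<I>" using subsetD[OF interior_subset, of x I] by blast
  qed
  then have "\<Union>\<I> = (\<Union>\<I> - U) \<union> U" by blast
  ultimately show ?thesis using sets.Un[of "\<Union>\<I> - U" borel U] by simp
qed

lemma diameter_insert_real:
  fixes S :: "real set"
  assumes "finite S" "S \<noteq> {}"
  shows "diameter (S \<union> {x}) = max (Max S) x - min (Min S) x"
  using diameter_real[of "insert x S"] assms by (simp add: max.commute min.commute)

text \<open>The superlevel set is the union of the sets \<open>J S s\<close>, over which one weight
  exceeds c near one point of S. Each is an interval because the weight falls as x moves away from
  the hull of S, and it has more than one point because the weight is continuous and largest on the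
  hull, which contains s.\<close>

lemma borel_measurable_sharp:
  assumes m: "1 \<le> m"
  shows "sharp m k E f \<in> borel_measurable borel"
proof (rule borel_measurableI_greater)
  fix c
  define w where "w S x = (if k = m then diameter S / diameter (S \<union> {x}) * \<bar>divided_difference k f S\<bar>
    else \<bar>divided_difference k f S\<bar>)" for S x
  define J where "J S s = {x \<in> {s - 1..s + 1}. c < ennreal (w S x)}" for S s
  define \<F> where "\<F> = {S. S \<subseteq> E \<and> finite S \<and> card S = k + 1}"
  define \<I> where "\<I> = {J S s | S s. S \<in> \<F> \<and> s \<in> S}"
  have "{x \<in> space borel. c < sharp m k E f x} = \<Union>\<I>"
  proof (intro set_eqI iffI)
    fix x assume "x \<in> {x \<in> space borel. c < sharp m k E f x}"
    then obtain S where S: "S \<in> \<F>" "infdist x S \<le> 1" "c < ennreal (w S x)"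
      by (auto simp: sharp_def less_SUP_iff \<F>_def w_def)
    then have "finite S" "S \<noteq> {}" by (auto simp: \<F>_def)
    then obtain s where "s \<in> S" "\<bar>x - s\<bar> \<le> 1" using infdist_finite_le[of S x 1] S(2) by metis
    then have "x \<in> J S s" using S(3) by (auto simp: J_def abs_le_iff)
    then show "x \<in> \<Union>\<I>" using S(1) \<open>s \<in> S\<close> by (auto simp: \<I>_def)
  next
    fix x assume "x \<in> \<Union>\<I>"
    then obtain S s where S: "S \<in> \<F>" "s \<in> S" "\<bar>x - s\<bar> \<le> 1" "c < ennreal (w S x)"
      by (auto simp: \<I>_def J_def abs_le_iff)
    have "infdist x S \<le> 1"
      using infdist_le[OF S(2), of x] S(3) by (simp add: dist_real_def)
    then have "ennreal (w S x) \<le> sharp m k E f x"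
      unfolding sharp_def w_def using S(1) by (intro SUP_upper) (auto simp: \<F>_def)
    then show "x \<in> {x \<in> space borel. c < sharp m k E f x}" using S(4) by simp
  qed
  also have "\<Union>\<I> \<in> sets borel"
  proof (rule Union_intervals_borel)
    fix I assume "I \<in> \<I>"
    then obtain S s where I: "I = J S s" and S: "S \<in> \<F>" "s \<in> S" by (auto simp: \<I>_def)
    define u where "u = Min S"
    define v where "v = Max S"
    have fin: "finite S" "S \<noteq> {}" using S by (auto simp: \<F>_def)
    have s: "u \<le> s" "s \<le> v" using S(2) fin by (auto simp: u_def v_def)
    define A where "A = \<bar>divided_difference k f S\<bar>"
    have A: "0 \<le> A" by (simp add: A_def)
    have diam: "diameter (S \<union> {x}) = max v x - min u x" "diameter S = v - u" for x
      using diameter_insert_real[OF fin] diameter_real[OF fin] by (auto simp: u_def v_def)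
    have uv: "u < v" if "k = m"
    proof (rule ccontr)
      assume "\<not> u < v"
      then have "t = u" if "t \<in> S" for t
        using Min_le[OF fin(1) that] Max_ge[OF fin(1) that] by (simp add: u_def v_def)
      then have "S \<subseteq> {u}" by blast
      then have "card S \<le> 1" using card_mono[of "{u}" S] by simp
      then show False using S(1) that m by (simp add: \<F>_def)
    qed
    have wm: "w S x = (v - u) / (max v x - min u x) * A" if "k = m" for x
      using that by (simp add: w_def diam[symmetric] A_def)
    have w0: "w S x = A" if "k \<noteq> m" for x using that by (simp add: w_def A_def)
    have anti: "w S y \<le> w S x" if "max v x - min u x \<le> max v y - min u y" for x y
    proof (cases "k = m")
      case True
      have "(v - u) / (max v y - min u y) \<le> (v - u) / (max v x - min u x)"
        using that uv[OF True] by (intro divide_left_mono mult_pos_pos) (auto simp: max_def min_def)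
      then show ?thesis unfolding wm[OF True] by (rule mult_right_mono[OF _ A])
    qed (simp add: w0)
    show "is_interval I"
      unfolding is_interval_1
    proof (intro ballI allI impI)
      fix x z y assume x: "x \<in> I" and z: "z \<in> I" and y: "x \<le> y \<and> y \<le> z"
      \<comment> \<open>The length of the hull is a convex function of the added point, so at y it
        is at most one of the values at x and z.\<close>
      have "max v y - min u y \<le> max v x - min u x \<or> max v y - min u y \<le> max v z - min u z"
        using y s by (auto simp: max_def min_def)
      then have "w S x \<le> w S y \<or> w S z \<le> w S y" using anti by blast
      then have "c < ennreal (w S y)"
        using x z by (auto simp: I J_def intro: order.strict_trans2 ennreal_leI)
      then show "y \<in> I" using x y z by (auto simp: I J_def)
    qed
    fix x assume x: "x \<in> I"
    show "\<exists>y\<in>I. y \<noteq> x"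
    proof (cases "x = s")
      case False
      have "w S x \<le> w S s" by (rule anti) (use s in \<open>auto simp: max_def min_def\<close>)
      then have "s \<in> I" using x by (auto simp: I J_def intro: order.strict_trans2 ennreal_leI)
      then show ?thesis using False by (intro bexI[of _ s]) auto
    next
      case True
      have c: "c < ennreal (w S s)" using x True by (simp add: I J_def)
      \<comment> \<open>At x = s a second point of \<open>I\<close> is found slightly to the right,
        where continuity keeps the weight above c.\<close>
      have "((\<lambda>y. w S y) \<longlongrightarrow> w S s) (at_right s)"
      proof (cases "k = m")
        case True
        have "max v s - min u s \<noteq> 0" using uv[OF True] by (auto simp: max_def min_def)
        then show ?thesis unfolding wm[OF True] by (intro tendsto_intros) auto
      qed (simp add: w0)
      then have "((\<lambda>y. ennreal (w S y)) \<longlongrightarrow> ennreal (w S s)) (at_right s)" by (rule tendsto_ennrealI)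
      then have "eventually (\<lambda>y. c < ennreal (w S y)) (at_right s)" by (rule order_tendstoD(1)[OF _ c])
      moreover have "eventually (\<lambda>y. y \<in> {s<..<s + 1}) (at_right s)"
        by (rule eventually_at_right_real) simp
      ultimately have "eventually (\<lambda>y. c < ennreal (w S y) \<and> y \<in> {s<..<s + 1}) (at_right s)"
        by (rule eventually_conj)
      then obtain y where "c < ennreal (w S y)" "y \<in> {s<..<s + 1}"
        using eventually_happens trivial_limit_at_right_real by blast
      then have "y \<in> I" "y \<noteq> x" using True by (auto simp: I J_def)
      then show ?thesis by blast
    qed
  qed
  finally show "{x \<in> space borel. c < sharp m k E f x} \<in> sets borel" .
qed

lemma sharp_norm_le:
  assumes m: "1 \<le> m" and p: "1 < p"
  shows "\<exists>C\<ge>1. \<forall>E f. \<forall>F \<in> extensions m p E f. \<forall>k\<le>m.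
    Lp_norm p (sharp m k E f) \<le> ennreal C * sobolev_norm m p F"
proof -
  define A where "A = (10 * p / (p - 1) * 2 powr (p - 1)) powr (1 / p)"
  define B where "B = real (m + 1) * real (m + 1) powr (1 / p)"
  define C where "C = max 1 (12 * (A * B))"
  have "Lp_norm p (sharp m k E f) \<le> ennreal C * sobolev_norm m p F"
    if F: "F \<in> extensions m p E f" and k: "k \<le> m" for E f F k
  proof -
    have Fs: "F \<in> sobolev m p" and Ff: "\<And>x. x \<in> E \<Longrightarrow> F x = f x"
      using F by (auto simp: extensions_def)
    have [measurable]: "(deriv ^^ j) F \<in> borel_measurable lebesgue" if "j \<in> {..m}" for j
      using sobolev_borel_measurable[OF Fs] that by simp
    have G[measurable]: "jet_sum m F \<in> borel_measurable lebesgue"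
      unfolding jet_sum_def by (intro borel_measurable_sum) measurable
    have M: "maximal (jet_sum m F) \<in> borel_measurable lebesgue"
      by (intro measurable_completion) simp
    have "Lp_norm p (sharp m k E f) \<le> Lp_norm p (\<lambda>x. 12 * maximal (jet_sum m F) x)"
      by (rule Lp_norm_mono) (use p sharp_le_maximal[OF Fs m Ff k] in auto)
    also have "\<dots> = 12 * Lp_norm p (maximal (jet_sum m F))"
      by (rule Lp_norm_cmult[OF M]) (use p in simp)
    also have "\<dots> \<le> 12 * (ennreal A * Lp_norm p (jet_sum m F))"
      unfolding A_def by (intro mult_left_mono Lp_norm_maximal G p) auto
    also have "Lp_norm p (jet_sum m F) \<le> of_nat (card {..m}) * ennreal_powr (of_nat (card {..m})) (1 / p) * sobolev_norm m p F"
      unfolding sobolev_norm_def jet_sum_def by (rule Lp_norm_sum_le) (use p in auto)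
    also have "of_nat (card {..m}) * ennreal_powr (of_nat (card {..m})) (1 / p) = ennreal B"
    proof -
      have "(of_nat (card {..m}) :: ennreal) = ennreal (real (m + 1))" by (simp flip: ennreal_of_nat_eq_real_of_nat)
      then show ?thesis unfolding B_def by (simp only: ennreal_powr_ennreal of_nat_0_le_iff ennreal_mult powr_ge_zero)
    qed
    also have "12 * (ennreal A * (ennreal B * sobolev_norm m p F)) = ennreal (12 * (A * B)) * sobolev_norm m p F"
      by (simp add: A_def B_def ennreal_mult mult_ac)
    also have "\<dots> \<le> ennreal C * sobolev_norm m p F"
      by (intro mult_right_mono ennreal_leI) (auto simp: C_def)
    finally show ?thesis by (simp add: mult_left_mono)
  qed
  then show ?thesis by (intro exI[of _ C]) (auto simp: C_def)
qed

section \<open>Smooth transitions between polynomials\<close>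

text \<open>On the left the equality includes a itself and so fixes \<open>f a\<close>; on the right
  it is asked only near a, because a patch changes its formula again further on.\<close>

lemma has_real_derivative_glue:
  fixes f u v :: "real \<Rightarrow> real"
  assumes u: "(u has_real_derivative d) (at a)" and v: "(v has_real_derivative d) (at a)"
    and f: "\<And>t. t \<le> a \<Longrightarrow> f t = u t" "eventually (\<lambda>t. f t = v t) (at_right a)" and eq: "u a = v a"
  shows "(f has_real_derivative d) (at a)"
proof -
  have "((\<lambda>t. (f t - f a) / (t - a)) \<longlongrightarrow> d) (at_left a)"
  proof (rule Lim_transform_eventually)
    show "((\<lambda>t. (u t - u a) / (t - a)) \<longlongrightarrow> d) (at_left a)"
      using u unfolding has_field_derivative_iff filterlim_at_split by blast
    show "eventually (\<lambda>t. (u t - u a) / (t - a) = (f t - f a) / (t - a)) (at_left a)"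
      using f(1) by (intro eventually_at_leftI[of "a - 1"]) auto
  qed
  moreover have "((\<lambda>t. (f t - f a) / (t - a)) \<longlongrightarrow> d) (at_right a)"
  proof (rule Lim_transform_eventually)
    show "((\<lambda>t. (v t - v a) / (t - a)) \<longlongrightarrow> d) (at_right a)"
      using v unfolding has_field_derivative_iff filterlim_at_split by blast
    show "eventually (\<lambda>t. (v t - v a) / (t - a) = (f t - f a) / (t - a)) (at_right a)"
      using f(2) by eventually_elim (simp add: f(1) eq)
  qed
  ultimately show ?thesis
    unfolding has_field_derivative_iff filterlim_at_split by blast
qed

lemma power_dvd_pderiv:
  fixes q :: "real poly"
  assumes "[:- c, 1:] ^ Suc n dvd q"
  shows "[:- c, 1:] ^ n dvd pderiv q"
proof -
  obtain r where q: "q = [:- c, 1:] ^ Suc n * r" using assms by (rule dvdE)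
  have "pderiv q = [:- c, 1:] ^ n * ([:- c, 1:] * pderiv r + smult (of_nat (Suc n)) (pderiv [:- c, 1:]) * r)"
    unfolding q pderiv_mult pderiv_power_Suc by (simp add: algebra_simps)
  then show ?thesis by (rule dvdI)
qed

lemma power_dvd_higher_pderiv:
  fixes q :: "real poly"
  assumes "[:- c, 1:] ^ m dvd q" "k < m"
  shows "poly ((pderiv ^^ k) q) c = 0"
proof -
  have "[:- c, 1:] ^ (m - k) dvd (pderiv ^^ k) q" if "k \<le> m"
    using that
  proof (induction k)
    case (Suc k)
    then have "[:- c, 1:] ^ Suc (m - Suc k) dvd (pderiv ^^ k) q"
      by (simp only: Suc_diff_Suc[OF Suc_le_lessD] Suc_leD)
    then show ?case using power_dvd_pderiv by simp
  qed (use assms in simp)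
  then have "[:- c, 1:] ^ (m - k) dvd (pderiv ^^ k) q" using assms(2) by simp
  moreover have "[:- c, 1:] dvd [:- c, 1:] ^ (m - k)" using assms(2) by (simp add: dvd_power)
  ultimately have "[:- c, 1:] dvd (pderiv ^^ k) q" by (rule dvd_trans[rotated])
  then show ?thesis by (simp add: poly_eq_0_iff_dvd)
qed

lemma higher_pderiv_diff: "(pderiv ^^ k) (p - q) = (pderiv ^^ k) p - (pderiv ^^ k) (q :: real poly)"
  by (induction k) (auto simp: pderiv_diff)

text \<open>The Leibniz rule for a linear factor. At k = 0 the truncated \<open>k - 1\<close> is
  harmless, as its coefficient vanishes.\<close>

lemma higher_pderiv_linear_mult:
  fixes p :: "real poly"
  shows "(pderiv ^^ k) ([:- x, 1:] * p) = [:- x, 1:] * (pderiv ^^ k) p + smult (of_nat k) ((pderiv ^^ (k - 1)) p)"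
proof (induction k)
  case (Suc k)
  have l: "pderiv [:- x, 1:] = (1 :: real poly)" by (simp add: pderiv_pCons)
  have s: "smult (of_nat k) (pderiv ((pderiv ^^ (k - 1)) p)) = smult (of_nat k) ((pderiv ^^ k) p)"
    by (cases k) auto
  have "(pderiv ^^ Suc k) ([:- x, 1:] * p) = pderiv ([:- x, 1:] * (pderiv ^^ k) p) + smult (of_nat k) (pderiv ((pderiv ^^ (k - 1)) p))"
    using Suc by (simp only: funpow.simps o_apply pderiv_add pderiv_smult)
  also have "\<dots> = [:- x, 1:] * (pderiv ^^ Suc k) p + (pderiv ^^ k) p + smult (of_nat k) ((pderiv ^^ k) p)"
    unfolding s pderiv_mult l by (simp only: funpow.simps o_apply mult_1_right)
  also have "\<dots> = [:- x, 1:] * (pderiv ^^ Suc k) p + smult (of_nat (Suc k)) ((pderiv ^^ k) p)"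
    by (simp only: of_nat_Suc smult_add_left smult_1_left add.assoc add.commute)
  finally show ?case by simp
qed simp

text \<open>The weights \<open>h ^ k\<close> make the bound homogeneous under scaling, so that each linear factor costs one power of \<open>h\<close>.\<close>

lemma higher_pderiv_nodal_mult_le:
  fixes p :: "real poly"
  assumes A: "finite A" and h: "0 \<le> h" and r: "0 \<le> r" and B: "0 \<le> B"
    and x: "\<And>x. x \<in> A \<Longrightarrow> \<bar>t - x\<bar> \<le> r * h"
    and p: "\<And>k. k \<le> m \<Longrightarrow> h ^ k * \<bar>poly ((pderiv ^^ k) p) t\<bar> \<le> B"
    and k: "k \<le> m"
  shows "h ^ k * \<bar>poly ((pderiv ^^ k) (nodal A * p)) t\<bar> \<le> ((r + real m) * h) ^ card A * B"
  using A x k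
proof (induction A arbitrary: k)
  case empty
  then show ?case using p by simp
next
  case (insert x A)
  define q where "q = nodal A * p"
  define K where "K = ((r + real m) * h) ^ card A * B"
  have K0: "0 \<le> K" using h r B by (simp add: K_def)
  have q: "h ^ k * \<bar>poly ((pderiv ^^ k) q) t\<bar> \<le> K" if "k \<le> m" for k
    unfolding q_def K_def by (rule insert.IH) (use insert.prems that in auto)
  have first: "h ^ k * \<bar>(t - x) * poly ((pderiv ^^ k) q) t\<bar> \<le> r * h * K"
  proof -
    have "h ^ k * \<bar>(t - x) * poly ((pderiv ^^ k) q) t\<bar> = \<bar>t - x\<bar> * (h ^ k * \<bar>poly ((pderiv ^^ k) q) t\<bar>)"
      by (simp add: abs_mult)
    also have "\<dots> \<le> (r * h) * K"
      using insert.prems q[of k] r h by (intro mult_mono) auto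
    finally show ?thesis .
  qed
  have second: "h ^ k * \<bar>real k * poly ((pderiv ^^ (k - 1)) q) t\<bar> \<le> real m * h * K"
  proof (cases k)
    case 0
    then show ?thesis using K0 h by simp
  next
    case (Suc k')
    have "h ^ k * \<bar>real k * poly ((pderiv ^^ (k - 1)) q) t\<bar> = real k * h * (h ^ k' * \<bar>poly ((pderiv ^^ k') q) t\<bar>)"
      by (simp add: Suc abs_mult)
    also have "\<dots> \<le> real m * h * K"
      using insert.prems(2) q[of k'] h Suc by (intro mult_mono) auto
    finally show ?thesis .
  qed
  have "nodal (insert x A) * p = [:- x, 1:] * q"
    unfolding q_def nodal_insert[OF insert.hyps] by (simp only: mult.assoc)
  then have "poly ((pderiv ^^ k) (nodal (insert x A) * p)) t
      = (t - x) * poly ((pderiv ^^ k) q) t + real k * poly ((pderiv ^^ (k - 1)) q) t"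
    by (simp only: higher_pderiv_linear_mult poly_add poly_mult poly_smult) simp
  then have "h ^ k * \<bar>poly ((pderiv ^^ k) (nodal (insert x A) * p)) t\<bar>
      \<le> h ^ k * (\<bar>(t - x) * poly ((pderiv ^^ k) q) t\<bar> + \<bar>real k * poly ((pderiv ^^ (k - 1)) q) t\<bar>)"
    using h by (intro mult_left_mono) auto
  also have "\<dots> \<le> r * h * K + real m * h * K"
    using first second by (simp add: distrib_left)
  also have "\<dots> = ((r + real m) * h) ^ card (insert x A) * B"
    using insert.hyps by (simp add: K_def algebra_simps)
  finally show ?case .
qed

text \<open>A polynomial that agrees with \<open>0\<close> at \<open>0\<close> and with \<open>1\<close> at \<open>1\<close> up to order \<open>m\<close>.\<close>

definition transition :: "nat \<Rightarrow> real poly" where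
  "transition m = 1 - (1 - [:0, 1:] ^ m) ^ m"

definition transition_on :: "nat \<Rightarrow> real \<Rightarrow> real \<Rightarrow> real poly" where
  "transition_on m a b = pcompose (transition m) [:- a / (b - a), 1 / (b - a):]"

text \<open>1 - v divides 1 - v^m for v = 1 - u^m, which gives the zero at 0; u - 1 divides 1 - u^m,
  which gives the other. Divisibility encodes the vanishing of all derivatives of order below
  m.\<close>

lemma transition_dvd: "[:0, 1:] ^ m dvd transition m" "[:- 1, 1:] ^ m dvd 1 - transition m"
proof -
  have "(1 - (1 - [:0, 1:] ^ m)) dvd 1 ^ m - (1 - [:0, 1:] ^ m :: real poly) ^ m"
    by (subst power_diff_sumr2) (rule dvd_triv_left)
  then show "[:0, 1:] ^ m dvd transition m" by (simp add: transition_def)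
  have "[:- 1, 1:] dvd (1 - [:0, 1:] ^ m :: real poly)"
    by (simp add: poly_eq_0_iff_dvd[symmetric] poly_power)
  then have "[:- 1, 1:] ^ m dvd (1 - [:0, 1:] ^ m :: real poly) ^ m" by (rule dvd_power_same)
  then show "[:- 1, 1:] ^ m dvd 1 - transition m" by (simp add: transition_def)
qed

lemma pcompose_power: "pcompose (p ^ n) r = pcompose (p :: real poly) r ^ n"
  by (induction n) (simp_all add: pcompose_mult pcompose_1)

lemma pcompose_dvd: "p dvd q \<Longrightarrow> pcompose p r dvd pcompose (q :: real poly) r"
  by (auto simp: dvd_def pcompose_mult)

lemma transition_on_dvd:
  assumes "a < b"
  shows "[:- a, 1:] ^ m dvd transition_on m a b" "[:- b, 1:] ^ m dvd 1 - transition_on m a b"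
proof -
  define l where "l = [:- a / (b - a), 1 / (b - a):]"
  have "pcompose ([:0, 1:] ^ m) l = smult ((1 / (b - a)) ^ m) ([:- a, 1:] ^ m)"
    using assms by (simp add: pcompose_power pcompose_pCons l_def flip: smult_power)
  moreover have "pcompose ([:0, 1:] ^ m) l dvd transition_on m a b"
    unfolding transition_on_def l_def by (intro pcompose_dvd transition_dvd)
  ultimately show "[:- a, 1:] ^ m dvd transition_on m a b"
    using assms by (simp add: smult_dvd_iff split: if_splits)
  have "pcompose [:- 1, 1:] l = smult (1 / (b - a)) [:- b, 1:]"
    using assms by (simp add: pcompose_pCons l_def field_simps)
  then have "pcompose ([:- 1, 1:] ^ m) l = smult ((1 / (b - a)) ^ m) ([:- b, 1:] ^ m)"
    by (simp only: pcompose_power smult_power)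
  moreover have "pcompose ([:- 1, 1:] ^ m) l dvd pcompose (1 - transition m) l"
    by (intro pcompose_dvd transition_dvd)
  moreover have "pcompose (1 - transition m) l = 1 - transition_on m a b"
    by (simp add: pcompose_diff pcompose_1 transition_on_def l_def)
  ultimately show "[:- b, 1:] ^ m dvd 1 - transition_on m a b"
    using assms by (simp add: smult_dvd_iff split: if_splits)
qed

lemma higher_pderiv_transition_on:
  "(pderiv ^^ k) (transition_on m a b) = smult ((1 / (b - a)) ^ k) (pcompose ((pderiv ^^ k) (transition m)) [:- a / (b - a), 1 / (b - a):])"
proof (induction k)
  case (Suc k)
  have "pderiv [:- a / (b - a), 1 / (b - a):] = [:1 / (b - a):]" by (simp add: pderiv_pCons)
  then show ?case
    using Suc by (simp add: pderiv_smult pderiv_pcompose mult.commute)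
qed (simp add: transition_on_def)

text \<open>After rescaling to the unit interval only m + 1 fixed polynomials on a compact set
  remain, so the bound depends on m alone.\<close>

lemma transition_bound:
  "\<exists>M\<ge>0. \<forall>a b t k. a < b \<longrightarrow> a \<le> t \<longrightarrow> t \<le> b \<longrightarrow> k \<le> m \<longrightarrow>
     (b - a) ^ k * \<bar>poly ((pderiv ^^ k) (transition_on m a b)) t\<bar> \<le> M"
proof -
  have "\<exists>M. \<forall>u\<in>{0..1}. \<bar>poly ((pderiv ^^ k) (transition m)) u\<bar> \<le> M" for k
  proof -
    have "compact ((poly ((pderiv ^^ k) (transition m))) ` {0..1})"
      by (intro compact_continuous_image) (auto intro!: continuous_intros)
    then have "bounded ((poly ((pderiv ^^ k) (transition m))) ` {0..1})" by (rule compact_imp_bounded)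
    then show ?thesis by (auto simp: bounded_iff)
  qed
  then have "\<forall>k. \<exists>M. \<forall>u\<in>{0..1}. \<bar>poly ((pderiv ^^ k) (transition m)) u\<bar> \<le> M" by blast
  from choice[OF this] obtain M where M: "\<forall>k. \<forall>u\<in>{0..1}. \<bar>poly ((pderiv ^^ k) (transition m)) u\<bar> \<le> M k"
    by (rule exE)
  have M0: "0 \<le> M k" for k using M[rule_format, of 0 k] by simp
  have "(b - a) ^ k * \<bar>poly ((pderiv ^^ k) (transition_on m a b)) t\<bar> \<le> (\<Sum>k\<le>m. M k)"
    if "a < b" "a \<le> t" "t \<le> b" "k \<le> m" for a b t k
  proof -
    have "(b - a) ^ k * \<bar>poly ((pderiv ^^ k) (transition_on m a b)) t\<bar> = \<bar>poly ((pderiv ^^ k) (transition m)) ((t - a) / (b - a))\<bar>"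
    proof -
      have "- a / (b - a) + t * (1 / (b - a)) = (t - a) / (b - a)" by (simp add: diff_divide_distrib)
      then show ?thesis
        using that(1) by (simp add: higher_pderiv_transition_on poly_pcompose abs_mult power_one_over)
    qed
    also have "\<dots> \<le> M k" using M that by (simp add: divide_le_eq_1)
    also have "\<dots> \<le> (\<Sum>k\<le>m. M k)" using that M0 by (intro member_le_sum) auto
    finally show ?thesis .
  qed
  then show ?thesis using M0 by (intro exI[of _ "\<Sum>k\<le>m. M k"]) (auto intro: sum_nonneg)
qed

text \<open>Derivative of order k of the function that is 0 up to a, equals Q from b on, and passes
  between them through the transition polynomial. The pieces agree at a and b for k < m; for k = m
  they may not, and the values at a and b are a convention.\<close>

definition patch :: "nat \<Rightarrow> real \<Rightarrow> real \<Rightarrow> real poly \<Rightarrow> nat \<Rightarrow> real \<Rightarrow> real" where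
  "patch m a b Q k t = (if t \<le> a then 0 else if t \<le> b then poly ((pderiv ^^ k) (transition_on m a b * Q)) t
     else poly ((pderiv ^^ k) Q) t)"

lemma patch_joints:
  assumes "a < b" "k < m"
  shows "poly ((pderiv ^^ k) (transition_on m a b * Q)) a = 0"
    "poly ((pderiv ^^ k) (transition_on m a b * Q)) b = poly ((pderiv ^^ k) Q) b"
proof -
  show "poly ((pderiv ^^ k) (transition_on m a b * Q)) a = 0"
    by (rule power_dvd_higher_pderiv[OF dvd_mult2[OF transition_on_dvd(1)[OF assms(1)]] assms(2)])
  have "[:- b, 1:] ^ m dvd (1 - transition_on m a b) * Q"
    by (rule dvd_mult2[OF transition_on_dvd(2)[OF assms(1)]])
  from power_dvd_higher_pderiv[OF this assms(2)]
  show "poly ((pderiv ^^ k) (transition_on m a b * Q)) b = poly ((pderiv ^^ k) Q) b"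
    by (simp add: left_diff_distrib higher_pderiv_diff)
qed

lemma patch_right:
  assumes "a < b" "k < m" "b \<le> t"
  shows "patch m a b Q k t = poly ((pderiv ^^ k) Q) t"
  using assms patch_joints(2)[OF assms(1,2), of Q] by (cases "t = b") (auto simp: patch_def)

lemma patch_DERIV:
  assumes ab: "a < b" and k: "k < m" and t: "t \<notin> {a, b} \<or> Suc k < m"
  shows "(patch m a b Q k has_real_derivative patch m a b Q (Suc k) t) (at t)"
proof -
  let ?q = "\<lambda>k. poly ((pderiv ^^ k) (transition_on m a b * Q))"
  let ?Q = "\<lambda>k. poly ((pderiv ^^ k) Q)"
  note D = has_real_derivative_higher_pderiv
  consider "t < a" | "t = a" | "a < t" "t < b" | "t = b" | "b < t" by linarith
  then show ?thesis
  proof cases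
    case 1
    have "((\<lambda>t. 0 :: real) has_real_derivative 0) (at t)" by simp
    then have "(patch m a b Q k has_real_derivative 0) (at t)"
      by (rule has_field_derivative_transform_within_open[where S = "{..<a}"]) (use 1 in \<open>auto simp: patch_def\<close>)
    then show ?thesis using 1 by (simp add: patch_def)
  next
    case 2
    then have k': "Suc k < m" using t by simp
    have "(patch m a b Q k has_real_derivative 0) (at a)"
    proof (rule has_real_derivative_glue)
      show "((\<lambda>t. 0 :: real) has_real_derivative 0) (at a)" by simp
      show "(?q k has_real_derivative 0) (at a)"
        using D[of k "transition_on m a b * Q" a] patch_joints(1)[OF ab k'] by (simp only:)
      show "eventually (\<lambda>t. patch m a b Q k t = ?q k t) (at_right a)"
        using ab by (intro eventually_at_rightI[of a b]) (auto simp: patch_def)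
      show "(0 :: real) = ?q k a" using patch_joints(1)[OF ab k] by (simp only:)
    qed (simp add: patch_def)
    then show ?thesis using 2 by (simp add: patch_def)
  next
    case 3
    have "(patch m a b Q k has_real_derivative ?q (Suc k) t) (at t)"
      by (rule has_field_derivative_transform_within_open[OF D, where S = "{a<..<b}"]) (use 3 in \<open>auto simp: patch_def\<close>)
    then show ?thesis using 3 by (simp add: patch_def)
  next
    case 4
    then have k': "Suc k < m" using t by simp
    have eq: "?q (Suc k) b = ?Q (Suc k) b" by (rule patch_joints(2)[OF ab k'])
    have "(patch m a b Q k has_real_derivative ?q (Suc k) b) (at b)"
    proof (rule DERIV_cong_ev[THEN iffD2, OF refl _ refl])
      \<comment> \<open>Gluing asks for equality on the whole left half-line, which
        \<open>patch\<close> has with this piece only near b; \<open>g\<close> agrees with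
        \<open>patch\<close> around b and satisfies it.\<close>
      define g where "g t = (if t \<le> b then ?q k t else ?Q k t)" for t
      show "eventually (\<lambda>t. patch m a b Q k t = g t) (nhds b)"
        by (rule eventually_nhds_in_open[of "{a<..}", THEN eventually_mono])
          (use ab in \<open>auto simp: patch_def g_def\<close>)
      show "(g has_real_derivative ?q (Suc k) b) (at b)"
      proof (rule has_real_derivative_glue[OF D])
        show "(?Q k has_real_derivative ?q (Suc k) b) (at b)" unfolding eq by (rule D)
        show "eventually (\<lambda>t. g t = ?Q k t) (at_right b)"
          by (intro eventually_at_rightI[of b "b + 1"]) (auto simp: g_def)
        show "?q k b = ?Q k b" by (rule patch_joints(2)[OF ab k])
      qed (simp add: g_def)
    qed
    then show ?thesis using 4 ab by (simp add: patch_def)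
  next
    case 5
    have "(patch m a b Q k has_real_derivative ?Q (Suc k) t) (at t)"
      by (rule has_field_derivative_transform_within_open[OF D, where S = "{b<..}"]) (use 5 ab in \<open>auto simp: patch_def\<close>)
    then show ?thesis using 5 ab by (simp add: patch_def)
  qed
qed

text \<open>At order m - 1 differentiability can fail at the joints, so continuity is shown
  separately: clamping t to \<open>{a..b}\<close> and to \<open>{b..}\<close> merges the three cases
  into one continuous formula.\<close>

lemma patch_continuous:
  assumes ab: "a < b" and k: "k < m"
  shows "continuous_on UNIV (patch m a b Q k)"
proof -
  let ?q = "poly ((pderiv ^^ k) (transition_on m a b * Q))"
  let ?Q = "poly ((pderiv ^^ k) Q)"
  have "patch m a b Q k = (\<lambda>t. ?q (max a (min t b)) + (?Q (max t b) - ?Q b))"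
    using patch_joints[OF ab k, of Q] ab by (auto simp: patch_def fun_eq_iff max_def min_def)
  then show ?thesis by (simp only:) (intro continuous_intros)
qed

section \<open>The extension from finitely many knots\<close>

lemma interp_newton:
  fixes x :: "nat \<Rightarrow> real"
  assumes inj: "inj_on x {s..<s + m}" and m: "1 \<le> m"
  shows "interp f (x ` {s..<s + m}) = (\<Sum>r<m. smult (dd f (x ` {s..s + r})) (nodal (x ` {s..<s + r})))"
  using m inj
proof (induction m rule: dec_induct)
  case base
  have "interp f {x s} = [:f (x s):]" by (rule interp_eqI) auto
  then show ?case by simp
next
  case (step n)
  have set: "{s..<s + Suc n} = insert (s + n) {s..<s + n}" by auto
  have notin: "x (s + n) \<notin> x ` {s..<s + n}"
    using step.prems unfolding set inj_on_insert by simp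
  have "interp f (x ` {s..<s + Suc n}) = interp f (insert (x (s + n)) (x ` {s..<s + n}))"
    unfolding set by simp
  also have "\<dots> = interp f (x ` {s..<s + n}) + smult (dd f (insert (x (s + n)) (x ` {s..<s + n}))) (nodal (x ` {s..<s + n}))"
    by (rule interp_insert) (use notin step.hyps in auto)
  also have "insert (x (s + n)) (x ` {s..<s + n}) = x ` {s..s + n}"
  proof -
    have "{s..s + n} = insert (s + n) {s..<s + n}" by auto
    then show ?thesis by simp
  qed
  also have "interp f (x ` {s..<s + n}) = (\<Sum>r<n. smult (dd f (x ` {s..s + r})) (nodal (x ` {s..<s + r})))"
    by (rule step.IH[OF inj_on_subset[OF step.prems]]) auto
  finally show ?case by simp
qed

text \<open>Windows of length at most 1 put every knot of a window within distance 1 of each of its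
  points, as \<open>sharp\<close> demands. The m zeros at either end make the first and the last
  interpolating polynomial 0.\<close>

locale knots =
  fixes m n :: nat and x :: "nat \<Rightarrow> real" and f :: "real \<Rightarrow> real"
  assumes m: "1 \<le> m" and n: "m < n"
    and incr: "\<And>i j. i < j \<Longrightarrow> j < n \<Longrightarrow> x i < x j"
    and window: "\<And>j. j + m < n \<Longrightarrow> x (j + m) - x j \<le> 1"
    and zero_left: "\<And>i. i < m \<Longrightarrow> f (x i) = 0"
    and zero_right: "\<And>i. n - m \<le> i \<Longrightarrow> i < n \<Longrightarrow> f (x i) = 0"
begin

lemma incr_le: "i \<le> j \<Longrightarrow> j < n \<Longrightarrow> x i \<le> x j"
  using incr[of i j] by (cases "i = j") auto

lemma inj: "A \<subseteq> {..<n} \<Longrightarrow> inj_on x A"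
  by (rule linorder_inj_onI') (use incr in force)

definition gap :: "nat \<Rightarrow> real" where
  "gap i = x (Suc i) - x i"

text \<open>Choosing the leftmost among the widest gaps makes the choice monotone in the window.\<close>

definition widest :: "nat \<Rightarrow> nat" where
  "widest j = (LEAST i. i \<in> {j..<j + m} \<and> (\<forall>l\<in>{j..<j + m}. gap l \<le> gap i))"

lemma widest:
  shows "widest j \<in> {j..<j + m}" and "l \<in> {j..<j + m} \<Longrightarrow> gap l \<le> gap (widest j)"
    and "l \<in> {j..<j + m} \<Longrightarrow> l < widest j \<Longrightarrow> gap l < gap (widest j)"
proof -
  let ?P = "\<lambda>i. i \<in> {j..<j + m} \<and> (\<forall>l\<in>{j..<j + m}. gap l \<le> gap i)"
  have "\<exists>i\<in>{j..<j + m}. \<forall>l\<in>{j..<j + m}. gap l \<le> gap i"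
  proof -
    have fin: "finite (gap ` {j..<j + m})" "gap ` {j..<j + m} \<noteq> {}" using m by auto
    from Max_in[OF this] obtain i where "i \<in> {j..<j + m}" "gap i = Max (gap ` {j..<j + m})" by auto
    then show ?thesis using Max_ge[OF fin(1)] by (intro bexI[of _ i]) auto
  qed
  then have "\<exists>i. ?P i" by blast
  from LeastI_ex[OF this] have W: "?P (widest j)" unfolding widest_def .
  then show "widest j \<in> {j..<j + m}" "l \<in> {j..<j + m} \<Longrightarrow> gap l \<le> gap (widest j)" by auto
  assume l: "l \<in> {j..<j + m}" "l < widest j"
  then have "\<not> ?P l" unfolding widest_def by (intro not_less_Least)
  then obtain l' where "l' \<in> {j..<j + m}" "gap l < gap l'" using l(1) by (auto simp: not_le)
  then show "gap l < gap (widest j)" using W by force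
qed

text \<open>If the order were reversed, both gaps would lie in both windows: as leftmost widest gap
  of window j the later one is strictly wider, while in window j' it is not wider.\<close>

lemma widest_mono:
  assumes "j \<le> j'"
  shows "widest j \<le> widest j'"
proof (rule ccontr)
  assume "\<not> ?thesis"
  then have less: "widest j' < widest j" by simp
  have "gap (widest j') < gap (widest j)"
    by (rule widest(3)[OF _ less]) (use widest(1)[of j'] widest(1)[of j] less assms in auto)
  moreover have "gap (widest j) \<le> gap (widest j')"
    by (rule widest(2)) (use widest(1)[of j'] widest(1)[of j] less assms in auto)
  ultimately show False by simp
qed

definition P :: "nat \<Rightarrow> real poly" where
  "P s = interp f (x ` {s..<s + m})"

definition coef :: "nat \<Rightarrow> real" where
  "coef j = dd f (x ` {j..j + m})"

text \<open>Writing the extension as a sum of transitions lets the completed ones telescope to a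
  single \<open>P s\<close>, while those not yet begun contribute 0.\<close>

definition T :: "nat \<Rightarrow> nat \<Rightarrow> real \<Rightarrow> real" where
  "T j = patch m (x (widest j)) (x (Suc (widest j))) (P (Suc j) - P j)"

definition D :: "nat \<Rightarrow> real \<Rightarrow> real" where
  "D k t = (\<Sum>j<n - m. T j k t)"

lemma widest_less: "j < n - m \<Longrightarrow> Suc (widest j) < n"
  using widest(1)[of j] by auto

lemma gap_pos: "j < n - m \<Longrightarrow> x (widest j) < x (Suc (widest j))"
  using widest_less[of j] by (intro incr) auto

lemma window_le: "j < n - m \<Longrightarrow> l \<in> {j..j + m} \<Longrightarrow> x j \<le> x l \<and> x l \<le> x (j + m)"
  using incr_le[of j l] incr_le[of l "j + m"] by auto

lemma P_diff:
  assumes j: "j < n - m"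
  shows "P (Suc j) - P j = smult (coef j * (x (j + m) - x j)) (nodal (x ` {Suc j..<j + m}))"
proof -
  let ?T = "x ` {Suc j..<j + m}"
  have lt: "x i < x l" if "i < l" "l \<le> j + m" for i l
    using that j by (intro incr) auto
  have 1: "x ` {Suc j..<Suc j + m} = insert (x (j + m)) ?T"
  proof -
    have "{Suc j..<Suc j + m} = insert (j + m) {Suc j..<j + m}" using m by auto
    then show ?thesis by simp
  qed
  have 2: "x ` {j..<j + m} = insert (x j) ?T"
  proof -
    have "{j..<j + m} = insert j {Suc j..<j + m}" using m by auto
    then show ?thesis by simp
  qed
  have 3: "x ` {j..j + m} = insert (x j) (insert (x (j + m)) ?T)"
  proof -
    have "{j..j + m} = insert j (insert (j + m) {Suc j..<j + m})" using m by auto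
    then show ?thesis by simp
  qed
  have "x l \<noteq> x j" "x l \<noteq> x (j + m)" if "l \<in> {Suc j..<j + m}" for l
    using lt[of j l] lt[of l "j + m"] that by auto
  then have "x j \<notin> ?T" "x (j + m) \<notin> ?T" by (metis imageE)+
  moreover have "x j \<noteq> x (j + m)" using lt[of j "j + m"] m by simp
  ultimately have "x j \<notin> ?T" "x (j + m) \<notin> ?T" "x j \<noteq> x (j + m)" by blast+
  from interp_exchange[OF _ this, of f] show ?thesis
    unfolding P_def coef_def 1 2 3 by simp
qed

lemma P_ends: "P 0 = 0" "P (n - m) = 0"
  unfolding P_def by (rule dd_zero(1); use m n zero_left zero_right in auto)+

lemma P_interp: "s + m \<le> n \<Longrightarrow> i \<in> {s..<s + m} \<Longrightarrow> poly (P s) (x i) = f (x i)"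
  unfolding P_def by (rule poly_interp) auto

text \<open>The transitions completed at the knot \<open>i\<close> are exactly those with index below \<open>start i\<close>, so that
  the extension takes the value of \<open>P (start i)\<close> there.\<close>

definition start :: "nat \<Rightarrow> nat" where
  "start i = (LEAST j. n - m \<le> j \<or> i \<le> widest j)"

text \<open>By monotonicity of \<open>widest\<close>, the windows with their gap to the left of knot
  i form an initial segment. The last clause makes knot i a node of
  \<open>P (start i)\<close>.\<close>

lemma start:
  shows "start i \<le> n - m" and "j < start i \<Longrightarrow> j < n - m \<and> widest j < i"
    and "start i \<le> j \<Longrightarrow> j < n - m \<Longrightarrow> i \<le> widest j"
    and "i < n \<Longrightarrow> start i \<le> i \<and> i < start i + m"
proof -
  let ?P = "\<lambda>j. n - m \<le> j \<or> i \<le> widest j"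
  have P: "?P (start i)" unfolding start_def by (rule LeastI[of ?P "n - m"]) simp
  show le: "start i \<le> n - m" unfolding start_def by (rule Least_le) simp
  show "j < n - m \<and> widest j < i" if "j < start i"
    using not_less_Least[of j ?P] that unfolding start_def by (auto simp: not_le)
  show "i \<le> widest j" if "start i \<le> j" "j < n - m"
    using P that widest_mono[OF that(1)] by auto
  assume i: "i < n"
  \<comment> \<open>\<open>widest i\<close> lies in \<open>{i..<i + m}\<close> for every i, even
    when this window runs past the last knot.\<close>
  have "?P i" using widest(1)[of i] by auto
  then have "start i \<le> i" unfolding start_def by (rule Least_le)
  moreover have "i < start i + m"
    using P i n widest(1)[of "start i"] by (cases "n - m \<le> start i") auto
  ultimately show "start i \<le> i \<and> i < start i + m" ..
qed

lemma sum_P_diff: "s \<le> n - m \<Longrightarrow> (\<Sum>j<s. P (Suc j) - P j) = P s"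
  using sum_lessThan_telescope[of P s] P_ends(1) by simp

lemma T_zero: "j < n - m \<Longrightarrow> t \<le> x (widest j) \<Longrightarrow> T j k t = 0"
  by (simp add: T_def patch_def)

lemma T_right: "j < n - m \<Longrightarrow> x (Suc (widest j)) < t \<Longrightarrow> T j k t = poly ((pderiv ^^ k) (P (Suc j) - P j)) t"
  using gap_pos[of j] by (simp add: T_def patch_def)

text \<open>At a knot no transition is in progress, since each runs over exactly one gap; the sum is
  therefore \<open>P (start i)\<close>, which has the knot among its nodes.\<close>

lemma D_interp:
  assumes i: "i < n"
  shows "D 0 (x i) = f (x i)"
proof -
  have "T j 0 (x i) = (if j < start i then poly (P (Suc j) - P j) (x i) else 0)" if j: "j < n - m" for j
  proof (cases "j < start i")
    case True
    \<comment> \<open>Equality may occur; \<open>patch_right\<close> covers the joint because the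
      pieces agree there at order 0 < m.\<close>
    then have "x (Suc (widest j)) \<le> x i" using start(2)[OF True] i by (intro incr_le) auto
    then show ?thesis
      unfolding T_def using True by (subst patch_right[OF gap_pos[OF j]]) (use m in auto)
  next
    case False
    then have "x i \<le> x (widest j)" using start(3)[of i j] j widest_less[OF j] by (intro incr_le) auto
    then show ?thesis using False j by (simp add: T_zero)
  qed
  then have "D 0 (x i) = (\<Sum>j<n - m. if j < start i then poly (P (Suc j) - P j) (x i) else 0)"
    unfolding D_def by (intro sum.cong) auto
  also have "\<dots> = (\<Sum>j<start i. poly (P (Suc j) - P j) (x i))"
    using start(1)[of i] by (intro sum.mono_neutral_cong_right) auto
  also have "\<dots> = poly (P (start i)) (x i)"
    unfolding sum_P_diff[OF start(1)[of i], symmetric] by (rule poly_sum[symmetric])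
  also have "\<dots> = f (x i)"
    by (rule P_interp) (use start(1,4)[of i] i n in auto)
  finally show ?thesis .
qed

lemma D_outside:
  assumes "t \<le> x 0 \<or> x (n - 1) < t"
  shows "D k t = 0"
proof (cases "t \<le> x 0")
  case True
  have "T j k t = 0" if "j < n - m" for j
    using True incr_le[of 0 "widest j"] widest_less[OF that] that by (intro T_zero) auto
  then show ?thesis by (simp add: D_def)
next
  case False
  have "T j k t = poly ((pderiv ^^ k) (P (Suc j) - P j)) t" if j: "j < n - m" for j
  proof (rule T_right[OF j])
    have "x (Suc (widest j)) \<le> x (n - 1)" using widest_less[OF j] n by (intro incr_le) auto
    then show "x (Suc (widest j)) < t" using False assms by simp
  qed
  then have "D k t = poly ((pderiv ^^ k) (\<Sum>j<n - m. P (Suc j) - P j)) t"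
    by (simp add: D_def higher_pderiv_sum poly_sum)
  then show ?thesis using sum_P_diff[of "n - m"] P_ends(2) by simp
qed

text \<open>Only the windows whose chosen gap is this one are in transition here; several windows
  may share a gap.\<close>

lemma D_on_gap:
  assumes i: "Suc i < n" and t: "x i < t" "t \<le> x (Suc i)"
  shows "D k t = poly ((pderiv ^^ k) (P (start i))) t + (\<Sum>j\<in>{j. j < n - m \<and> widest j = i}. T j k t)"
proof -
  have eq: "T j k t = (if j < start i then poly ((pderiv ^^ k) (P (Suc j) - P j)) t else 0) + (if widest j = i then T j k t else 0)"
    if j: "j < n - m" for j
  proof (cases "j < start i")
    case True
    have w: "widest j < i" using start(2)[OF True] by simp
    then have "x (Suc (widest j)) \<le> x i" using i by (intro incr_le) auto
    then show ?thesis using True w t j by (simp add: T_right)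
  next
    case False
    then have "i \<le> widest j" using start(3) j by simp
    then consider "widest j = i" | "Suc i \<le> widest j" by linarith
    then show ?thesis
    proof cases
      case 2
      then have "x (Suc i) \<le> x (widest j)" using widest_less[OF j] by (intro incr_le) auto
      then show ?thesis using False 2 t j by (simp add: T_zero)
    qed (use False in simp)
  qed
  have "D k t = (\<Sum>j<n - m. (if j < start i then poly ((pderiv ^^ k) (P (Suc j) - P j)) t else 0)) + (\<Sum>j<n - m. (if widest j = i then T j k t else 0))"
    unfolding D_def sum.distrib[symmetric] by (intro sum.cong refl eq) auto
  also have "(\<Sum>j<n - m. (if j < start i then poly ((pderiv ^^ k) (P (Suc j) - P j)) t else 0)) = (\<Sum>j<start i. poly ((pderiv ^^ k) (P (Suc j) - P j)) t)"
    using start(1)[of i] by (intro sum.mono_neutral_cong_right) auto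
  also have "\<dots> = poly ((pderiv ^^ k) (P (start i))) t"
    using sum_P_diff[OF start(1)[of i]] by (simp flip: poly_sum higher_pderiv_sum)
  also have "(\<Sum>j<n - m. (if widest j = i then T j k t else 0)) = (\<Sum>j\<in>{j. j < n - m \<and> widest j = i}. T j k t)"
    by (intro sum.mono_neutral_cong_right) auto
  finally show ?thesis .
qed

text \<open>The m terms of the Newton form have nodes within distance 1 of t, so the nodal bound is
  used at scale h = 1 with r = 1 and costs 1 + m for each factor.\<close>

lemma P_bound:
  assumes s: "s + m \<le> n" and t: "\<And>l. l \<in> {s..<s + m} \<Longrightarrow> \<bar>t - x l\<bar> \<le> 1"
    and \<beta>: "\<And>r. r < m \<Longrightarrow> \<bar>dd f (x ` {s..s + r})\<bar> \<le> \<beta>" and k: "k \<le> m"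
  shows "\<bar>poly ((pderiv ^^ k) (P s)) t\<bar> \<le> real m * (1 + real m) ^ m * \<beta>"
proof -
  have \<beta>0: "0 \<le> \<beta>" using \<beta>[of 0] m by simp
  have "\<bar>poly ((pderiv ^^ k) (smult (dd f (x ` {s..s + r})) (nodal (x ` {s..<s + r})))) t\<bar> \<le> (1 + real m) ^ m * \<beta>"
    if r: "r < m" for r
  proof -
    have p1: "1 ^ j * \<bar>poly ((pderiv ^^ j) 1) t\<bar> \<le> 1" for j
      by (cases j) (auto simp: funpow_Suc_right simp del: funpow.simps)
    have inj': "inj_on x {s..<s + r}" using r s by (intro inj) auto
    have "1 ^ k * \<bar>poly ((pderiv ^^ k) (nodal (x ` {s..<s + r}) * 1)) t\<bar> \<le> ((1 + real m) * 1) ^ card (x ` {s..<s + r}) * 1"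
      by (rule higher_pderiv_nodal_mult_le[OF _ _ _ _ _ p1 k]) (use t r in auto)
    then have "\<bar>poly ((pderiv ^^ k) (nodal (x ` {s..<s + r}))) t\<bar> \<le> (1 + real m) ^ r"
      by (simp add: card_image[OF inj'])
    also have "\<dots> \<le> (1 + real m) ^ m" using r by (intro power_increasing) auto
    finally have "\<bar>dd f (x ` {s..s + r})\<bar> * \<bar>poly ((pderiv ^^ k) (nodal (x ` {s..<s + r}))) t\<bar> \<le> \<beta> * (1 + real m) ^ m"
      using \<beta>[OF r] \<beta>0 by (intro mult_mono) auto
    then show ?thesis by (simp add: higher_pderiv_smult abs_mult mult.commute)
  qed
  then have "(\<Sum>r<m. \<bar>poly ((pderiv ^^ k) (smult (dd f (x ` {s..s + r})) (nodal (x ` {s..<s + r})))) t\<bar>) \<le> (\<Sum>r<m. (1 + real m) ^ m * \<beta>)"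
    by (intro sum_mono) auto
  also have "\<dots> = real m * (1 + real m) ^ m * \<beta>" by simp
  finally have bound: "(\<Sum>r<m. \<bar>poly ((pderiv ^^ k) (smult (dd f (x ` {s..s + r})) (nodal (x ` {s..<s + r})))) t\<bar>)
      \<le> real m * (1 + real m) ^ m * \<beta>" .
  have "inj_on x {s..<s + m}" using s by (intro inj) auto
  then have "poly ((pderiv ^^ k) (P s)) t = (\<Sum>r<m. poly ((pderiv ^^ k) (smult (dd f (x ` {s..s + r})) (nodal (x ` {s..<s + r})))) t)"
    unfolding P_def by (simp only: interp_newton[OF _ m] higher_pderiv_sum poly_sum)
  then show ?thesis using order_trans[OF sum_abs bound] by (simp only:)
qed

lemma window_length_le:
  assumes j: "j < n - m"
  shows "x (j + m) - x j \<le> real m * gap (widest j)"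
proof -
  have "(\<Sum>l = j..<j + m. gap l) = x (j + m) - x j"
    unfolding gap_def by (rule sum_Suc_diff') simp
  moreover have "(\<Sum>l = j..<j + m. gap l) \<le> (\<Sum>l = j..<j + m. gap (widest j))"
    by (intro sum_mono widest(2))
  ultimately show ?thesis by simp
qed

text \<open>Power counting in the length h of the chosen gap. The window length contributes at most
  m h, each of the m - 1 inner knots at most 2 m h, and k derivatives cost h^k; the remaining factor
  h^(m-k) is at most 1.\<close>

lemma T_bound:
  assumes M: "\<And>a b t k. a < b \<Longrightarrow> a \<le> t \<Longrightarrow> t \<le> b \<Longrightarrow> k \<le> m \<Longrightarrow>
       (b - a) ^ k * \<bar>poly ((pderiv ^^ k) (transition_on m a b)) t\<bar> \<le> M" and M0: "0 \<le> M"
    and j: "j < n - m" and t: "x (widest j) < t" "t \<le> x (Suc (widest j))" and k: "k \<le> m"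
  shows "\<bar>T j k t\<bar> \<le> real m * (2 * real m) ^ (m - 1) * M * \<bar>coef j\<bar>"
proof -
  define a where "a = x (widest j)"
  define b where "b = x (Suc (widest j))"
  define h where "h = b - a"
  define L where "L = x (j + m) - x j"
  have L: "0 \<le> L" "L \<le> real m * h" "L \<le> 1"
    using window_length_le[OF j] window[of j] window_le[OF j, of j] j by (auto simp: L_def h_def a_def b_def gap_def)
  have inw: "x j \<le> a" "b \<le> x (j + m)"
    using widest(1)[of j] window_le[OF j, of "widest j"] window_le[OF j, of "Suc (widest j)"] by (auto simp: a_def b_def)
  have h: "0 < h" "h \<le> 1" using gap_pos[OF j] inw L(3) by (auto simp: h_def a_def b_def L_def)
  have ij: "inj_on x {Suc j..<j + m}" using j by (intro inj) auto
  have near: "\<bar>t - y\<bar> \<le> real m * h" if "y \<in> x ` {Suc j..<j + m}" for y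
  proof -
    obtain l where l: "l \<in> {Suc j..<j + m}" "y = x l" using \<open>y \<in> x ` {Suc j..<j + m}\<close> by blast
    have "x j \<le> y" "y \<le> x (j + m)" using window_le[OF j, of l] l by auto
    then have "\<bar>t - y\<bar> \<le> L" using inw t unfolding L_def a_def b_def by linarith
    then show ?thesis using L(2) by linarith
  qed
  have "h ^ k * \<bar>poly ((pderiv ^^ k) (nodal (x ` {Suc j..<j + m}) * transition_on m a b)) t\<bar>
      \<le> ((real m + real m) * h) ^ card (x ` {Suc j..<j + m}) * M"
    by (rule higher_pderiv_nodal_mult_le[OF _ _ _ M0 near _ k])
      (use h M[of a b t] gap_pos[OF j] t in \<open>auto simp: a_def b_def h_def\<close>)
  also have "card (x ` {Suc j..<j + m}) = m - 1" by (simp add: card_image[OF ij])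
  finally have q: "h ^ k * \<bar>poly ((pderiv ^^ k) (nodal (x ` {Suc j..<j + m}) * transition_on m a b)) t\<bar>
      \<le> (2 * real m * h) ^ (m - 1) * M" by simp
  have "transition_on m a b * (P (Suc j) - P j) = smult (coef j * L) (nodal (x ` {Suc j..<j + m}) * transition_on m a b)"
    by (simp add: P_diff[OF j] L_def mult.commute)
  then have "T j k t = coef j * L * poly ((pderiv ^^ k) (nodal (x ` {Suc j..<j + m}) * transition_on m a b)) t"
    using t by (simp add: T_def patch_def a_def b_def higher_pderiv_smult)
  then have "h ^ k * \<bar>T j k t\<bar> = \<bar>coef j\<bar> * (L * (h ^ k * \<bar>poly ((pderiv ^^ k) (nodal (x ` {Suc j..<j + m}) * transition_on m a b)) t\<bar>))"
    using L(1) by (simp add: abs_mult)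
  also have "\<dots> \<le> \<bar>coef j\<bar> * (real m * h * ((2 * real m * h) ^ (m - 1) * M))"
    using L q h M0 by (intro mult_left_mono mult_mono[OF L(2) q]) auto
  also have "\<dots> = h ^ m * (real m * (2 * real m) ^ (m - 1) * M * \<bar>coef j\<bar>)"
    using m by (cases m) (auto simp: power_mult_distrib)
  also have "\<dots> \<le> h ^ k * (real m * (2 * real m) ^ (m - 1) * M * \<bar>coef j\<bar>)"
    using h k M0 by (intro mult_right_mono power_decreasing) auto
  finally show ?thesis using h(1) by (simp add: mult_le_cancel_left_pos)
qed

text \<open>The first summand of the constant stems from \<open>P_bound\<close> for
  \<open>P (start i)\<close>, the second from the transitions on the gap. These number at most m,
  because a window that contains gap i starts at one of the m indices up to i.\<close>

lemma D_bound:
  assumes M: "\<And>a b t k. a < b \<Longrightarrow> a \<le> t \<Longrightarrow> t \<le> b \<Longrightarrow> k \<le> m \<Longrightarrow>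
       (b - a) ^ k * \<bar>poly ((pderiv ^^ k) (transition_on m a b)) t\<bar> \<le> M" and M0: "0 \<le> M"
    and lower: "\<And>s r. r < m \<Longrightarrow> s + m \<le> n \<Longrightarrow> (\<And>l. l \<in> {s..<s + m} \<Longrightarrow> \<bar>t - x l\<bar> \<le> 1) \<Longrightarrow> \<bar>dd f (x ` {s..s + r})\<bar> \<le> \<beta>"
    and top: "\<And>j. j < n - m \<Longrightarrow> x j \<le> t \<Longrightarrow> t \<le> x (j + m) \<Longrightarrow> \<bar>coef j\<bar> \<le> \<beta>"
    and \<beta>0: "0 \<le> \<beta>" and k: "k \<le> m"
  shows "\<bar>D k t\<bar> \<le> (real m * (1 + real m) ^ m + real m * (real m * (2 * real m) ^ (m - 1) * M)) * \<beta>"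
proof (cases "t \<le> x 0 \<or> x (n - 1) < t")
  case True
  then show ?thesis using D_outside M0 \<beta>0 by simp
next
  case False
  define K where "K = real m * (2 * real m) ^ (m - 1) * M"
  have K0: "0 \<le> K" using M0 by (simp add: K_def)
  define i where "i = (LEAST i. t \<le> x (Suc i))"
  have ex: "t \<le> x (Suc (n - 2))" using False n m by (simp add: numeral_2_eq_2 Suc_diff_Suc)
  have ti: "t \<le> x (Suc i)" unfolding i_def by (rule LeastI[of "\<lambda>i. t \<le> x (Suc i)", OF ex])
  have "i \<le> n - 2" unfolding i_def by (rule Least_le[of "\<lambda>i. t \<le> x (Suc i)", OF ex])
  then have i: "Suc i < n" using n m by linarith
  have xi: "x i < t"
  proof (cases i)
    case 0
    then show ?thesis using False by simp
  next
    case (Suc i')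
    then have "\<not> t \<le> x (Suc i')" using not_less_Least[of i' "\<lambda>i. t \<le> x (Suc i)"] by (simp add: i_def)
    then show ?thesis using Suc by simp
  qed
  define J where "J = {j. j < n - m \<and> widest j = i}"
  have "\<bar>poly ((pderiv ^^ k) (P (start i))) t\<bar> \<le> real m * (1 + real m) ^ m * \<beta>"
  \<comment> \<open>After the last transition no window of m + 1 knots starts at
    \<open>start i\<close>, but the polynomial is then 0.\<close>
  proof (cases "start i = n - m")
    case True
    then show ?thesis using P_ends(2) \<beta>0 by simp
  next
    case False
    then have s: "start i < n - m" using start(1)[of i] by simp
    have si: "start i \<le> i" "Suc i \<le> start i + m" using start(4)[of i] i by auto
    have "\<bar>t - x l\<bar> \<le> 1" if "l \<in> {start i..<start i + m}" for l
    proof -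
      have "x (start i) \<le> x i" "x (Suc i) \<le> x (start i + m)" using si s by (auto intro!: incr_le)
      then show ?thesis
        using window_le[OF s, of l] window[of "start i"] that s xi ti
        unfolding abs_le_iff less_diff_conv atLeastLessThan_iff atLeastAtMost_iff by force
    qed
    then show ?thesis by (intro P_bound lower k) (use s in auto)
  qed
  moreover have "\<bar>\<Sum>j\<in>J. T j k t\<bar> \<le> real m * K * \<beta>"
  proof -
    have "\<bar>T j k t\<bar> \<le> K * \<beta>" if "j \<in> J" for j
    proof -
      have j: "j < n - m" "widest j = i" using that by (auto simp: J_def)
      have "x j \<le> x i" "x (Suc i) \<le> x (j + m)"
        using widest(1)[of j] j by (auto intro!: incr_le)
      then have "\<bar>coef j\<bar> \<le> \<beta>" using top[OF j(1)] xi ti by simp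
      have "\<bar>T j k t\<bar> \<le> K * \<bar>coef j\<bar>"
        unfolding K_def by (rule T_bound[OF M M0 j(1) _ _ k]) (use j(2) xi ti in auto)
      also have "\<dots> \<le> K * \<beta>" using \<open>\<bar>coef j\<bar> \<le> \<beta>\<close> K0 by (rule mult_left_mono)
      finally show ?thesis .
    qed
    then have "(\<Sum>j\<in>J. \<bar>T j k t\<bar>) \<le> (\<Sum>j\<in>J. K * \<beta>)" by (rule sum_mono)
    also have "\<dots> = real (card J) * (K * \<beta>)" by simp
    also have "\<dots> \<le> real m * (K * \<beta>)"
    proof (rule mult_right_mono)
      have "J \<subseteq> {Suc i - m..i}"
      proof
        fix j assume "j \<in> J"
        then show "j \<in> {Suc i - m..i}" using widest(1)[of j] by (auto simp: J_def)
      qed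
      then have "card J \<le> card {Suc i - m..i}" by (intro card_mono) auto
      also have "\<dots> \<le> m" by simp
      finally show "real (card J) \<le> real m" by simp
    qed (use K0 \<beta>0 in simp)
    finally have "(\<Sum>j\<in>J. \<bar>T j k t\<bar>) \<le> real m * (K * \<beta>)" .
    from order_trans[OF sum_abs this] show ?thesis by (simp only: mult.assoc)
  qed
  ultimately show ?thesis
    unfolding D_on_gap[OF i xi ti] J_def[symmetric] K_def[symmetric] by (simp add: distrib_right abs_le_iff)
qed

lemma D_DERIV:
  assumes "k < m" "t \<notin> x ` {..<n} \<or> Suc k < m"
  shows "(D k has_real_derivative D (Suc k) t) (at t)"
  unfolding D_def
proof (rule DERIV_sum)
  fix j assume "j \<in> {..<n - m}"
  then have j: "j < n - m" by simp
  show "(T j k has_real_derivative T j (Suc k) t) (at t)"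
    unfolding T_def by (rule patch_DERIV[OF gap_pos[OF j] assms(1)]) (use assms(2) widest_less[OF j] in auto)
qed

lemma D_continuous: "k < m \<Longrightarrow> continuous_on UNIV (D k)"
  unfolding D_def T_def by (intro continuous_on_sum patch_continuous gap_pos) auto

text \<open>At order m the family \<open>D\<close> is a derivative off the finitely many knots only,
  which the integral does not see.\<close>

lemma D_has_integral:
  assumes "k < m" "u \<le> v"
  shows "(D (Suc k) has_integral D k v - D k u) {u..v}"
  by (rule fundamental_theorem_of_calculus_interior_strong[of "x ` {..<n}"])
    (use assms D_DERIV[OF assms(1)] continuous_on_subset[OF D_continuous[OF assms(1)]] in
      \<open>auto simp: has_real_derivative_iff_has_vector_derivative[symmetric]\<close>)

end

section \<open>The extension from a finite subset\<close>

text \<open>A set with points in both A and Z contains a pair at distance at least \<delta>, and one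
  recursion step over it costs 2/\<delta>. The steps end at subsets of A, bounded by N, or of Z,
  where the difference is 0.\<close>

lemma dd_zero_extension_le:
  fixes f g :: "real \<Rightarrow> real"
  assumes \<delta>: "0 < \<delta>" and N: "0 \<le> N"
    and g: "\<And>y. y \<in> A \<Longrightarrow> g y = f y" "\<And>y. y \<in> Z \<Longrightarrow> g y = 0"
    and sep: "\<And>y z. y \<in> A \<Longrightarrow> z \<in> Z \<Longrightarrow> \<delta> \<le> \<bar>y - z\<bar>"
    and S: "finite S" "S \<noteq> {}" "S \<subseteq> A \<union> Z"
    and bound: "\<And>T. T \<subseteq> S \<inter> A \<Longrightarrow> T \<noteq> {} \<Longrightarrow> \<bar>dd f T\<bar> \<le> N"
  shows "\<bar>dd g S\<bar> \<le> (1 + 2 / \<delta>) ^ card S * N"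
  using S bound
proof (induction "card S" arbitrary: S rule: less_induct)
  case less
  let ?K = "1 + 2 / \<delta>"
  have K: "1 \<le> ?K" using \<delta> by simp
  consider "S \<subseteq> A" | "S \<subseteq> Z" | y z where "y \<in> S" "y \<in> A" "z \<in> S" "z \<in> Z"
    using less.prems(3) by blast
  then show ?case
  proof cases
    case 1
    have "dd g S = dd f S" by (rule dd_cong) (use less.prems 1 g in auto)
    also have "\<bar>\<dots>\<bar> \<le> 1 * N" using less.prems 1 by simp
    also have "\<dots> \<le> ?K ^ card S * N" using K N by (intro mult_right_mono one_le_power)
    finally show ?thesis .
  next
    case 2
    have "dd g S = 0" by (rule dd_zero) (use less.prems 2 g in auto)
    then show ?thesis using K N by simp
  next
    case 3
    have d: "\<delta> \<le> \<bar>z - y\<bar>" using sep[OF 3(2,4)] by (simp add: abs_minus_commute)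
    then have "y \<noteq> z" using \<delta> by auto
    define c where "c = card S - 1"
    have c: "card S = Suc c" using less.prems 3(1) by (auto simp: c_def card_gt_0_iff)
    have IH: "\<bar>dd g (S - {w})\<bar> \<le> ?K ^ c * N" if "w \<in> {y, z}" for w
    proof -
      have w: "w \<in> S" using that 3 by blast
      have "S - {w} \<noteq> {}" using that 3 \<open>y \<noteq> z\<close> by blast
      then have "\<bar>dd g (S - {w})\<bar> \<le> ?K ^ card (S - {w}) * N"
        using less.prems w by (intro less.hyps) (auto simp: card_gt_0_iff)
      then show ?thesis using w by (simp add: c_def)
    qed
    have "\<bar>dd g S\<bar> \<le> (\<bar>dd g (S - {y})\<bar> + \<bar>dd g (S - {z})\<bar>) / \<delta>"
      by (rule abs_dd_recursion[OF less.prems(1) 3(1,3) d \<delta>])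
    also have "\<dots> \<le> (?K ^ c * N + ?K ^ c * N) / \<delta>"
      using IH[of y] IH[of z] \<delta> by (intro divide_right_mono add_mono) auto
    also have "\<dots> = (2 / \<delta>) * (?K ^ c * N)" by (simp add: field_simps)
    also have "\<dots> \<le> ?K * (?K ^ c * N)" using K N \<delta> by (intro mult_right_mono) auto
    finally show ?thesis by (simp add: c mult.assoc)
  qed
qed

lemma dd_le_sharp:
  assumes T: "T \<subseteq> E" "finite T" "card T = Suc k" "infdist t T \<le> 1" and k: "k < m"
  shows "ennreal \<bar>dd f T\<bar> \<le> sharp m k E f t"
proof -
  have "ennreal \<bar>dd f T\<bar> = ennreal (if k = m then diameter T / diameter (T \<union> {t}) * \<bar>divided_difference k f T\<bar>
    else \<bar>divided_difference k f T\<bar>)"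
    using T k by (simp add: dd_def)
  also have "\<dots> \<le> sharp m k E f t"
    unfolding sharp_def using T by (intro SUP_upper) auto
  finally show ?thesis .
qed

text \<open>For t in the hull of \<open>T\<close> adding t does not change the diameter, so the
  weight is 1.\<close>

lemma dd_le_sharp_top:
  assumes T: "T \<subseteq> E" "finite T" "card T = Suc m" "infdist t T \<le> 1" and t: "Min T \<le> t" "t \<le> Max T" and m: "1 \<le> m"
  shows "ennreal \<bar>dd f T\<bar> \<le> sharp m m E f t"
proof -
  have ne: "T \<noteq> {}" using T by auto
  have "Min T < Max T"
  proof (rule ccontr)
    assume "\<not> Min T < Max T"
    then have "y = Min T" if "y \<in> T" for y
      using Min_le[OF T(2) that] Max_ge[OF T(2) that] by simp
    then have "T \<subseteq> {Min T}" by blast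
    then have "card T \<le> 1" using card_mono[of "{Min T}" T] by simp
    then show False using T(3) m by simp
  qed
  moreover have "diameter (T \<union> {t}) = Max T - Min T"
    using diameter_insert_real[OF T(2) ne, of t] t by (simp add: max_def min_def)
  ultimately have "diameter T / diameter (T \<union> {t}) = 1"
    using diameter_real[OF T(2) ne] by simp
  then have "ennreal \<bar>dd f T\<bar> = ennreal (if m = m then diameter T / diameter (T \<union> {t}) * \<bar>divided_difference m f T\<bar>
    else \<bar>divided_difference m f T\<bar>)"
    using T by (simp only: dd_def mult_1 if_True) simp
  also have "\<dots> \<le> sharp m m E f t"
    unfolding sharp_def using T by (intro SUP_upper) auto
  finally show ?thesis .
qed

text \<open>Far from \<open>E0\<close> the function is continued by zero to a grid of mesh \<open>1 / (3 * m)\<close>. This makes all gaps short,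
  and the zeros at both ends give the extension compact support.\<close>

lemma knots_exist:
  fixes E0 :: "real set" and f :: "real \<Rightarrow> real"
  assumes m: "1 \<le> m" and E0: "finite E0" "E0 \<noteq> {}"
  defines "\<delta> \<equiv> 1 / (3 * real m)"
  shows "\<exists>n x Z. knots m n x (\<lambda>y. if y \<in> E0 then f y else 0) \<and> x ` {..<n} = E0 \<union> Z \<and>
    (\<forall>y\<in>E0. \<forall>z\<in>Z. \<delta> \<le> \<bar>y - z\<bar>)"
proof -
  have \<delta>: "0 < \<delta>" using m by (simp add: \<delta>_def)
  obtain r where r: "\<And>y. y \<in> E0 \<Longrightarrow> \<bar>y\<bar> \<le> r" "0 < r"
    using finite_imp_bounded[OF E0(1)] by (auto simp: bounded_pos)
  \<comment> \<open>Large enough for m grid points on each side of \<open>E0\<close>, all at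
    distance at least \<delta> from it.\<close>
  define L :: int where "L = \<lceil>r / \<delta>\<rceil> + int m + 1"
  have "r / \<delta> \<le> of_int \<lceil>r / \<delta>\<rceil>" by (rule le_of_int_ceiling)
  then have "r \<le> of_int \<lceil>r / \<delta>\<rceil> * \<delta>" by (simp only: pos_divide_le_eq[OF \<delta>])
  then have "r \<le> \<delta> * of_int \<lceil>r / \<delta>\<rceil>" by (simp only: mult.commute)
  then have L: "r + \<delta> * (real m + 1) \<le> \<delta> * of_int L"
    by (simp add: L_def algebra_simps)
  have "0 \<le> r / \<delta>" using r(2) \<delta> by simp
  then have "0 \<le> \<lceil>r / \<delta>\<rceil>" by linarith
  then have Lm: "int m \<le> L" by (simp add: L_def)
  define Z where "Z = {\<delta> * of_int l | l. l \<in> {- L..L} \<and> (\<forall>y\<in>E0. \<delta> \<le> \<bar>y - \<delta> * of_int l\<bar>)}"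
  have sep: "\<delta> \<le> \<bar>y - z\<bar>" if "y \<in> E0" "z \<in> Z" for y z using that by (auto simp: Z_def)
  have ZI: "\<delta> * of_int l \<in> Z" if "- L \<le> l" "l \<le> L" "\<And>y. y \<in> E0 \<Longrightarrow> \<delta> \<le> \<bar>y - \<delta> * of_int l\<bar>" for l
    unfolding Z_def using that by (intro CollectI exI[of _ l]) auto
  define X where "X = E0 \<union> Z"
  have "Z \<subseteq> (\<lambda>l. \<delta> * of_int l) ` {- L..L}" by (auto simp: Z_def)
  then have "finite Z" by (rule finite_subset) simp
  then have X: "finite X" using E0 by (simp add: X_def)
  have Xb: "\<bar>y\<bar> \<le> \<delta> * of_int L" if "y \<in> X" for y
  proof (cases "y \<in> E0")
    case True
    have "0 \<le> \<delta> * (real m + 1)" using \<delta> by simp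
    then show ?thesis using r(1)[OF True] L by linarith
  next
    case False
    then have "y \<in> Z" using that by (simp add: X_def)
    then obtain l where "y = \<delta> * of_int l" "l \<in> {- L..L}" unfolding Z_def by blast
    moreover from this have "\<bar>l\<bar> \<le> L" by auto
    then have "\<bar>real_of_int l\<bar> \<le> of_int L" by linarith
    ultimately show ?thesis using \<delta> by (simp add: abs_mult)
  qed
  have left: "\<delta> * of_int (int l - L) \<in> Z \<and> (\<forall>y\<in>E0. \<delta> * of_int (int l - L) < y)" if "l < m" for l
  proof -
    have le: "\<delta> * of_int (int l - L) \<le> y - \<delta>" if "y \<in> E0" for y
    proof -
      have "\<delta> * real l \<le> \<delta> * real m" using \<open>l < m\<close> \<delta> by (intro mult_left_mono) auto
      then show ?thesis using r(1)[OF that] L by (simp add: algebra_simps abs_le_iff)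
    qed
    have "\<delta> \<le> \<bar>y - \<delta> * of_int (int l - L)\<bar>" if "y \<in> E0" for y
      using le[OF that] by linarith
    moreover have "\<delta> * of_int (int l - L) < y" if "y \<in> E0" for y
      using le[OF that] \<delta> by linarith
    ultimately show ?thesis using that Lm by (intro conjI ballI ZI) auto
  qed
  have right: "\<delta> * of_int (L - int l) \<in> Z \<and> (\<forall>y\<in>E0. y < \<delta> * of_int (L - int l))" if "l < m" for l
  proof -
    have le: "y + \<delta> \<le> \<delta> * of_int (L - int l)" if "y \<in> E0" for y
    proof -
      have "\<delta> * real l \<le> \<delta> * real m" using \<open>l < m\<close> \<delta> by (intro mult_left_mono) auto
      then show ?thesis using r(1)[OF that] L by (simp add: algebra_simps abs_le_iff)
    qed
    have "\<delta> \<le> \<bar>y - \<delta> * of_int (L - int l)\<bar>" if "y \<in> E0" for y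
      using le[OF that] by linarith
    moreover have "y < \<delta> * of_int (L - int l)" if "y \<in> E0" for y
      using le[OF that] \<delta> by linarith
    ultimately show ?thesis using that Lm by (intro conjI ballI ZI) auto
  qed
  define xs where "xs = sorted_list_of_set X"
  define n where "n = card X"
  define x where "x i = xs ! i" for i
  have xs: "length xs = n" "set xs = X" "sorted_wrt (<) xs"
    using X by (auto simp: xs_def n_def)
  have incr: "x i < x j" if "i < j" "j < n" for i j
    using xs that by (simp add: x_def sorted_wrt_iff_nth_less)
  have img: "x ` {..<n} = X"
    using xs(1,2) by (auto simp: x_def in_set_conv_nth image_iff)
  have index: "\<exists>j<n. y = x j" if "y \<in> X" for y
    using that img by auto
  have less_index: "i < j" if "x i < x j" "i < n" for i j
    using that incr[of j i] by (cases i j rule: linorder_cases) auto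
  define g where "g y = (if y \<in> E0 then f y else 0)" for y
  have inj_left: "card ((\<lambda>l. \<delta> * of_int (int l - L)) ` {..<m}) = m" "card ((\<lambda>l. \<delta> * of_int (L - int l)) ` {..<m}) = m"
    using \<delta> by (auto simp: card_image inj_on_def)
  have gap: "x (Suc i) - x i \<le> 3 * \<delta>" if i: "Suc i < n" for i
  proof (rule ccontr)
    assume big: "\<not> ?thesis"
    \<comment> \<open>The grid point l \<delta> lies in [x i + \<delta>, x i + 2 \<delta>). In a gap
      longer than 3 \<delta> it keeps distance \<delta> from all knots, so it would itself be a
      knot.\<close>
    define l where "l = \<lceil>x i / \<delta>\<rceil> + 1"
    have "x i / \<delta> + 1 \<le> of_int l" "of_int l < x i / \<delta> + 2" unfolding l_def by linarith+
    then have l: "x i + \<delta> \<le> \<delta> * of_int l" "\<delta> * of_int l < x i + 2 * \<delta>" using \<delta> by (auto simp: field_simps)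
    have xi: "\<bar>x i\<bar> \<le> \<delta> * of_int L" "\<bar>x (Suc i)\<bar> \<le> \<delta> * of_int L"
      using Xb img i by auto
    have "\<delta> * of_int l < \<delta> * of_int L" using l xi(2) big \<delta> by linarith
    moreover have "- (\<delta> * of_int L) < \<delta> * of_int l" using l xi(1) \<delta> by linarith
    then have "\<delta> * of_int (- L) < \<delta> * of_int l" by simp
    ultimately have "\<delta> * of_int l < \<delta> * of_int L" "\<delta> * of_int (- L) < \<delta> * of_int l" by blast+
    then have lL: "l < L" "- L < l"
      using \<delta> by (simp_all only: mult_less_cancel_left_pos of_int_less_iff)
    have between: "y \<le> x i \<or> x (Suc i) \<le> y" if "y \<in> X" for y
    proof -
      obtain j where j: "j < n" "y = x j" using index[OF \<open>y \<in> X\<close>] by blast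
      show ?thesis using less_index[of i j] less_index[of j "Suc i"] j i by force
    qed
    have "\<delta> \<le> \<bar>y - \<delta> * of_int l\<bar>" if "y \<in> E0" for y
      using between[of y] that l big by (auto simp: X_def)
    then have "\<delta> * of_int l \<in> X" using lL by (auto simp: X_def Z_def)
    from between[OF this] show False using l big \<delta> by auto
  qed
  have step: "x (j + r) - x j \<le> real r * (3 * \<delta>)" if "j + r < n" for j r
    using that
  proof (induction r)
    case (Suc r)
    then show ?case using gap[of "j + r"] by (simp add: algebra_simps)
  qed simp
  have "knots m n x g"
  proof
    have "(\<lambda>l. \<delta> * of_int (int l - L)) ` {..<m} \<union> E0 \<subseteq> X" using left by (auto simp: X_def)
    then have "card ((\<lambda>l. \<delta> * of_int (int l - L)) ` {..<m} \<union> E0) \<le> n" unfolding n_def by (rule card_mono[OF X])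
    moreover have "((\<lambda>l. \<delta> * of_int (int l - L)) ` {..<m}) \<inter> E0 = {}" using left by force
    ultimately have "m + card E0 \<le> n" using E0(1) inj_left(1) by (simp add: card_Un_disjoint)
    moreover have "0 < card E0" using E0 by (simp add: card_gt_0_iff)
    ultimately show "m < n" by linarith
    show "x (j + m) - x j \<le> 1" if "j + m < n" for j
      using step[OF that] m by (simp add: \<delta>_def)
    show "g (x i) = 0" if "i < m" for i
    proof (rule ccontr)
      assume "g (x i) \<noteq> 0"
      then have xi: "x i \<in> E0" by (auto simp: g_def split: if_splits)
      \<comment> \<open>If knot i were in \<open>E0\<close>, the m grid points to the left of
        \<open>E0\<close> would all have smaller indices, so that m \<le> i.\<close>
      have "(\<lambda>l. \<delta> * of_int (int l - L)) ` {..<m} \<subseteq> x ` {..<i}"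
      proof
        fix z assume "z \<in> (\<lambda>l. \<delta> * of_int (int l - L)) ` {..<m}"
        then have z: "z \<in> X" "z < x i" using left xi by (auto simp: X_def)
        then obtain j where "j < n" "z = x j" using index[OF z(1)] by blast
        then show "z \<in> x ` {..<i}" using less_index[of j i] z by auto
      qed
      from card_mono[OF _ this] have "m \<le> card (x ` {..<i})" unfolding inj_left by simp
      also have "\<dots> \<le> i" using card_image_le[of "{..<i}" x] by simp
      finally show False using that by simp
    qed
    show "g (x i) = 0" if i: "n - m \<le> i" "i < n" for i
    proof (rule ccontr)
      assume "g (x i) \<noteq> 0"
      then have xi: "x i \<in> E0" by (auto simp: g_def split: if_splits)
      have "(\<lambda>l. \<delta> * of_int (L - int l)) ` {..<m} \<subseteq> x ` {i<..<n}"
      proof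
        fix z assume "z \<in> (\<lambda>l. \<delta> * of_int (L - int l)) ` {..<m}"
        then have z: "z \<in> X" "x i < z" using right xi by (auto simp: X_def)
        then obtain j where "j < n" "z = x j" using index[OF z(1)] by blast
        then show "z \<in> x ` {i<..<n}" using less_index[of i j] z i by auto
      qed
      from card_mono[OF _ this] have "m \<le> card (x ` {i<..<n})" unfolding inj_left by simp
      also have "\<dots> \<le> n - Suc i" using card_image_le[of "{i<..<n}" x] by simp
      finally show False using i m by linarith
    qed
  qed (use m incr in auto)
  then show ?thesis using img sep unfolding X_def g_def by blast
qed

definition sharp_sum :: "nat \<Rightarrow> real set \<Rightarrow> (real \<Rightarrow> real) \<Rightarrow> real \<Rightarrow> ennreal" where
  "sharp_sum m E f t = (\<Sum>k\<le>m. sharp m k E f t)"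

text \<open>The integral relation in place of derivatives admits a top order that is a derivative
  only off the knots, and it passes to limits.\<close>

definition bounded_jet where
  "bounded_jet m E f C E0 D \<longleftrightarrow> (\<forall>y\<in>E0. D 0 y = f y) \<and>
    (\<forall>k\<le>m. \<forall>t. ennreal \<bar>D k t\<bar> \<le> ennreal C * sharp_sum m E f t) \<and>
    (\<forall>k<m. \<forall>u v. u \<le> v \<longrightarrow> (D (Suc k) has_integral D k v - D k u) {u..v :: real})"

lemma finite_extension:
  assumes m: "1 \<le> m"
  shows "\<exists>C>0. \<forall>E f E0. finite E0 \<longrightarrow> E0 \<noteq> {} \<longrightarrow> E0 \<subseteq> E \<longrightarrow>
    Ex (bounded_jet m E f C E0)"
proof -
  obtain M where M0: "0 \<le> M" and M: "\<And>a b t k. a < b \<Longrightarrow> a \<le> t \<Longrightarrow> t \<le> b \<Longrightarrow> k \<le> m \<Longrightarrow>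
       (b - a) ^ k * \<bar>poly ((pderiv ^^ k) (transition_on m a b)) t\<bar> \<le> M"
    using transition_bound[of m] by blast
  define \<delta> where "\<delta> = 1 / (3 * real m)"
  have \<delta>: "0 < \<delta>" using m by (simp add: \<delta>_def)
  \<comment> \<open>The cost of the zero extension for sets of at most m + 1 knots, each recursion
    step costing at most 1 + 2/\<delta>.\<close>
  define K where "K = (1 + 2 / \<delta>) ^ Suc m"
  have K: "1 \<le> K" unfolding K_def using \<delta> by (intro one_le_power) simp
  define A where "A = real m * (1 + real m) ^ m + real m * (real m * (2 * real m) ^ (m - 1) * M)"
  have A: "0 < A" unfolding A_def using m M0 by (intro add_pos_nonneg) auto
  have main: "Ex (bounded_jet m E f (A * K) E0)"
    if E0: "finite E0" "E0 \<noteq> {}" "E0 \<subseteq> E" for E f and E0 :: "real set"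
  proof -
    define g where "g y = (if y \<in> E0 then f y else 0)" for y
    have "g = (\<lambda>y. if y \<in> E0 then f y else 0)" by (simp add: fun_eq_iff g_def)
    then have "\<exists>n x Z. knots m n x g \<and> x ` {..<n} = E0 \<union> Z \<and> (\<forall>y\<in>E0. \<forall>z\<in>Z. \<delta> \<le> \<bar>y - z\<bar>)"
      using knots_exist[OF m E0(1,2), of f] by (simp only: \<delta>_def)
    then obtain n x Z where kn: "knots m n x g" and img: "x ` {..<n} = E0 \<union> Z"
      and sep0: "\<forall>y\<in>E0. \<forall>z\<in>Z. \<delta> \<le> \<bar>y - z\<bar>"
      by (elim exE conjE)
    have sep: "\<delta> \<le> \<bar>y - z\<bar>" if "y \<in> E0" "z \<in> Z" for y z using sep0 that by simp
    interpret knots m n x g by (rule kn)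
    have g0: "g z = 0" if "z \<in> Z" for z
    proof -
      have "z \<notin> E0" using sep[of z z] that \<delta> by auto
      then show ?thesis by (simp add: g_def)
    qed
    have bound: "ennreal \<bar>D k t\<bar> \<le> ennreal (A * K) * sharp_sum m E f t" if k: "k \<le> m" for k t
    \<comment> \<open>Where the sum of the sharp functions is infinite there is nothing to show;
      otherwise its value N bounds each of them at t.\<close>
    proof (cases "sharp_sum m E f t")
      case top
      then show ?thesis using A K by (simp add: ennreal_mult_top)
    next
      case (real N)
      have sh: "\<bar>dd f T\<bar> \<le> N" if T: "T \<subseteq> E0" "T \<noteq> {}" "card T \<le> m" "\<And>y. y \<in> T \<Longrightarrow> \<bar>t - y\<bar> \<le> 1" for T
      proof -
        have fin: "finite T" using T(1) E0(1) finite_subset by blast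
        then obtain k where k: "card T = Suc k" using T(2) by (metis card_0_eq not0_implies_Suc)
        obtain y where y: "y \<in> T" using T(2) by blast
        have "infdist t T \<le> 1" using infdist_le[OF y, of t] T(4)[OF y] by (simp add: dist_real_def)
        then have "ennreal \<bar>dd f T\<bar> \<le> sharp m k E f t"
          using T k E0(3) fin by (intro dd_le_sharp) auto
        also have "\<dots> \<le> sharp_sum m E f t"
          unfolding sharp_sum_def using T(3) k by (intro member_le_sum) auto
        finally show ?thesis using real by simp
      qed
      have mixed: "\<bar>dd g S\<bar> \<le> K * N"
        if S: "S \<subseteq> x ` {..<n}" "S \<noteq> {}" "card S \<le> Suc m" and b: "\<And>T. T \<subseteq> S \<inter> E0 \<Longrightarrow> T \<noteq> {} \<Longrightarrow> \<bar>dd f T\<bar> \<le> N" for S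
      proof -
        have "finite S" using S(1) finite_subset by blast
        then have "\<bar>dd g S\<bar> \<le> (1 + 2 / \<delta>) ^ card S * N"
          using dd_zero_extension_le[of \<delta> N E0 g f Z S] \<delta> real sep g0 S b img by (auto simp: g_def)
        also have "\<dots> \<le> K * N"
          unfolding K_def using S(3) \<delta> real by (intro mult_right_mono power_increasing) auto
        finally show ?thesis .
      qed
      have "\<bar>D k t\<bar> \<le> A * (K * N)"
        unfolding A_def
      proof (rule D_bound[OF M M0 _ _ _ k])
        show "0 \<le> K * N" using K real by simp
      next
        fix s r assume r: "r < m" and s: "s + m \<le> n" and t: "\<And>l. l \<in> {s..<s + m} \<Longrightarrow> \<bar>t - x l\<bar> \<le> 1"
        have card: "card (x ` {s..s + r}) \<le> Suc r" using card_image_le[of "{s..s + r}" x] by simp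
        show "\<bar>dd g (x ` {s..s + r})\<bar> \<le> K * N"
        proof (rule mixed)
          show "\<bar>dd f T\<bar> \<le> N" if T: "T \<subseteq> x ` {s..s + r} \<inter> E0" "T \<noteq> {}" for T
          proof (rule sh)
            have "card T \<le> card (x ` {s..s + r})" by (rule card_mono) (use T in auto)
            then show "card T \<le> m" using card r by simp
            show "\<bar>t - y\<bar> \<le> 1" if "y \<in> T" for y
            proof -
              have "y \<in> x ` {s..s + r}" using that T(1) by blast
              then obtain l where "l \<in> {s..s + r}" "y = x l" by blast
              then show ?thesis using t[of l] r by simp
            qed
          qed (use T in auto)
        qed (use r s card in auto)
      next
        fix j assume j: "j < n - m" and t: "x j \<le> t" "t \<le> x (j + m)"
        have near: "\<bar>t - y\<bar> \<le> 1" if "y \<in> x ` {j..j + m}" for y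
        proof -
          obtain l where "l \<in> {j..j + m}" "y = x l" using \<open>y \<in> x ` {j..j + m}\<close> by blast
          moreover have "x (j + m) - x j \<le> 1" using j by (intro window) simp
          ultimately show ?thesis using window_le[OF j, of l] t by (simp add: abs_le_iff)
        qed
        have ij: "inj_on x {j..j + m}" using j by (intro inj) auto
        have card: "card (x ` {j..j + m}) = Suc m" by (simp add: card_image[OF ij])
        show "\<bar>coef j\<bar> \<le> K * N"
          unfolding coef_def
        proof (rule mixed)
          show "\<bar>dd f T\<bar> \<le> N" if T: "T \<subseteq> x ` {j..j + m} \<inter> E0" "T \<noteq> {}" for T
          \<comment> \<open>Smaller sets are handled by the sharp functions of order below m. The
            only other case is that the whole window lies in \<open>E0\<close>; then t is in its
            hull and the order m applies with weight 1.\<close>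
          proof (cases "card T \<le> m")
            case True
            show ?thesis by (rule sh) (use T True near in auto)
          next
            case False
            have Teq: "T = x ` {j..j + m}"
              by (rule card_seteq) (use T False card in auto)
            have "Min T \<le> x j" "x (j + m) \<le> Max T" unfolding Teq by (auto intro!: Min_le Max_ge)
            then have mm: "Min T \<le> t" "t \<le> Max T" using t by linarith+
            obtain y where y: "y \<in> T" using T(2) by blast
            have "\<bar>t - y\<bar> \<le> 1" using near y T(1) by blast
            then have "infdist t T \<le> 1" using infdist_le[OF y, of t] by (simp add: dist_real_def)
            then have "ennreal \<bar>dd f T\<bar> \<le> sharp m m E f t"
              using T E0 mm m card Teq by (intro dd_le_sharp_top) auto
            also have "\<dots> \<le> sharp_sum m E f t"
              unfolding sharp_sum_def by (intro member_le_sum) auto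
            finally show ?thesis using real by simp
          qed
        qed (use j card in auto)
      qed
      then have "ennreal \<bar>D k t\<bar> \<le> ennreal (A * K * N)" by (intro ennreal_leI) (simp add: mult.assoc)
      also have "\<dots> = ennreal (A * K) * ennreal N" using A K real by (intro ennreal_mult) auto
      finally show ?thesis using real by simp
    qed
    have "D 0 y = f y" if "y \<in> E0" for y
    proof -
      have "y \<in> x ` {..<n}" using img that by blast
      then obtain i where "i < n" "y = x i" by blast
      then show ?thesis using D_interp[of i] that by (simp add: g_def)
    qed
    then have "bounded_jet m E f (A * K) E0 D"
      unfolding bounded_jet_def by (intro conjI allI impI ballI bound D_has_integral)
    then show ?thesis by blast
  qed
  show ?thesis by (intro exI[of _ "A * K"] conjI allI impI main) (use A K in auto)
qed

section \<open>Primitives and dominated increments\<close>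

lemma primitive_exists:
  fixes h :: "real \<Rightarrow> real"
  assumes h: "\<And>u v. u \<le> v \<Longrightarrow> h integrable_on {u..v}"
  obtains W where "\<And>u v. u \<le> v \<Longrightarrow> (h has_integral W v - W u) {u..v}"
proof -
  define W where "W x = integral {0..x} h - integral {x..0} h" for x
  have comb: "integral {a..b} h + integral {b..c} h = integral {a..c} h" if "a \<le> b" "b \<le> c" for a b c
    by (rule Henstock_Kurzweil_Integration.integral_combine[OF that]) (use h that in auto)
  have "W v - W u = integral {u..v} h" if "u \<le> v" for u v
  proof -
    consider "0 \<le> u" | "u < 0" "0 \<le> v" | "v < 0" by linarith
    then show ?thesis
    proof cases
      case 1
      then show ?thesis using comb[of 0 u v] that by (cases "u = 0"; cases "v = 0") (auto simp: W_def)
    next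
      case 2
      then show ?thesis using comb[of u 0 v] by (cases "v = 0") (auto simp: W_def)
    next
      case 3
      then show ?thesis using comb[of u v 0] that by (auto simp: W_def)
    qed
  qed
  then show thesis using that[of W] h by (simp add: has_integral_iff)
qed

text \<open>Split h into its truncation at height N and the rest \<open>r N\<close>. Dominated
  convergence makes the integral of the rest less than \<epsilon>/2, and the truncated part adds at
  most N times the total length of the division.\<close>

lemma locally_abs_continuous_primitive:
  assumes h: "\<And>u v. u \<le> v \<Longrightarrow> (h has_integral W v - W u) {u..v}" and nonneg: "\<And>t. 0 \<le> h t"
  shows "locally_abs_continuous W"
  unfolding locally_abs_continuous_iff
proof (intro allI impI)
  fix a b \<epsilon> :: real assume \<epsilon>: "0 < \<epsilon>"
  have ai: "h absolutely_integrable_on {u..v}" for u v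
    using h[of u v] nonneg by (cases "u \<le> v"; force intro!: nonnegative_absolutely_integrable_1)
  define r where "r n t = h t - min (h t) (real n)" for n t
  have min_int: "(\<lambda>t. min (h t) (real n)) absolutely_integrable_on {u..v}" for n u v
    by (intro absolutely_integrable_min_1 ai) (auto intro!: absolutely_integrable_continuous_real)
  have r_int: "r n integrable_on {u..v}" for n u v
    unfolding r_def using ai min_int
    by (intro integrable_diff) (auto simp: absolutely_integrable_on_def)
  have r0: "0 \<le> r n t" for n t by (simp add: r_def)
  have "(\<lambda>n. integral {a..b} (r n)) \<longlonglongrightarrow> integral {a..b} (\<lambda>t. 0)"
  proof (rule dominated_convergence(2)[where h = h])
    show "h integrable_on {a..b}" using ai by (auto simp: absolutely_integrable_on_def)
    show "norm (r n t) \<le> h t" for n t using nonneg[of t] by (simp add: r_def min_def)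
    show "(\<lambda>n. r n t) \<longlonglongrightarrow> 0" for t
    proof (rule tendsto_eventually)
      obtain N where "h t \<le> real N" using real_arch_simple by blast
      then show "eventually (\<lambda>n. r n t = 0) sequentially"
        by (intro eventually_sequentiallyI[of N]) (auto simp: r_def min_def)
    qed
  qed (rule r_int)
  then have "eventually (\<lambda>n. integral {a..b} (r n) < \<epsilon> / 2) sequentially"
    using \<epsilon> by (intro order_tendstoD(2)) auto
  then obtain N where N: "integral {a..b} (r N) < \<epsilon> / 2"
    by (auto simp: eventually_sequentially)
  define \<delta> where "\<delta> = \<epsilon> / (2 * (real N + 1))"
  have \<delta>: "0 < \<delta>" using \<epsilon> by (simp add: \<delta>_def)
  have "osc_small W a b \<delta> \<epsilon>"
  proof (rule osc_smallI)
    fix D assume D: "D division_of \<Union>D" "\<Union>D \<subseteq> {a..b}" "sum (measure lborel) D < \<delta>"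
    have osc: "osc W K \<le> integral K (r N) + real N * measure lborel K" "r N integrable_on K" if "K \<in> D" for K
    proof -
      obtain u v where K: "u \<le> v" "K = {u..v}" using \<open>K \<in> D\<close> by (rule division_memE[OF D(1)])
      have "0 \<le> W v - W u" by (rule has_integral_nonneg[OF h[OF K(1)]]) (use nonneg in auto)
      then have "osc W K = integral K h" using integral_unique[OF h[OF K(1)]] K by (simp add: osc_Icc)
      also have "\<dots> \<le> integral K (\<lambda>t. r N t + real N)"
        unfolding K(2)
        by (rule integral_le[OF has_integral_integrable[OF h[OF K(1)]] integrable_add[OF r_int]])
          (auto simp: r_def)
      also have "\<dots> = integral K (r N) + real N * measure lborel K"
        unfolding K(2) using r_int K(1) by (subst integral_add) auto
      finally show "osc W K \<le> integral K (r N) + real N * measure lborel K" .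
      show "r N integrable_on K" unfolding K(2) by (rule r_int)
    qed
    have "(r N has_integral (\<Sum>K\<in>D. integral K (r N))) (\<Union>D)"
      by (rule has_integral_combine_division[OF D(1)]) (use osc(2) in \<open>auto intro: integrable_integral\<close>)
    then have "(\<Sum>K\<in>D. integral K (r N)) \<le> integral {a..b} (r N)"
      using D(2) r_int r0 by (metis has_integral_integrable_integral integral_subset_le)
    moreover have "real N * sum (measure lborel) D \<le> real N * \<delta>"
      using D(3) by (intro mult_left_mono) auto
    moreover have "real N * \<delta> \<le> \<epsilon> / 2"
      using \<epsilon> by (simp add: \<delta>_def field_simps)
    moreover have "sum (osc W) D \<le> (\<Sum>K\<in>D. integral K (r N)) + real N * sum (measure lborel) D"
      using sum_mono[of D "osc W" "\<lambda>K. integral K (r N) + real N * measure lborel K"] osc(1)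
      by (simp add: sum.distrib sum_distrib_left)
    ultimately show "sum (osc W) D < \<epsilon>" using N by linarith
  qed
  then show "\<exists>\<delta>>0. osc_small W a b \<delta> \<epsilon>"
    using \<delta> by blast
qed

lemma mono_DERIV_nonneg:
  fixes f :: "real \<Rightarrow> real"
  assumes f: "\<And>u v. u \<le> v \<Longrightarrow> f u \<le> f v" and d: "(f has_real_derivative d) (at x)"
  shows "0 \<le> d"
proof (rule ccontr)
  assume "\<not> 0 \<le> d"
  then obtain e where "0 < e" "\<And>h. 0 < h \<Longrightarrow> h < e \<Longrightarrow> f (x + h) < f x"
    using DERIV_neg_dec_right[OF d] by auto
  then have "f (x + e / 2) < f x" by simp
  then show False using f[of x "x + e / 2"] \<open>0 < e\<close> by simp
qed

text \<open>W - G and W + G are both nondecreasing, so their derivatives are nonnegative.\<close>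

lemma dominated_DERIV_le:
  fixes G W :: "real \<Rightarrow> real"
  assumes G: "\<And>u v. u \<le> v \<Longrightarrow> \<bar>G v - G u\<bar> \<le> W v - W u"
    and d: "(G has_real_derivative a) (at x)" "(W has_real_derivative b) (at x)"
  shows "\<bar>a\<bar> \<le> b"
proof -
  have "0 \<le> b - a"
  proof (rule mono_DERIV_nonneg[OF _ DERIV_diff[OF d(2,1)]])
    show "W u - G u \<le> W v - G v" if "u \<le> v" for u v using G[OF that] by linarith
  qed
  moreover have "0 \<le> b + a"
  proof (rule mono_DERIV_nonneg[OF _ DERIV_add[OF d(2,1)]])
    show "W u + G u \<le> W v + G v" if "u \<le> v" for u v using G[OF that] by linarith
  qed
  ultimately show ?thesis by linarith
qed

lemma has_integral_DERIV:
  fixes f F :: "real \<Rightarrow> real"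
  assumes int: "\<And>u v. u \<le> v \<Longrightarrow> (f has_integral F v - F u) {u..v}" and cont: "continuous_on UNIV f"
  shows "(F has_real_derivative f t) (at t)"
proof -
  have "((\<lambda>x. integral {t - 1..x} f) has_real_derivative f t) (at t within {t - 1..t + 1})"
    by (rule integral_has_real_derivative) (use continuous_on_subset[OF cont] in auto)
  then have "((\<lambda>x. integral {t - 1..x} f) has_real_derivative f t) (at t)"
    by (simp add: at_within_Icc_at)
  from DERIV_add[OF DERIV_const[of "F (t - 1)"] this]
  have "((\<lambda>x. F (t - 1) + integral {t - 1..x} f) has_real_derivative f t) (at t)" by simp
  then show ?thesis
    by (rule has_field_derivative_transform_within_open[where S = "{t - 1<..<t + 1}"])
      (use integral_unique[OF int] in auto)
qed

text \<open>From t \<le> 1 + t^p, where the 1 is integrable over a bounded interval.\<close>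

lemma Lp_norm_finite_locally_integrable:
  assumes H[measurable]: "H \<in> borel_measurable borel" and p: "1 \<le> p" and fin: "Lp_norm p H < \<infinity>"
  shows "AE t in lborel. H t \<noteq> \<infinity>"
    and "(\<integral>\<^sup>+ t. H t * indicator {u..v} t \<partial>lborel) < \<infinity>"
proof -
  have int: "(\<integral>\<^sup>+ t. ennreal_powr (H t) p \<partial>lborel) < \<infinity>"
    using fin unfolding Lp_norm_finite_iff nn_integral_completion .
  then have "AE t in lborel. ennreal_powr (H t) p \<noteq> \<infinity>"
    by (intro nn_integral_PInf_AE) auto
  then show "AE t in lborel. H t \<noteq> \<infinity>"
    by eventually_elim (auto simp: ennreal_powr_def)
  have le: "H t \<le> 1 + ennreal_powr (H t) p" for t
  proof (cases "H t")
    case (real r)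
    have "r \<le> 1 + r powr p"
    proof (cases "r \<le> 1")
      case False
      then have "r powr 1 \<le> r powr p" using p by (intro powr_mono) auto
      then show ?thesis using False by simp
    qed (simp add: add_increasing2)
    then have "ennreal r \<le> ennreal (1 + r powr p)" by (rule ennreal_leI)
    also have "\<dots> = 1 + ennreal (r powr p)"
      using ennreal_plus[of 1 "r powr p"] by simp
    finally show ?thesis using real by (simp add: ennreal_powr_ennreal)
  qed (simp add: ennreal_powr_def)
  have "(\<integral>\<^sup>+ t. H t * indicator {u..v} t \<partial>lborel) \<le> (\<integral>\<^sup>+ t. indicator {u..v} t + ennreal_powr (H t) p \<partial>lborel)"
    using le by (intro nn_integral_mono) (auto simp: indicator_def)
  also have "\<dots> = emeasure lborel {u..v} + (\<integral>\<^sup>+ t. ennreal_powr (H t) p \<partial>lborel)"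
    by (subst nn_integral_add) auto
  also have "\<dots> < \<infinity>" using int by (cases "u \<le> v") (auto simp: ennreal_add_less_top)
  finally show "(\<integral>\<^sup>+ t. H t * indicator {u..v} t \<partial>lborel) < \<infinity>" .
qed

text \<open>The common modulus of continuity W spreads convergence from the rationals to every
  point.\<close>

lemma Cauchy_of_dense:
  fixes g :: "nat \<Rightarrow> real \<Rightarrow> real"
  assumes W: "continuous_on UNIV W" and g: "\<And>n u v. u \<le> v \<Longrightarrow> \<bar>g n v - g n u\<bar> \<le> W v - (W u :: real)"
    and conv: "\<And>q. q \<in> \<rat> \<Longrightarrow> convergent (\<lambda>n. g n q)"
  shows "convergent (\<lambda>n. g n t)"
proof -
  have "Cauchy (\<lambda>n. g n t)"
  proof (rule metric_CauchyI)
    fix e :: real assume e: "0 < e"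
    have "isCont W t" using W by (simp add: continuous_on_eq_continuous_at)
    then obtain d where d: "0 < d" "\<And>s. \<bar>s - t\<bar> < d \<Longrightarrow> \<bar>W s - W t\<bar> < e / 3"
      using e unfolding continuous_at_eps_delta dist_real_def by (metis divide_pos_pos zero_less_numeral)
    obtain q where q: "q \<in> \<rat>" "t < q" "q < t + d" using Rats_dense_in_real[of t "t + d"] d(1) by auto
    have near: "\<bar>g n q - g n t\<bar> < e / 3" for n
      using g[of t q n] d(2)[of q] q by (simp add: abs_less_iff)
    have "Cauchy (\<lambda>n. g n q)" using conv[OF q(1)] by (rule convergent_Cauchy)
    then obtain M where M: "\<And>i j. M \<le> i \<Longrightarrow> M \<le> j \<Longrightarrow> dist (g i q) (g j q) < e / 3"
      using e unfolding Cauchy_def by (meson divide_pos_pos zero_less_numeral)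
    have "dist (g i t) (g j t) < e" if "M \<le> i" "M \<le> j" for i j
      using M[OF that] near[of i] near[of j] unfolding dist_real_def by linarith
    then show "\<exists>M. \<forall>i\<ge>M. \<forall>j\<ge>M. dist (g i t) (g j t) < e" by blast
  qed
  then show ?thesis by (rule Cauchy_convergent)
qed

section \<open>Passage to the limit\<close>

text \<open>An Arzela-Ascoli argument for the orders below m, with the primitive W of C H as common
  modulus. The derivatives of order m need not converge; the limit of order m - 1 inherits
  increments dominated by those of W, and this bounds its derivative by W' = C H almost
  everywhere.\<close>

lemma limit_extension:
  assumes m: "1 \<le> m" and p: "1 < p" and E: "E \<noteq> {}" and C: "0 < C"
    and fin: "Lp_norm p (sharp_sum m E f) < \<infinity>"
    and extend: "\<And>E0. finite E0 \<Longrightarrow> E0 \<noteq> {} \<Longrightarrow> E0 \<subseteq> E \<Longrightarrow>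
      Ex (bounded_jet m E f C E0)"
  shows "\<exists>F \<in> extensions m p E f. \<forall>k\<le>m. AE t in lebesgue. ennreal \<bar>(deriv ^^ k) F t\<bar> \<le> ennreal C * sharp_sum m E f t"
proof -
  define H where "H = sharp_sum m E f"
  have Hm[measurable]: "H \<in> borel_measurable borel"
    unfolding H_def sharp_sum_def using borel_measurable_sharp[OF m] by (intro borel_measurable_sum)
  have H_AE: "AE t in lborel. H t \<noteq> \<infinity>"
    using Lp_norm_finite_locally_integrable(1)[OF Hm, of p] p fin by (simp add: H_def)
  have H_int: "(\<integral>\<^sup>+ t. H t * indicator {u..v} t \<partial>lborel) < \<infinity>" for u v
    using Lp_norm_finite_locally_integrable(2)[OF Hm, of p u v] p fin by (simp add: H_def)
  define N where "N = {t. H t = \<infinity>}"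
  have N: "negligible N"
  proof -
    have "AE t in lebesgue. t \<notin> N" using H_AE by (simp add: N_def AE_completion_iff)
    then show ?thesis by (simp add: negligible_iff_null_sets AE_iff_null_sets completion.AE_iff_null_sets eventually_ae_filter N_def)
  qed
  \<comment> \<open>On \<open>N\<close> the value of \<open>enn2real\<close> is 0, so
    \<open>h\<close> represents C H off \<open>N\<close> only. For this reason the derivatives are
    set to 0 on \<open>N\<close> (as \<open>D'\<close>) before they are compared with
    \<open>h\<close>.\<close>
  define h where "h t = C * enn2real (H t)" for t
  have h0: "0 \<le> h t" for t using C by (simp add: h_def)
  have hH: "ennreal C * H t = ennreal (h t)" if "t \<notin> N" for t
    using that C by (cases "H t") (auto simp: h_def N_def ennreal_mult)
  have hm[measurable]: "h \<in> borel_measurable borel" unfolding h_def by measurable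
  have h_int: "h integrable_on {u..v}" for u v
  proof -
    have "(\<integral>\<^sup>+ t. ennreal (h t * indicator {u..v} t) \<partial>lborel) \<le> (\<integral>\<^sup>+ t. ennreal C * (H t * indicator {u..v} t) \<partial>lborel)"
    proof (rule nn_integral_mono)
      fix t
      have "ennreal (h t) \<le> ennreal C * H t"
        using C by (cases "H t") (auto simp: h_def ennreal_mult ennreal_mult_top)
      then show "ennreal (h t * indicator {u..v} t) \<le> ennreal C * (H t * indicator {u..v} t)"
        by (simp add: indicator_def)
    qed
    also have "\<dots> < \<infinity>" using H_int[of u v] by (simp add: nn_integral_cmult ennreal_mult_less_top)
    finally have "(\<lambda>t. h t * indicator {u..v} t) integrable_on UNIV"
      using h0 by (intro nn_integral_integrable_on) auto
    moreover have "(\<lambda>t. h t * indicator {u..v} t) = (\<lambda>t. if t \<in> {u..v} then h t else 0)" by (auto simp: indicator_def)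
    ultimately show ?thesis by (simp only: integrable_restrict_UNIV)
  qed
  obtain W where W: "\<And>u v. u \<le> v \<Longrightarrow> (h has_integral W v - W u) {u..v}"
    by (rule primitive_exists[OF h_int]) blast
  have W_ac: "locally_abs_continuous W" by (rule locally_abs_continuous_primitive[OF W h0])
  then have W_cont: "continuous_on UNIV W" by (rule locally_abs_continuous_imp_continuous)
  note good_def = bounded_jet_def[of m E f C, folded H_def]
  have incr: "\<bar>D k v - D k u\<bar> \<le> W v - W u" if D: "bounded_jet m E f C E0 D" and k: "k < m" and uv: "u \<le> v" for E0 D k u v
  proof -
    define D' where "D' t = (if t \<in> N then 0 else D (Suc k) t)" for t
    have "(D (Suc k) has_integral D k v - D k u) {u..v}" using D k uv by (simp add: good_def)
    then have D': "(D' has_integral D k v - D k u) {u..v}"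
      by (rule has_integral_spike[OF N, rotated]) (simp add: D'_def)
    have "norm (D' t) \<le> h t" for t
    proof (cases "t \<in> N")
      case False
      have "ennreal \<bar>D (Suc k) t\<bar> \<le> ennreal (h t)" using D k hH[OF False] unfolding good_def by (metis Suc_leI)
      then show ?thesis using False h0 by (simp add: D'_def)
    qed (simp add: D'_def h0)
    then have "norm (integral {u..v} D') \<le> integral {u..v} h"
      using D' h_int by (intro Henstock_Kurzweil_Integration.integral_norm_bound_integral) auto
    then show ?thesis using integral_unique[OF D'] integral_unique[OF W[OF uv]] by simp
  qed
  have incr': "\<bar>D k v - D k u\<bar> \<le> \<bar>W v - W u\<bar>" if "bounded_jet m E f C E0 D" "k < m" for E0 D k u v
    using incr[OF that, of u v] incr[OF that, of v u] by (cases "u \<le> v") auto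
  \<comment> \<open>A base point at which H is finite bounds all jets there; the modulus W spreads
    this to the locally bounded majorant \<open>b\<close>, which is independent of the finite
    set.\<close>
  obtain t0 where t0: "t0 \<notin> N"
    using N by (metis UNIV_eq_I non_negligible_UNIV)
  define b where "b t = h t0 + \<bar>W t - W t0\<bar>" for t
  have b0: "0 \<le> b t" for t using h0 by (simp add: b_def)
  have b_cont: "continuous_on S b" for S
    unfolding b_def by (intro continuous_intros continuous_on_subset[OF W_cont]) auto
  have bound: "\<bar>D k t\<bar> \<le> b t" if D: "bounded_jet m E f C E0 D" and k: "k < m" for E0 D k t
  proof -
    have "ennreal \<bar>D k t0\<bar> \<le> ennreal (h t0)" using D k hH[OF t0] unfolding good_def by (metis less_imp_le)
    then have "\<bar>D k t0\<bar> \<le> h t0" using h0 by simp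
    then show ?thesis using incr'[OF D k, of t t0] unfolding b_def by linarith
  qed
  obtain T where T: "countable T" "T \<subseteq> E" "E \<subseteq> closure T" by (rule separable)
  have T_ne: "T \<noteq> {}" using T(3) E by auto
  define En where "En n = from_nat_into T ` {..n}" for n :: nat
  have "\<exists>D. bounded_jet m E f C (En n) D" for n
    by (rule extend) (use T(2) from_nat_into[OF T_ne] in \<open>auto simp: En_def\<close>)
  then have "\<forall>n. \<exists>D. bounded_jet m E f C (En n) D" by blast
  from choice[OF this] obtain D where "\<forall>n. bounded_jet m E f C (En n) (D n)" by (rule exE)
  then have D: "bounded_jet m E f C (En n) (D n)" for n by blast
  \<comment> \<open>The diagonal selection runs over pairs of an order and a rational point;
    division by 1 + b makes all values at most 1 in absolute value.\<close>
  define S where "S = {..<m} \<times> (\<rat> :: real set)"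
  have "countable S" unfolding S_def by (intro countable_SIGMA countable_finite countable_rat) auto
  moreover have "norm (D n (fst z) (snd z) / (1 + b (snd z))) \<le> 1" if "z \<in> S" for n z
  proof -
    have "\<bar>D n (fst z) (snd z)\<bar> \<le> 1 + b (snd z)" using bound[OF D, of "fst z" n "snd z"] that by (auto simp: S_def)
    then show ?thesis using b0[of "snd z"] by (simp add: divide_le_eq_1)
  qed
  ultimately obtain r where r: "strict_mono (r :: nat \<Rightarrow> nat)"
    "\<And>z. z \<in> S \<Longrightarrow> \<exists>l. (\<lambda>n. D (r n) (fst z) (snd z) / (1 + b (snd z))) \<longlonglongrightarrow> l"
    using function_convergent_subsequence[of S "\<lambda>n z. D n (fst z) (snd z) / (1 + b (snd z))" 1] by metis
  have conv: "convergent (\<lambda>n. D (r n) k t)" if k: "k < m" for k t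
  proof (rule Cauchy_of_dense[OF W_cont incr[OF D k]])
    fix q :: real assume "q \<in> \<rat>"
    then obtain l where "(\<lambda>n. D (r n) k q / (1 + b q)) \<longlonglongrightarrow> l" using r(2)[of "(k, q)"] k by (auto simp: S_def)
    then have "(\<lambda>n. D (r n) k q / (1 + b q) * (1 + b q)) \<longlonglongrightarrow> l * (1 + b q)" by (rule tendsto_mult_right)
    then show "convergent (\<lambda>n. D (r n) k q)" using b0[of q] by (auto simp: convergent_def)
  qed
  define L where "L k t = lim (\<lambda>n. D (r n) k t)" for k t
  have L: "(\<lambda>n. D (r n) k t) \<longlonglongrightarrow> L k t" if "k < m" for k t
    unfolding L_def using conv[OF that] by (simp add: convergent_LIMSEQ_iff)
  have L_incr: "\<bar>L k v - L k u\<bar> \<le> W v - W u" if "k < m" "u \<le> v" for k u v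
    by (rule tendsto_upperbound[OF tendsto_rabs[OF tendsto_diff[OF L[OF that(1)] L[OF that(1)]]]])
      (use incr[OF D that] in auto)
  have L_ac: "locally_abs_continuous (L k)" if "k < m" for k
    by (rule locally_abs_continuous_dominated[OF W_ac W_ac]) (use L_incr[OF that] in fastforce)
  have L_cont: "continuous_on UNIV (L k)" if "k < m" for k
    by (rule locally_abs_continuous_imp_continuous[OF L_ac[OF that]])
  have L_bound: "ennreal \<bar>L k t\<bar> \<le> ennreal C * H t" if "k < m" for k t
  proof (rule tendsto_upperbound)
    show "(\<lambda>n. ennreal \<bar>D (r n) k t\<bar>) \<longlonglongrightarrow> ennreal \<bar>L k t\<bar>"
      by (intro tendsto_ennrealI tendsto_rabs L that)
    show "eventually (\<lambda>n. ennreal \<bar>D (r n) k t\<bar> \<le> ennreal C * H t) sequentially"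
      using D that by (auto simp: good_def)
  qed simp
  \<comment> \<open>Both sides converge, the integrals by dominated convergence with the continuous
    majorant \<open>b\<close>.\<close>
  have L_integral: "(L (Suc k) has_integral L k v - L k u) {u..v}" if k: "Suc k < m" and uv: "u \<le> v" for k u v
  proof -
    have Dint: "(D (r n) (Suc k) has_integral D (r n) k v - D (r n) k u) {u..v}" for n
      using D[of "r n"] k uv by (simp add: good_def)
    have lim: "(\<lambda>n. integral {u..v} (D (r n) (Suc k))) \<longlonglongrightarrow> integral {u..v} (L (Suc k))"
    proof (rule dominated_convergence(2)[where h = b])
      show "D (r n) (Suc k) integrable_on {u..v}" for n using Dint by blast
      show "b integrable_on {u..v}" by (rule integrable_continuous_real[OF b_cont])
      show "norm (D (r n) (Suc k) t) \<le> b t" for n t using bound[OF D k] by simp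
      show "(\<lambda>n. D (r n) (Suc k) t) \<longlonglongrightarrow> L (Suc k) t" for t by (rule L[OF k])
    qed
    have "(\<lambda>n. integral {u..v} (D (r n) (Suc k))) \<longlonglongrightarrow> L k v - L k u"
      unfolding integral_unique[OF Dint] using k by (intro tendsto_diff L) auto
    then have "integral {u..v} (L (Suc k)) = L k v - L k u" using lim by (rule LIMSEQ_unique[rotated])
    moreover have "L (Suc k) integrable_on {u..v}"
      by (rule integrable_continuous_real[OF continuous_on_subset[OF L_cont[OF k]]]) simp
    ultimately show ?thesis by (simp add: has_integral_iff)
  qed
  have L_DERIV: "(L k has_real_derivative L (Suc k) t) (at t)" if "Suc k < m" for k t
    by (rule has_integral_DERIV[OF L_integral[OF that] L_cont[OF that]])
  have deriv_L: "(deriv ^^ k) (L 0) = L k" if "k < m" for k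
    using that
  proof (induction k)
    case (Suc k)
    then have "(deriv ^^ Suc k) (L 0) = deriv (L k)" by simp
    also have "\<dots> = L (Suc k)" by (intro ext DERIV_imp_deriv L_DERIV Suc.prems)
    finally show ?case .
  qed simp
  let ?G = "L (m - 1)"
  have m1: "m - 1 < m" using m by simp
  obtain g where g: "g \<in> borel_measurable borel" "AE t in lebesgue. (?G has_real_derivative g t) (at t)"
    by (rule locally_abs_continuous_ftc[OF L_ac[OF m1]]) blast
  have "(deriv ^^ m) (L 0) = deriv ((deriv ^^ (m - 1)) (L 0))" using m by (cases m) auto
  then have top: "(deriv ^^ m) (L 0) = deriv ?G" by (simp only: deriv_L[OF m1])
  have g_eq: "AE t in lebesgue. (deriv ^^ m) (L 0) t = g t"
    using g(2) unfolding top by eventually_elim (rule DERIV_imp_deriv)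
  \<comment> \<open>At almost every t both W and the limit of order m - 1 are differentiable, so the
    domination of increments passes to the derivatives.\<close>
  have "AE t in lebesgue. (W has_real_derivative h t) (at t)" by (rule lebesgue_differentiation[OF W])
  then have g_le: "AE t in lebesgue. \<bar>g t\<bar> \<le> h t"
    using g(2) by eventually_elim (rule dominated_DERIV_le[OF L_incr[OF m1]])
  have AE_bound: "AE t in lebesgue. ennreal \<bar>(deriv ^^ k) (L 0) t\<bar> \<le> ennreal C * H t" if "k \<le> m" for k
  proof (cases "k < m")
    case True
    then show ?thesis using L_bound deriv_L by simp
  next
    case False
    then have k: "k = m" using that by simp
    have "AE t in lebesgue. t \<notin> N" using H_AE by (simp add: N_def AE_completion_iff)
    then show ?thesis
      unfolding k using g_eq g_le
    proof eventually_elim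
      case (elim t)
      then show ?case using hH[of t] h0[of t] by (simp add: ennreal_leI)
    qed
  qed
  have meas: "(deriv ^^ k) (L 0) \<in> borel_measurable lebesgue" if "k \<le> m" for k
  proof (cases "k < m")
    case True
    have "L k \<in> borel_measurable borel" by (rule borel_measurable_continuous_onI[OF L_cont[OF True]])
    then show ?thesis using deriv_L[OF True] by (simp add: measurable_completion)
  next
    case False
    then have k: "k = m" using that by simp
    have "g \<in> borel_measurable lebesgue" using g(1) by (simp add: measurable_completion)
    moreover have "AE t in lebesgue. g t = (deriv ^^ m) (L 0) t" using g_eq by eventually_elim simp
    ultimately show ?thesis unfolding k by (rule borel_measurable_AE)
  qed
  have norm_fin: "Lp_norm p (\<lambda>t. ennreal \<bar>(deriv ^^ k) (L 0) t\<bar>) < \<infinity>" if "k \<le> m" for k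
  proof -
    have Hl: "H \<in> borel_measurable lebesgue" using Hm by (simp add: measurable_completion)
    have "Lp_norm p (\<lambda>t. ennreal \<bar>(deriv ^^ k) (L 0) t\<bar>) \<le> Lp_norm p (\<lambda>t. ennreal C * H t)"
      by (rule Lp_norm_mono_AE[OF _ AE_bound[OF that]]) (use p in simp)
    also have "\<dots> = ennreal C * Lp_norm p H" by (rule Lp_norm_cmult[OF Hl]) (use p in simp)
    also have "\<dots> < \<infinity>" using fin by (simp add: H_def ennreal_mult_less_top)
    finally show ?thesis .
  qed
  have sob: "L 0 \<in> sobolev m p"
    unfolding sobolev_def
  proof (intro CollectI conjI allI impI)
    show "(deriv ^^ k) (L 0) differentiable_on UNIV" if "Suc k < m" for k
      using L_DERIV[OF that] deriv_L[of k] that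
      by (auto simp: differentiable_on_def real_differentiable_def)
    show "locally_abs_continuous ((deriv ^^ (m - 1)) (L 0))" using L_ac[OF m1] deriv_L[OF m1] by simp
    show "(deriv ^^ k) (L 0) \<in> Lp_real p" if "k \<le> m" for k
      using meas[OF that] norm_fin[OF that] by (simp add: Lp_real_def)
  qed
  have "L 0 y = f y" if y: "y \<in> T" for y
  proof -
    obtain i where i: "from_nat_into T i = y" using from_nat_into_surj[OF T(1) y] by blast
    have "D (r n) 0 y = f y" if "i \<le> n" for n
    proof -
      have "n \<le> r n" using r(1) by (rule strict_mono_imp_increasing)
      then have "y \<in> En (r n)" using i that by (auto simp: En_def)
      then show ?thesis using D[of "r n"] by (simp add: good_def)
    qed
    then have "(\<lambda>n. D (r n) 0 y) \<longlonglongrightarrow> f y"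
      by (intro tendsto_eventually eventually_sequentiallyI[of i])
    then show ?thesis using LIMSEQ_unique[OF L[of 0 y]] m by simp
  qed
  note L_T = this
  \<comment> \<open>Continuity of f on E is not given. Applied to the two points y and z, the finite
    extension shows that f has modulus W on E, so the values on the dense set \<open>T\<close>
    determine those on E.\<close>
  have L_E: "L 0 y = f y" if y: "y \<in> E" for y
  proof -
    have "\<bar>L 0 y - f y\<bar> \<le> 2 * e" if e: "0 < e" for e
    proof -
      have "isCont W y" using W_cont by (simp add: continuous_on_eq_continuous_at)
      then obtain d where d: "0 < d" "\<And>s. \<bar>s - y\<bar> < d \<Longrightarrow> \<bar>W s - W y\<bar> < e"
        using e unfolding continuous_at_eps_delta dist_real_def by blast
      have "y \<in> closure T" using T(3) y by blast
      then obtain z where z: "z \<in> T" "\<bar>z - y\<bar> < d"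
        using d(1) unfolding closure_approachable dist_real_def by blast
      obtain D' where D': "bounded_jet m E f C {y, z} D'" using extend[of "{y, z}"] y z(1) T(2) by blast
      have "\<bar>f z - f y\<bar> \<le> \<bar>W z - W y\<bar>" using incr'[OF D', of 0 z y] D' m by (simp add: good_def)
      moreover have "\<bar>L 0 z - L 0 y\<bar> \<le> \<bar>W z - W y\<bar>"
        using L_incr[of 0 y z] L_incr[of 0 z y] m by (cases "y \<le> z") auto
      ultimately show ?thesis using d(2)[OF z(2)] L_T[OF z(1)] by linarith
    qed
    then have "\<bar>L 0 y - f y\<bar> \<le> e" if "0 < e" for e using that[THEN half_gt_zero] by fastforce
    then have "\<bar>L 0 y - f y\<bar> \<le> 0" by (rule field_le_epsilon) simp
    then show ?thesis by simp
  qed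
  show ?thesis
    by (rule bexI[of _ "L 0"]) (use AE_bound sob L_E in \<open>auto simp: H_def extensions_def\<close>)
qed

section \<open>The main theorem\<close>

lemma sharp_sum_norm_le:
  assumes m: "1 \<le> m" and p: "0 < p"
  shows "Lp_norm p (sharp_sum m E f) \<le> ennreal (real (m + 1) * real (m + 1) powr (1 / p)) * (\<Sum>k\<le>m. Lp_norm p (sharp m k E f))"
proof -
  have "sharp m k E f \<in> borel_measurable lebesgue" for k
    using borel_measurable_sharp[OF m] by (simp add: measurable_completion)
  then have "Lp_norm p (sharp_sum m E f) \<le> of_nat (card {..m}) * ennreal_powr (of_nat (card {..m})) (1 / p) * (\<Sum>k\<le>m. Lp_norm p (sharp m k E f))"
    unfolding sharp_sum_def using p by (intro Lp_norm_sum_le) auto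
  also have "of_nat (card {..m}) * ennreal_powr (of_nat (card {..m})) (1 / p) = ennreal (real (m + 1) * real (m + 1) powr (1 / p))"
  proof -
    have "(of_nat (card {..m}) :: ennreal) = ennreal (real (m + 1))" by (simp flip: ennreal_of_nat_eq_real_of_nat)
    then show ?thesis by (simp only: ennreal_powr_ennreal of_nat_0_le_iff ennreal_mult powr_ge_zero)
  qed
  finally show ?thesis .
qed

lemma sharp_imp_extension:
  assumes m: "1 \<le> m" and p: "1 < p"
  shows "\<exists>C\<ge>1. \<forall>E f. E \<noteq> {} \<longrightarrow> (\<forall>k\<le>m. sharp m k E f \<in> Lp_ennreal p) \<longrightarrow>
    (\<exists>F \<in> extensions m p E f. sobolev_norm m p F \<le> ennreal C * (\<Sum>k\<le>m. Lp_norm p (sharp m k E f)))"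
proof -
  obtain A where A: "0 < A" and fe: "\<forall>E f E0. finite E0 \<longrightarrow> E0 \<noteq> {} \<longrightarrow> E0 \<subseteq> E \<longrightarrow>
    Ex (bounded_jet m E f A E0)"
    using finite_extension[OF m] by (elim exE conjE)
  define B where "B = real (m + 1) * real (m + 1) powr (1 / p)"
  define C where "C = max 1 (real (m + 1) * (A * B))"
  have "\<exists>F \<in> extensions m p E f. sobolev_norm m p F \<le> ennreal C * (\<Sum>k\<le>m. Lp_norm p (sharp m k E f))"
    if E: "E \<noteq> {}" and sh: "\<forall>k\<le>m. sharp m k E f \<in> Lp_ennreal p" for E f
  proof -
    define Z where "Z = (\<Sum>k\<le>m. Lp_norm p (sharp m k E f))"
    have H: "Lp_norm p (sharp_sum m E f) \<le> ennreal B * Z"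
      unfolding B_def Z_def using p by (intro sharp_sum_norm_le m) simp
    have "Z < \<infinity>" unfolding Z_def using sh by (simp add: Lp_ennreal_def)
    then have "ennreal B * Z < \<infinity>" by (simp add: ennreal_mult_less_top)
    then have fin: "Lp_norm p (sharp_sum m E f) < \<infinity>" by (rule le_less_trans[OF H])
    obtain F where F: "F \<in> extensions m p E f"
      and b: "\<forall>k\<le>m. AE t in lebesgue. ennreal \<bar>(deriv ^^ k) F t\<bar> \<le> ennreal A * sharp_sum m E f t"
      using limit_extension[OF m p E A fin fe[rule_format]] by blast
    have Hm: "sharp_sum m E f \<in> borel_measurable lebesgue"
      unfolding sharp_sum_def using borel_measurable_sharp[OF m]
      by (intro borel_measurable_sum) (simp add: measurable_completion)
    have "Lp_norm p (\<lambda>t. ennreal \<bar>(deriv ^^ k) F t\<bar>) \<le> ennreal (A * B) * Z" if "k \<le> m" for k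
    proof -
      have "Lp_norm p (\<lambda>t. ennreal \<bar>(deriv ^^ k) F t\<bar>) \<le> Lp_norm p (\<lambda>t. ennreal A * sharp_sum m E f t)"
        by (rule Lp_norm_mono_AE) (use p b that in auto)
      also have "\<dots> = ennreal A * Lp_norm p (sharp_sum m E f)"
        by (rule Lp_norm_cmult[OF Hm]) (use p in simp)
      also have "\<dots> \<le> ennreal A * (ennreal B * Z)" by (rule mult_left_mono[OF H]) simp
      also have "\<dots> = ennreal (A * B) * Z" using A by (simp add: B_def ennreal_mult mult.assoc)
      finally show ?thesis .
    qed
    then have "sobolev_norm m p F \<le> (\<Sum>k\<le>m. ennreal (A * B) * Z)"
      unfolding sobolev_norm_def by (intro sum_mono) auto
    also have "\<dots> = ennreal (real (m + 1)) * (ennreal (A * B) * Z)"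
      by (simp add: ennreal_of_nat_eq_real_of_nat)
    also have "\<dots> = ennreal (real (m + 1) * (A * B)) * Z"
      using A by (subst ennreal_mult) (auto simp: B_def mult.assoc)
    also have "\<dots> \<le> ennreal C * Z"
      by (intro mult_right_mono ennreal_leI) (auto simp: C_def)
    finally show ?thesis using F unfolding Z_def by blast
  qed
  then show ?thesis by (intro exI[of _ C]) (auto simp: C_def)
qed

theorem theorem1p5:
  fixes m :: nat and p :: real
  assumes "1 \<le> m" and "1 < p"
  shows "(\<forall>(E :: real set) (f :: real \<Rightarrow> real). closed E \<and> E \<noteq> {} \<longrightarrow>
            (f \<in> trace_space m p E \<longleftrightarrow> (\<forall>k\<le>m. sharp m k E f \<in> Lp_ennreal p))) \<and>
         (\<exists>C::real. C \<ge> 1 \<and>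
            (\<forall>(E :: real set) (f :: real \<Rightarrow> real). closed E \<and> E \<noteq> {} \<and> f \<in> trace_space m p E \<longrightarrow>
               trace_norm m p E f \<le> ennreal C * (\<Sum>k\<le>m. Lp_norm p (sharp m k E f)) \<and>
               (\<Sum>k\<le>m. Lp_norm p (sharp m k E f)) \<le> ennreal C * trace_norm m p E f))"
proof -
  obtain A where A: "1 \<le> A" and sharp_le: "\<forall>E f. \<forall>F \<in> extensions m p E f. \<forall>k\<le>m.
      Lp_norm p (sharp m k E f) \<le> ennreal A * sobolev_norm m p F"
    using sharp_norm_le[OF assms] by (elim exE conjE)
  obtain B where B: "1 \<le> B" and extend: "\<forall>E f. E \<noteq> {} \<longrightarrow> (\<forall>k\<le>m. sharp m k E f \<in> Lp_ennreal p) \<longrightarrow>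
      (\<exists>F \<in> extensions m p E f. sobolev_norm m p F \<le> ennreal B * (\<Sum>k\<le>m. Lp_norm p (sharp m k E f)))"
    using sharp_imp_extension[OF assms] by (elim exE conjE)
  have finite_norm: "sobolev_norm m p F < \<infinity>" if "F \<in> sobolev m p" for F
    using that by (simp add: sobolev_norm_def sobolev_def Lp_real_def)
  have sharp_Lp: "sharp m k E f \<in> Lp_ennreal p" if f: "f \<in> trace_space m p E" and k: "k \<le> m" for E f k
  proof -
    obtain F where F: "F \<in> extensions m p E f" using f by (auto simp: trace_space_def)
    have "Lp_norm p (sharp m k E f) \<le> ennreal A * sobolev_norm m p F" using sharp_le F k by blast
    also have "\<dots> < \<infinity>" using finite_norm[of F] F by (simp add: extensions_def ennreal_mult_less_top)
    finally show ?thesis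
      using borel_measurable_sharp[OF assms(1)] by (simp add: Lp_ennreal_def measurable_completion)
  qed
  define C where "C = max B (real (m + 1) * A)"
  have "trace_norm m p E f \<le> ennreal C * (\<Sum>k\<le>m. Lp_norm p (sharp m k E f)) \<and>
      (\<Sum>k\<le>m. Lp_norm p (sharp m k E f)) \<le> ennreal C * trace_norm m p E f"
    if E: "E \<noteq> {}" and f: "f \<in> trace_space m p E" for E f
  proof
    obtain F where F: "F \<in> extensions m p E f"
      "sobolev_norm m p F \<le> ennreal B * (\<Sum>k\<le>m. Lp_norm p (sharp m k E f))"
      using extend E sharp_Lp[OF f] by blast
    have "trace_norm m p E f \<le> sobolev_norm m p F"
      unfolding trace_norm_def using F(1) by (rule INF_lower)
    also note F(2)
    also have "ennreal B * (\<Sum>k\<le>m. Lp_norm p (sharp m k E f)) \<le> ennreal C * (\<Sum>k\<le>m. Lp_norm p (sharp m k E f))"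
      by (intro mult_right_mono ennreal_leI) (auto simp: C_def)
    finally show "trace_norm m p E f \<le> ennreal C * (\<Sum>k\<le>m. Lp_norm p (sharp m k E f))" .
    have C0: "0 < C" using B by (simp add: C_def)
    \<comment> \<open>With the constant moved to the left, the estimate for each extension passes to
      the infimum.\<close>
    have "(\<Sum>k\<le>m. Lp_norm p (sharp m k E f)) / ennreal C \<le> sobolev_norm m p F" if F: "F \<in> extensions m p E f" for F
    proof (rule divide_le_posI_ennreal)
      show "0 < ennreal C" using C0 by simp
      have "(\<Sum>k\<le>m. Lp_norm p (sharp m k E f)) \<le> (\<Sum>k\<le>m. ennreal A * sobolev_norm m p F)"
        using sharp_le F by (intro sum_mono) auto
      also have "\<dots> = ennreal (real (m + 1)) * (ennreal A * sobolev_norm m p F)"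
        by (simp add: ennreal_of_nat_eq_real_of_nat)
      also have "\<dots> = ennreal (real (m + 1) * A) * sobolev_norm m p F"
        using A by (subst ennreal_mult) (auto simp: mult.assoc)
      also have "\<dots> \<le> ennreal C * sobolev_norm m p F"
        by (intro mult_right_mono ennreal_leI) (auto simp: C_def)
      finally show "(\<Sum>k\<le>m. Lp_norm p (sharp m k E f)) \<le> ennreal C * sobolev_norm m p F" .
    qed
    then have le: "(\<Sum>k\<le>m. Lp_norm p (sharp m k E f)) / ennreal C \<le> trace_norm m p E f"
      unfolding trace_norm_def by (intro INF_greatest)
    have "(\<Sum>k\<le>m. Lp_norm p (sharp m k E f)) = ennreal C * ((\<Sum>k\<le>m. Lp_norm p (sharp m k E f)) / ennreal C)"
      using C0 by (simp add: ennreal_times_divide ennreal_mult_divide_eq mult.commute[of "ennreal C"])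
    also have "\<dots> \<le> ennreal C * trace_norm m p E f" by (rule mult_left_mono[OF le]) simp
    finally show "(\<Sum>k\<le>m. Lp_norm p (sharp m k E f)) \<le> ennreal C * trace_norm m p E f" .
  qed
  moreover have "1 \<le> C" using B by (simp add: C_def)
  moreover have "f \<in> trace_space m p E \<longleftrightarrow> (\<forall>k\<le>m. sharp m k E f \<in> Lp_ennreal p)" if "E \<noteq> {}" for E f
    using sharp_Lp extend that unfolding trace_space_def by blast
  ultimately show ?thesis by blast
qed

end
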